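(* Let $0<\kappa<1$ and let $\phi:\mathbb{R}^d\to\mathbb{R}$ be a $C^{1,\kappa}$ function such that (i) $\Omega=\phi^{-1}(0,\infty)$ is pre-compact, (ii) $|\nabla\phi|$ is bounded away from $0$ in a neighborhood of $\partial\Omega$. Let $X=(X_t)_{t\ge0}$ be a translation invariant isotropic process on $\mathbb{R}^d$ with càdlàg paths such that, for every $\varepsilon>0$, $$\lim_{t\downarrow 0}\frac{1}{\mu(t)}\,\mathbb{P}_0\Big(\sup_{0\le s\le t}X^{(1)}_s>\varepsilon\Big)=0,\qquad\text{where}\quad \mu(t)=\mathbb{E}_0\Big[\Big(\sup_{0\le s\le t}X^{(1)}_s\Big)\wedge 1\Big].$$ Then $$\mathrm{Per}(\Omega)\le\liminf_{t\downarrow0}\frac{\mathrm{Vol}(\Omega)-Q^X_\Omega(t)}{\mu(t)}\le\limsup_{t\downarrow0}\frac{\mathrm{Vol}(\Omega)-Q^X_\Omega(t)}{\mu(t)}\le\frac{\sup_{\partial\Omega}|\nabla\phi|}{\inf_{\partial\Omega}|\nabla\phi|}\,\mathrm{Per}(\Omega).$$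
   Context: $X=(X_t)_{t\ge0}$, $X_t=(X^{(1)}_t,\dots,X^{(d)}_t)$, is an $\mathbb{R}^d$-valued stochastic process with càdlàg paths; $\mathbb{P}_x$ (expectation $\mathbb{E}_x$) denotes the probability measure when $X_0=x$. Translation invariant isotropic means: for any $t\ge0$, $x\in\mathbb{R}^d$ and Borel set $A\subset\mathbb{R}^d$, $\mathbb{P}_x(X_t\in A)=\mathbb{P}_0(X_t+x\in A)$ and $\mathbb{P}_0(X_t\in A)=\mathbb{P}_0(UX_t\in A)$ for all $d\times d$ orthogonal matrices $U$. The spectral heat content of a bounded open set $\Omega\subset\mathbb{R}^d$ is $Q^X_\Omega(t)=\int_\Omega\mathbb{P}_x(\tau^X_\Omega>t)\,dx$, where $\tau^X_\Omega=\inf\{t\ge0:X_t\notin\Omega\}$. $\mathrm{Vol}(\Omega)$ is the volume of $\Omega$. The perimeter is $\mathrm{Per}(\Omega)=\sup\{\int_\Omega\sum_{i=1}^dD_i\varphi_i\,dx:\ \varphi_i\in C_c^\infty(\mathbb{R}^d),\ \sum_{i=1}^d\varphi_i^2\le1\}$. A function $f:\mathbb{R}^d\to\mathbb{R}$ is $C^{1,\kappa}$ if it is $C^1$ and there is $L>0$ with $|\nabla f(x)-\nabla f(y)|\le L|x-y|^\kappa$ for all $x,y\in\mathbb{R}^d$.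
   Formalization: Translation invariance and isotropy are required of the law of the whole process, not only of each X_t (with one-time laws alone the claim fails, e.g. Brownian under P_0 but x+√t N under P_x, Ω=(-1,1)); μ(t) is assumed nonzero for small t. *)

theory Defs
  imports "HOL-Probability.Probability"
begin

section \<open>Calculus on Euclidean space\<close>

definition partial :: "'n \<Rightarrow> (real ^ 'n::finite \<Rightarrow> real) \<Rightarrow> real ^ 'n \<Rightarrow> real" where
  "partial i f x = frechet_derivative f (at x) (axis i 1)"

definition grad :: "(real ^ 'n::finite \<Rightarrow> real) \<Rightarrow> real ^ 'n \<Rightarrow> real ^ 'n" where
  "grad f x = (\<chi> i. partial i f x)"

definition C1_kappa :: "real \<Rightarrow> (real ^ 'n::finite \<Rightarrow> real) \<Rightarrow> bool" where
  "C1_kappa \<kappa> f \<longleftrightarrow>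
     (\<forall>x. f differentiable (at x)) \<and> continuous_on UNIV (grad f) \<and>
     (\<exists>L>0. \<forall>x y. norm (grad f x - grad f y) \<le> L * norm (x - y) powr \<kappa>)"

primrec Ck :: "nat \<Rightarrow> (real ^ 'n::finite \<Rightarrow> real) \<Rightarrow> bool" where
  "Ck 0 f \<longleftrightarrow> continuous_on UNIV f"
| "Ck (Suc k) f \<longleftrightarrow> (\<forall>x. f differentiable (at x)) \<and> (\<forall>i. Ck k (partial i f))"

definition Cc_infinity :: "(real ^ 'n::finite \<Rightarrow> real) set" where
  "Cc_infinity = {f. (\<forall>k. Ck k f) \<and> compact (closure {x. f x \<noteq> 0})}"

definition perimeter :: "(real ^ 'n::finite) set \<Rightarrow> ereal" where
  "perimeter \<Omega> =
     (SUP \<phi> \<in> {\<phi> :: real ^ 'n \<Rightarrow> real ^ 'n.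
                 (\<forall>i. (\<lambda>x. \<phi> x $ i) \<in> Cc_infinity) \<and> (\<forall>x. (\<Sum>i\<in>UNIV. (\<phi> x $ i)\<^sup>2) \<le> 1)}.
        ereal (LINT x:\<Omega>|lborel. (\<Sum>i\<in>UNIV. partial i (\<lambda>y. \<phi> y $ i) x)))"

section \<open>Processes\<close>

text \<open>A process is a map \<open>X t \<omega>\<close>, of which only the times \<open>t \<ge> 0\<close> matter, together with one
  probability measure \<open>P x\<close> per starting point, all on the same measurable space.\<close>

definition cadlag :: "(real \<Rightarrow> 'a::topological_space) \<Rightarrow> bool" where
  "cadlag f \<longleftrightarrow> (\<forall>t\<ge>0. continuous (at_right t) f) \<and> (\<forall>t>0. \<exists>l. (f \<longlongrightarrow> l) (at_left t))"

definition cadlag_process ::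
    "(real ^ 'n::finite \<Rightarrow> 'w measure) \<Rightarrow> (real \<Rightarrow> 'w \<Rightarrow> real ^ 'n) \<Rightarrow> bool" where
  "cadlag_process P X \<longleftrightarrow>
     (\<forall>x. prob_space (P x)) \<and> (\<forall>x. sets (P x) = sets (P 0)) \<and>
     (\<forall>x. \<forall>t\<ge>0. X t \<in> borel_measurable (P x)) \<and>
     (\<forall>x. AE \<omega> in P x. X 0 \<omega> = x) \<and>
     (\<forall>\<omega> \<in> space (P 0). cadlag (\<lambda>t. X t \<omega>))"

definition path_law :: "'w measure \<Rightarrow> (real \<Rightarrow> 'w \<Rightarrow> real ^ 'n::finite) \<Rightarrow> (real \<Rightarrow> real ^ 'n) measure"
  where "path_law M Y = distr M (\<Pi>\<^sub>M t\<in>{0..}. borel) (\<lambda>\<omega>. \<lambda>t\<in>{0..}. Y t \<omega>)"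

text \<open>Both invariances are properties of the process, that is of the joint law of its values (the
  law on the product sigma-algebra, equivalently all finite-dimensional distributions). Equality of
  the one-time marginals alone would not relate the suprema and exit times of different starting
  points and directions: those are functionals of the whole path. The one-time identities are
  consequences, see \<open>translation_invariant_marginal\<close> and \<open>isotropic_marginal\<close>.\<close>

definition translation_invariant ::
    "(real ^ 'n::finite \<Rightarrow> 'w measure) \<Rightarrow> (real \<Rightarrow> 'w \<Rightarrow> real ^ 'n) \<Rightarrow> bool" where
  "translation_invariant P X \<longleftrightarrow> (\<forall>x. path_law (P x) X = path_law (P 0) (\<lambda>t \<omega>. X t \<omega> + x))"

definition isotropic ::
    "(real ^ 'n::finite \<Rightarrow> 'w measure) \<Rightarrow> (real \<Rightarrow> 'w \<Rightarrow> real ^ 'n) \<Rightarrow> bool" where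
  "isotropic P X \<longleftrightarrow>
     (\<forall>U :: real ^ 'n ^ 'n. orthogonal_matrix U \<longrightarrow>
        path_law (P 0) X = path_law (P 0) (\<lambda>t \<omega>. U *v X t \<omega>))"

lemma path_law_marginal:
  assumes "\<And>t. 0 \<le> t \<Longrightarrow> Y t \<in> borel_measurable M" "0 \<le> t" "A \<in> sets borel"
  shows "measure M {\<omega> \<in> space M. Y t \<omega> \<in> A} =
    measure (path_law M Y) {f \<in> space (\<Pi>\<^sub>M t\<in>{0..}. borel). f t \<in> A}"
proof -
  have "(\<lambda>\<omega>. \<lambda>t\<in>{0..}. Y t \<omega>) \<in> M \<rightarrow>\<^sub>M (\<Pi>\<^sub>M t\<in>{0..}. borel)"
    using assms(1) by (intro measurable_restrict) auto
  moreover have "{f \<in> space (\<Pi>\<^sub>M t\<in>{0..}. borel). f t \<in> A} \<in> sets (\<Pi>\<^sub>M t\<in>{0..}. borel)"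
    using assms(2,3) measurable_sets[OF measurable_component_singleton[of t "{0..}" "\<lambda>_. borel"], of A]
    by (simp add: vimage_def Int_def conj_commute)
  ultimately show ?thesis
    unfolding path_law_def using assms(2)
    by (subst measure_distr) (auto intro!: arg_cong[where f = "measure M"] simp: space_PiM)
qed

lemma translation_invariant_marginal:
  assumes "cadlag_process P X" "translation_invariant P X" "0 \<le> t" "A \<in> sets borel"
  shows "measure (P x) {\<omega> \<in> space (P x). X t \<omega> \<in> A} =
    measure (P 0) {\<omega> \<in> space (P 0). X t \<omega> + x \<in> A}"
proof -
  have "path_law (P x) X = path_law (P 0) (\<lambda>t \<omega>. X t \<omega> + x)"
    using assms(2) by (simp only: translation_invariant_def)
  moreover have "X t \<in> borel_measurable (P y)" if "0 \<le> t" for t y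
    using assms(1) that by (simp add: cadlag_process_def)
  ultimately show ?thesis
    using assms(3,4)
    by (simp add: path_law_marginal[of X] path_law_marginal[of "\<lambda>t \<omega>. X t \<omega> + x"])
qed

lemma isotropic_marginal:
  fixes U :: "real ^ 'n ^ 'n::finite"
  assumes "cadlag_process P X" "isotropic P X" "orthogonal_matrix U" "0 \<le> t" "A \<in> sets borel"
  shows "measure (P 0) {\<omega> \<in> space (P 0). X t \<omega> \<in> A} =
    measure (P 0) {\<omega> \<in> space (P 0). U *v X t \<omega> \<in> A}"
proof -
  have "path_law (P 0) X = path_law (P 0) (\<lambda>t \<omega>. U *v X t \<omega>)"
    using assms(2,3) by (simp only: isotropic_def)
  moreover have X: "X t \<in> borel_measurable (P 0)" if "0 \<le> t" for t
    using assms(1) that by (simp add: cadlag_process_def)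
  moreover have U: "(*v) U \<in> borel_measurable borel"
    by (intro borel_measurable_continuous_onI matrix_vector_mult_linear_continuous_on)
  have "(\<lambda>\<omega>. U *v X t \<omega>) \<in> borel_measurable (P 0)" if "0 \<le> t" for t
    using measurable_compose[OF X[OF that] U] .
  ultimately show ?thesis
    using assms(4,5)
    by (simp add: path_law_marginal[of X] path_law_marginal[of "\<lambda>t \<omega>. U *v X t \<omega>"])
qed

section \<open>Spectral heat content\<close>

definition exit_time :: "(real \<Rightarrow> 'w \<Rightarrow> 'a) \<Rightarrow> 'a set \<Rightarrow> 'w \<Rightarrow> ereal" where
  "exit_time X \<Omega> \<omega> = Inf (ereal ` {t. 0 \<le> t \<and> X t \<omega> \<notin> \<Omega>})"

text \<open>A cadlag path may approach the complement of an open set without ever entering it, so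
  \<open>exit_time X \<Omega> > t\<close> is not a countable combination of conditions on the \<open>X s\<close> and need only be
  measurable up to null sets. Hence the completions, of \<open>P x\<close> and (through \<open>lebesgue\<close>) of the
  measure in \<open>x\<close>; on measurable sets they agree with the original measures.\<close>

definition spectral_heat_content ::
    "(real ^ 'n::finite \<Rightarrow> 'w measure) \<Rightarrow> (real \<Rightarrow> 'w \<Rightarrow> real ^ 'n) \<Rightarrow> (real ^ 'n) set \<Rightarrow> real \<Rightarrow> real"
  where
  "spectral_heat_content P X \<Omega> t =
     (LINT x:\<Omega>|lebesgue. measure (completion (P x)) {\<omega> \<in> space (P x). exit_time X \<Omega> \<omega> > ereal t})"

definition running_sup :: "(real \<Rightarrow> 'w \<Rightarrow> real ^ 'n::finite) \<Rightarrow> 'n \<Rightarrow> real \<Rightarrow> 'w \<Rightarrow> real" where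
  "running_sup X k t \<omega> = (SUP s\<in>{0..t}. X s \<omega> $ k)"

definition mean_truncated_sup ::
    "(real ^ 'n::finite \<Rightarrow> 'w measure) \<Rightarrow> (real \<Rightarrow> 'w \<Rightarrow> real ^ 'n) \<Rightarrow> 'n \<Rightarrow> real \<Rightarrow> real" where
  "mean_truncated_sup P X k t = (LINT \<omega>|P 0. min (running_sup X k t \<omega>) 1)"

end

theory Submission
  imports Defs
begin

text \<open>
  The quotient converges to the perimeter itself; the ratio of gradients on the right, which is at
  least one when the frontier is nonempty, only weakens the upper estimate.

  Fix a small \<open>\<delta>\<close>. Dividing \<open>\<phi>\<close> by a smooth function close to \<open>norm (grad \<phi>)\<close> gives a continuously
  differentiable \<open>u\<close> with \<open>\<Omega> = {u > 0}\<close> and \<open>1 - \<delta> \<le> norm (grad u) \<le> 1 + \<delta>\<close> near the boundary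
  (\<open>normalized_defining_function\<close>), so that \<open>u\<close> is almost the distance to the complement. The volume of
  the layer \<open>{0 < u \<le> m}\<close>, divided by \<open>m\<close>, then approximates the perimeter as \<open>m\<close> tends to 0, up to
  factors that tend to 1 with \<open>\<delta>\<close> (\<open>perimeter_layer_volume\<close>). Indeed, integration by parts shows that
  the integral of the divergence of \<open>\<psi>\<close> over \<open>\<Omega>\<close> is the limit of the integral of \<open>- grad u \<bullet> \<psi>\<close> over
  the layer, divided by \<open>m\<close> (\<open>divergence_layer_limit\<close>). This is at most the normalized layer volume when \<open>norm \<psi> \<le> 1\<close>,
  and almost equal to it when \<open>\<psi>\<close> is a smooth approximation of \<open>- grad u / norm (grad u)\<close>. No surface
  measure and no coarea formula is needed.

  On the probabilistic side, let the path from the origin up to time \<open>t\<close> be confined to a small ball.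
  By the first-order expansion of \<open>u\<close>, the path started at \<open>x\<close> leaves \<open>\<Omega>\<close> if and only if \<open>u x\<close> is at
  most the supremum of the path in the direction of \<open>- grad u x\<close>, up to a factor near 1 and an error of
  \<open>\<delta>\<close> times the largest displacement (\<open>exit_criterion\<close>). By isotropy the joint law of this supremum
  and of the largest displacement does not depend on the direction (\<open>sup_law\<close>), so the direction may
  be replaced by a fixed coordinate direction \<open>k\<close>. After Tonelli's theorem the heat loss becomes the
  expected volume of a layer \<open>{0 < u \<le> Y}\<close> whose random thickness \<open>Y\<close> is close to the running
  supremum (\<open>heat_loss_upper\<close>, \<open>heat_loss_lower\<close>), that is, close to the perimeter times \<open>\<mu> t\<close>. The
  expected largest displacement, truncated at 1, is at most \<open>2 * CARD('n) * \<mu> t\<close>, and the paths that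
  leave the small ball contribute \<open>o(\<mu> t)\<close> by hypothesis.

  The event that the exit time exceeds \<open>t\<close> is not determined by countably many times. It lies between
  the event that the values at countably many times stay in some \<open>{u \<ge> 1 / n}\<close> and the event that they
  stay in \<open>{u > 0}\<close>. For a fixed path the starting points that distinguish these two events form a
  Lebesgue null set (\<open>null_set_touching\<close>), so for almost every \<open>x\<close> the two events have the same
  probability (\<open>survival_prob_AE\<close>).
\<close>

section \<open>Continuously differentiable functions\<close>

text \<open>Differentiability together with continuity of the gradient; the growth condition of
  \<open>C1_kappa\<close> is dropped.\<close>

definition C1 :: "(real ^ 'n::finite \<Rightarrow> real) \<Rightarrow> bool" where
  "C1 f \<longleftrightarrow> (\<forall>x. f differentiable (at x)) \<and> continuous_on UNIV (grad f)"

text \<open>The sum of the partial derivatives of the components, as in the definition of the perimeter.\<close>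

definition divergence :: "(real ^ 'n::finite \<Rightarrow> real ^ 'n) \<Rightarrow> real ^ 'n \<Rightarrow> real" where
  "divergence \<psi> x = (\<Sum>i\<in>UNIV. partial i (\<lambda>y. \<psi> y $ i) x)"

lemma has_derivative_grad:
  assumes "f differentiable (at x)"
  shows "(f has_derivative (\<lambda>h. grad f x \<bullet> h)) (at x)"
proof -
  let ?f' = "frechet_derivative f (at x)"
  have f': "(f has_derivative ?f') (at x)"
    using assms frechet_derivative_works by blast
  then have lin: "linear ?f'"
    by (rule has_derivative_linear)
  have "?f' h = grad f x \<bullet> h" for h
  proof -
    have "?f' h = ?f' (\<Sum>i\<in>UNIV. (h $ i) *\<^sub>R axis i 1)"
      by (metis basis_expansion scalar_mult_eq_scaleR)
    also have "\<dots> = (\<Sum>i\<in>UNIV. h $ i * ?f' (axis i 1))"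
      by (simp add: linear_sum[OF lin] linear_cmul[OF lin])
    also have "\<dots> = grad f x \<bullet> h"
      by (simp add: inner_vec_def grad_def partial_def mult.commute)
    finally show ?thesis .
  qed
  then have "?f' = (\<lambda>h. grad f x \<bullet> h)"
    by blast
  with f' show ?thesis by simp
qed

lemma grad_eqI:
  assumes "(f has_derivative (\<lambda>h. g \<bullet> h)) (at x)"
  shows "grad f x = g"
  using frechet_derivative_at[OF assms]
  by (simp add: grad_def partial_def vec_eq_iff inner_axis flip: frechet_derivative_at[OF assms])

lemma C1I:
  assumes "\<And>x. (f has_derivative (\<lambda>h. g x \<bullet> h)) (at x)" "continuous_on UNIV g"
  shows "C1 f" "grad f = g"
proof -
  show eq: "grad f = g" using grad_eqI[OF assms(1)] by blast
  show "C1 f" using assms unfolding C1_def eq by (auto simp: differentiable_def)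
qed

lemma C1_has_derivative: "C1 f \<Longrightarrow> (f has_derivative (\<lambda>h. grad f x \<bullet> h)) (at x)"
  by (simp add: C1_def has_derivative_grad)

lemma C1_continuous: "C1 f \<Longrightarrow> continuous_on S f"
  by (meson C1_has_derivative continuous_at_imp_continuous_on has_derivative_continuous)

lemma C1_continuous_grad: "C1 f \<Longrightarrow> continuous_on S (grad f)"
  by (auto simp: C1_def intro: continuous_on_subset)

lemma partial_eq_grad: "partial i f x = grad f x $ i"
  by (simp add: grad_def)

lemma C1_continuous_partial: "C1 f \<Longrightarrow> continuous_on S (partial i f)"
  unfolding partial_eq_grad[abs_def] by (intro continuous_intros C1_continuous_grad)

lemma continuous_on_divergence:
  "(\<And>i. C1 (\<lambda>x. \<psi> x $ i)) \<Longrightarrow> continuous_on S (divergence \<psi>)"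
  unfolding divergence_def[abs_def] by (intro continuous_intros C1_continuous_partial)

lemma C1I_partial:
  assumes "\<And>x. f differentiable (at x)" "\<And>i. continuous_on UNIV (partial i f)"
  shows "C1 f"
proof -
  have "continuous_on UNIV (\<lambda>x. \<chi> i. partial i f x)"
    by (intro continuous_on_vec_lambda assms(2))
  with assms(1) show ?thesis unfolding C1_def grad_def[abs_def] by blast
qed

lemma C1_add:
  assumes "C1 f" "C1 h"
  shows "C1 (\<lambda>x. f x + h x)" "grad (\<lambda>x. f x + h x) = (\<lambda>x. grad f x + grad h x)"
proof -
  have "((\<lambda>x. f x + h x) has_derivative (\<lambda>y. (grad f x + grad h x) \<bullet> y)) (at x)" for x
    using has_derivative_add[OF C1_has_derivative[OF assms(1)] C1_has_derivative[OF assms(2)], of x]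
    by (rule has_derivative_eq_rhs) (auto simp: algebra_simps)
  moreover have "continuous_on UNIV (\<lambda>x. grad f x + grad h x)"
    by (intro continuous_intros C1_continuous_grad assms)
  ultimately show "C1 (\<lambda>x. f x + h x)" "grad (\<lambda>x. f x + h x) = (\<lambda>x. grad f x + grad h x)"
    by (rule C1I)+
qed

lemma C1_minus_const:
  assumes "C1 u"
  shows "C1 (\<lambda>x. u x - m)" "grad (\<lambda>x. u x - m) = grad u"
proof -
  have "((\<lambda>x. u x - m) has_derivative (\<lambda>h. grad u x \<bullet> h)) (at x)" for x
    using has_derivative_diff[OF C1_has_derivative[OF assms] has_derivative_const] by simp
  then show "C1 (\<lambda>x. u x - m)" "grad (\<lambda>x. u x - m) = grad u"
    by (rule C1I; intro C1_continuous_grad assms)+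
qed

lemma C1_mult:
  assumes "C1 f" "C1 h"
  shows "C1 (\<lambda>x. f x * h x)" "grad (\<lambda>x. f x * h x) = (\<lambda>x. f x *\<^sub>R grad h x + h x *\<^sub>R grad f x)"
proof -
  have "((\<lambda>x. f x * h x) has_derivative (\<lambda>y. (f x *\<^sub>R grad h x + h x *\<^sub>R grad f x) \<bullet> y)) (at x)" for x
    using has_derivative_mult[OF C1_has_derivative[OF assms(1)] C1_has_derivative[OF assms(2)], of x]
    by (rule has_derivative_eq_rhs) (auto simp: algebra_simps)
  moreover have "continuous_on UNIV (\<lambda>x. f x *\<^sub>R grad h x + h x *\<^sub>R grad f x)"
    by (intro continuous_intros C1_continuous C1_continuous_grad assms)
  ultimately show "C1 (\<lambda>x. f x * h x)"
    "grad (\<lambda>x. f x * h x) = (\<lambda>x. f x *\<^sub>R grad h x + h x *\<^sub>R grad f x)"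
    by (rule C1I)+
qed

lemma C1_compose:
  assumes "C1 f" "\<And>s. (c has_real_derivative c' s) (at s)" "continuous_on UNIV c'"
  shows "C1 (\<lambda>x. c (f x))" "grad (\<lambda>x. c (f x)) = (\<lambda>x. c' (f x) *\<^sub>R grad f x)"
proof -
  have "((\<lambda>x. c (f x)) has_derivative (\<lambda>y. (c' (f x) *\<^sub>R grad f x) \<bullet> y)) (at x)" for x
    using has_derivative_compose[OF C1_has_derivative[OF assms(1)], of c "(*) (c' (f x))" x]
      assms(2)[of "f x"]
    by (simp add: has_field_derivative_def)
  moreover have "continuous_on UNIV (\<lambda>x. c' (f x) *\<^sub>R grad f x)"
    by (intro continuous_intros C1_continuous C1_continuous_grad assms
        continuous_on_compose2[OF assms(3)]) auto
  ultimately show "C1 (\<lambda>x. c (f x))" "grad (\<lambda>x. c (f x)) = (\<lambda>x. c' (f x) *\<^sub>R grad f x)"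
    by (rule C1I)+
qed

lemma C1_line_derivative:
  assumes "C1 u"
  shows "((\<lambda>s. u (x + s *\<^sub>R y)) has_real_derivative grad u (x + s *\<^sub>R y) \<bullet> y) (at s)"
proof -
  have "((\<lambda>s. u (x + s *\<^sub>R y)) has_derivative (\<lambda>h. grad u (x + s *\<^sub>R y) \<bullet> (h *\<^sub>R y))) (at s)"
    by (rule has_derivative_compose[OF _ C1_has_derivative[OF assms]]) (auto intro!: derivative_eq_intros)
  then show ?thesis
    by (simp add: has_field_derivative_def mult_commute_abs)
qed

lemma Cc_infinity_C1:
  assumes "f \<in> Cc_infinity"
  shows "C1 f"
proof -
  have *: "Ck 1 f" "Ck 2 f" using assms by (auto simp: Cc_infinity_def)
  have "continuous_on UNIV (partial i f)" for i
    using *(1) by simp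
  then have "continuous_on UNIV (grad f)"
    unfolding grad_def[abs_def] by (intro continuous_intros) auto
  then show ?thesis using * by (auto simp: C1_def numeral_2_eq_2)
qed

section \<open>Integration by parts on superlevel sets\<close>

lemma integrable_bounded_support:
  fixes f :: "real ^ 'n::finite \<Rightarrow> real"
  assumes "f \<in> borel_measurable borel" "bounded S" "S \<in> sets borel"
    and "\<And>x. norm (f x) \<le> B * indicator S x"
  shows "integrable lborel f"
proof (rule Bochner_Integration.integrable_bound[where f = "\<lambda>x. B * indicator S x"])
  show "integrable lborel (\<lambda>x. B * indicator S x)"
    using assms(2,3) by (auto intro!: integrable_mult_right emeasure_bounded_finite)
  show "AE x in lborel. norm (f x) \<le> norm (B * indicator S x)"
    using assms(4) by (intro AE_I2) (metis abs_ge_self order_trans real_norm_def)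
qed (use assms in auto)

text \<open>Translation invariance of Lebesgue measure makes the integral of every difference quotient of
  \<open>w\<close> vanish; dominated convergence carries this over to the partial derivative.\<close>

lemma integral_partial_eq_0:
  fixes w :: "real ^ 'n::finite \<Rightarrow> real"
  assumes w: "C1 w" and bd: "bounded {x. w x \<noteq> 0}"
  shows "integrable lborel (partial i w)" "(LINT x|lborel. partial i w x) = 0"
proof -
  obtain R where R: "\<And>x. w x \<noteq> 0 \<Longrightarrow> norm x \<le> R"
    using bd by (auto simp: bounded_iff)
  let ?e = "axis i 1 :: real ^ 'n"
  have "bounded (partial i w ` cball 0 (R + 2))"
    by (intro compact_imp_bounded compact_continuous_image C1_continuous_partial w) auto
  then obtain B where B: "\<And>x. x \<in> cball 0 (R + 2) \<Longrightarrow> \<bar>partial i w x\<bar> \<le> B"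
    by (fastforce simp: bounded_iff)
  define W where "W n x = real (Suc n) * (w (x + (1 / real (Suc n)) *\<^sub>R ?e) - w x)" for n x
  have deriv: "((\<lambda>s. w (x + s *\<^sub>R ?e)) has_real_derivative partial i w (x + s *\<^sub>R ?e)) (at s)" for x s
    using C1_line_derivative[OF w, of x ?e s] by (simp add: inner_axis partial_eq_grad)
  have cw: "w \<in> borel_measurable borel"
    by (intro borel_measurable_continuous_onI C1_continuous w)
  have iw: "integrable lborel w"
  proof -
    have "integrable lborel (\<lambda>x. indicator (cball 0 R) x *\<^sub>R w x)"
      by (intro borel_integrable_compact C1_continuous w) auto
    also have "(\<lambda>x. indicator (cball 0 R) x *\<^sub>R w x) = w"
      using R by (auto simp: fun_eq_iff indicator_def)
    finally show ?thesis .
  qed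
  have int_W: "integral\<^sup>L lborel (W n) = 0" for n
  proof -
    let ?c = "(1 / real (Suc n)) *\<^sub>R ?e"
    have "integrable (distr lborel borel ((+) ?c)) w"
      using iw by (simp add: lborel_distr_plus)
    then have i2: "integrable lborel (\<lambda>x. w (x + ?c))"
      by (subst (asm) integrable_distr_eq) (use cw in \<open>auto simp: add.commute\<close>)
    have "(LINT x|lborel. w (x + ?c)) = (LINT x|distr lborel borel ((+) ?c). w x)"
      by (subst integral_distr) (use cw in \<open>auto simp: add.commute\<close>)
    also have "\<dots> = (LINT x|lborel. w x)"
      by (simp add: lborel_distr_plus)
    finally show ?thesis
      unfolding W_def using iw i2 by simp
  qed
  have bound: "norm (W n x) \<le> B * indicator (cball 0 (R + 1)) x" for n x
  proof (cases "x \<in> cball 0 (R + 1)")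
    case True
    have le1: "1 / real (Suc n) \<le> 1" by simp
    have "\<exists>z>0. z < 1 / real (Suc n) \<and> w (x + (1 / real (Suc n)) *\<^sub>R ?e) - w (x + 0 *\<^sub>R ?e)
        = (1 / real (Suc n) - 0) * partial i w (x + z *\<^sub>R ?e)"
      by (rule MVT2) (auto intro: deriv)
    then obtain z where z: "0 < z" "z < 1 / real (Suc n)" "W n x = partial i w (x + z *\<^sub>R ?e)"
      by (auto simp: W_def field_simps)
    have "norm (x + z *\<^sub>R ?e) \<le> R + 2"
      using norm_triangle_ineq[of x "z *\<^sub>R ?e"] z(1,2) order_less_le_trans[OF z(2) le1] True by simp
    then show ?thesis using B[of "x + z *\<^sub>R ?e"] z True by simp
  next
    case False
    then have "norm x > R + 1" by simp
    moreover have "norm x \<le> norm (x + (1 / real (Suc n)) *\<^sub>R ?e) + 1 / real (Suc n)"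
      using norm_triangle_ineq4[of "x + (1 / real (Suc n)) *\<^sub>R ?e" "(1 / real (Suc n)) *\<^sub>R ?e"] by simp
    moreover have "1 / real (Suc n) \<le> 1" by simp
    ultimately have "w x = 0" "w (x + (1 / real (Suc n)) *\<^sub>R ?e) = 0"
      using R by (smt (verit))+
    then show ?thesis using False by (simp add: W_def)
  qed
  have lim: "(\<lambda>n. W n x) \<longlonglongrightarrow> partial i w x" for x
  proof -
    have "((\<lambda>h. (w (x + h *\<^sub>R ?e) - w x) / h) \<longlongrightarrow> partial i w x) (at 0)"
      using deriv[of x 0] by (simp add: DERIV_def)
    moreover have "filterlim (\<lambda>n. 1 / real (Suc n)) (at 0) sequentially"
      using LIMSEQ_inverse_real_of_nat by (auto simp: filterlim_at inverse_eq_divide)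
    ultimately have "(\<lambda>n. (w (x + (1 / real (Suc n)) *\<^sub>R ?e) - w x) / (1 / real (Suc n)))
        \<longlonglongrightarrow> partial i w x"
      by (rule filterlim_compose)
    then show ?thesis by (simp add: W_def mult.commute)
  qed
  have mW: "W n \<in> borel_measurable lborel" for n
    unfolding W_def using cw by measurable
  have mp: "partial i w \<in> borel_measurable lborel"
    using borel_measurable_continuous_onI[OF C1_continuous_partial[OF w]] by simp
  have ib: "integrable lborel (\<lambda>x. B * indicator (cball 0 (R + 1)) x)"
    by (intro integrable_mult_right) (auto intro!: emeasure_bounded_finite)
  show "integrable lborel (partial i w)"
    by (rule integrable_dominated_convergence[of _ _ W, OF mp mW ib]) (use lim bound in auto)
  have "(\<lambda>n. integral\<^sup>L lborel (W n)) \<longlonglongrightarrow> integral\<^sup>L lborel (partial i w)"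
    by (rule integral_dominated_convergence[of _ _ W, OF mp mW ib]) (use lim bound in auto)
  then show "(LINT x|lborel. partial i w x) = 0"
    by (simp add: int_W LIMSEQ_const_iff)
qed

lemma has_real_derivative_max_0_square:
  "((\<lambda>s::real. (max 0 s)\<^sup>2 / 2) has_real_derivative max 0 s) (at s)"
proof -
  consider "s < 0" | "s = 0" | "s > 0" by linarith
  then show ?thesis
  proof cases
    case 1
    have "((\<lambda>s::real. 0) has_real_derivative 0) (at s)" by simp
    moreover have "\<forall>\<^sub>F x in nhds s. (0::real) = (max 0 x)\<^sup>2 / 2"
      using eventually_nhds_in_open[of "{..<0}" s] 1 by (auto elim: eventually_mono)
    ultimately show ?thesis
      using 1 DERIV_cong_ev[of s s "\<lambda>_. 0" "\<lambda>s. (max 0 s)\<^sup>2 / 2" 0 0] by simp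
  next
    case 2
    have "((\<lambda>h::real. (max 0 h)\<^sup>2 / 2 / h) \<longlongrightarrow> 0) (at 0)"
    proof (rule Lim_null_comparison)
      show "\<forall>\<^sub>F h::real in at 0. norm ((max 0 h)\<^sup>2 / 2 / h) \<le> \<bar>h\<bar>"
        by (rule always_eventually) (auto simp: max_def power2_eq_square)
      show "((\<lambda>h::real. \<bar>h\<bar>) \<longlongrightarrow> 0) (at 0)" by (simp add: tendsto_rabs_zero)
    qed
    then show ?thesis using 2 by (simp add: DERIV_def)
  next
    case 3
    have "((\<lambda>s::real. s\<^sup>2 / 2) has_real_derivative s) (at s)"
      by (auto intro!: derivative_eq_intros)
    moreover have "\<forall>\<^sub>F x in nhds s. x\<^sup>2 / 2 = (max 0 x)\<^sup>2 / 2"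
      using eventually_nhds_in_open[of "{0<..}" s] 3 by (auto elim!: eventually_mono simp: max_def)
    ultimately show ?thesis
      using 3 DERIV_cong_ev[of s s "\<lambda>s. s\<^sup>2 / 2" "\<lambda>s. (max 0 s)\<^sup>2 / 2" s s] by simp
  qed
qed

text \<open>A continuously differentiable approximation of the positive part, obtained as a difference
  quotient of \<open>(max 0 s)\<^sup>2 / 2\<close> with step \<open>h\<close>.\<close>

definition smooth_pos :: "real \<Rightarrow> real \<Rightarrow> real" where
  "smooth_pos h s = ((max 0 s)\<^sup>2 / 2 - (max 0 (s - h))\<^sup>2 / 2) / h"

text \<open>The derivative of \<open>smooth_pos h\<close>; it lies between 0 and 1 and increases to the indicator of the
  positive half-line as \<open>h\<close> decreases to 0.\<close>

definition smooth_pos_deriv :: "real \<Rightarrow> real \<Rightarrow> real" where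
  "smooth_pos_deriv h s = (max 0 s - max 0 (s - h)) / h"

lemma smooth_pos_has_derivative:
  "(smooth_pos h has_real_derivative smooth_pos_deriv h s) (at s)"
proof -
  have 1: "((\<lambda>s. (max 0 (s - h))\<^sup>2 / 2) has_real_derivative max 0 (s - h) * (1 - 0)) (at s)"
    by (rule DERIV_chain2[OF has_real_derivative_max_0_square]) (intro derivative_intros)
  show ?thesis
    unfolding smooth_pos_def[abs_def] smooth_pos_deriv_def
    by (rule DERIV_cdivide, rule DERIV_diff[OF has_real_derivative_max_0_square]) (use 1 in simp)
qed

lemma continuous_on_smooth_pos_deriv: "continuous_on S (smooth_pos_deriv h)"
  unfolding smooth_pos_deriv_def[abs_def] divide_inverse by (intro continuous_intros)

lemma smooth_pos_nonpos:
  "0 < h \<Longrightarrow> s \<le> 0 \<Longrightarrow> smooth_pos h s = 0" "0 < h \<Longrightarrow> s \<le> 0 \<Longrightarrow> smooth_pos_deriv h s = 0"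
  by (auto simp: smooth_pos_def smooth_pos_deriv_def max_def)

lemma smooth_pos_deriv_bounds:
  "0 < h \<Longrightarrow> 0 \<le> smooth_pos_deriv h s" "0 < h \<Longrightarrow> smooth_pos_deriv h s \<le> 1"
  by (auto simp: smooth_pos_deriv_def max_def)

lemma smooth_pos_bounds:
  assumes h: "0 < h"
  shows "0 \<le> smooth_pos h s" "smooth_pos h s \<le> max 0 s"
proof -
  show "0 \<le> smooth_pos h s"
    unfolding smooth_pos_def using h by (intro divide_nonneg_nonneg) (auto simp: max_def power_mono)
  have "(max 0 s)\<^sup>2 / 2 - (max 0 (s - h))\<^sup>2 / 2 \<le> max 0 s * h"
  proof -
    consider "s \<le> 0" | "0 < s" "s \<le> h" | "h < s" by linarith
    then show ?thesis
    proof cases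
      case 2
      then have "s * s \<le> s * h" by (intro mult_left_mono) auto
      moreover have "0 \<le> s * h" using 2 by simp
      ultimately show ?thesis using 2 by (simp add: power2_eq_square max_def)
    next
      case 3
      have "s\<^sup>2 / 2 - (s - h)\<^sup>2 / 2 = s * h - h\<^sup>2 / 2"
        by (simp add: power2_eq_square field_simps)
      then show ?thesis using h 3 by (simp add: max_def)
    qed (use h in \<open>simp add: max_def\<close>)
  qed
  then show "smooth_pos h s \<le> max 0 s"
    unfolding smooth_pos_def using h by (simp add: divide_le_eq)
qed

lemma smooth_pos_deriv_LIMSEQ:
  "(\<lambda>n. smooth_pos_deriv (inverse (real (Suc n))) s) \<longlonglongrightarrow> indicator {0<..} s"
proof (cases "s \<le> 0")
  case False
  then have "\<forall>\<^sub>F n in sequentially. inverse (real (Suc n)) < s"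
    using order_tendstoD(2)[OF LIMSEQ_inverse_real_of_nat, of s] by simp
  then have "\<forall>\<^sub>F n in sequentially. smooth_pos_deriv (inverse (real (Suc n))) s = 1"
    by eventually_elim (use False in \<open>auto simp: smooth_pos_deriv_def max_def\<close>)
  then show ?thesis using False by (simp add: tendsto_eventually)
qed (simp add: smooth_pos_nonpos)

lemma smooth_pos_LIMSEQ: "(\<lambda>n. smooth_pos (inverse (real (Suc n))) s) \<longlonglongrightarrow> max 0 s"
proof (cases "s \<le> 0")
  case False
  have *: "s - h / 2 = smooth_pos h s" if "h < s" "0 < h" for h
    using that by (simp add: smooth_pos_def max_def power2_eq_square field_simps)
  have "\<forall>\<^sub>F n in sequentially. inverse (real (Suc n)) < s"
    using False order_tendstoD(2)[OF LIMSEQ_inverse_real_of_nat, of s] by simp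
  then have "\<forall>\<^sub>F n in sequentially. s - inverse (real (Suc n)) / 2 = smooth_pos (inverse (real (Suc n))) s"
    by eventually_elim (rule *, auto)
  moreover have "(\<lambda>n. s - inverse (real (Suc n)) / 2) \<longlonglongrightarrow> s - 0 / 2"
    using LIMSEQ_inverse_real_of_nat by (intro tendsto_intros) auto
  ultimately show ?thesis using False by (auto intro: Lim_transform_eventually simp: max_def)
qed (simp add: smooth_pos_nonpos)

text \<open>Integration by parts for the positive part of \<open>u\<close>. No measure on the level set \<open>u = 0\<close>
  enters, since the positive part vanishes there. The identity holds for \<open>smooth_pos h\<close> in place of the
  positive part, and \<open>h\<close> tends to 0. Only the superlevel set, not the support of \<open>\<psi>\<close>, has to be
  bounded.\<close>

lemma integral_pos_part_divergence:
  fixes u :: "real ^ 'n::finite \<Rightarrow> real"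
  assumes u: "C1 u" and bd: "bounded {x. 0 < u x}" and \<psi>: "\<And>i. C1 (\<lambda>x. \<psi> x $ i)"
  shows "integrable lborel (\<lambda>x. max 0 (u x) * divergence \<psi> x)"
    "integrable lborel (\<lambda>x. indicator {x. 0 < u x} x * (grad u x \<bullet> \<psi> x))"
    "(LINT x|lborel. max 0 (u x) * divergence \<psi> x)
      = - (LINT x|lborel. indicator {x. 0 < u x} x * (grad u x \<bullet> \<psi> x))"
proof -
  let ?\<Omega> = "{x. 0 < u x}"
  define h where "h n = inverse (real (Suc n))" for n
  have h: "0 < h n" for n by (simp add: h_def)
  have c\<psi>: "continuous_on S \<psi>" for S
  proof -
    have "continuous_on S (\<lambda>x. \<chi> i. \<psi> x $ i)"
      by (intro continuous_intros C1_continuous[OF \<psi>])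
    then show ?thesis by simp
  qed
  have cpt: "compact (closure ?\<Omega>)" using bd by simp
  have [measurable]: "u \<in> borel_measurable borel"
    by (intro borel_measurable_continuous_onI C1_continuous u)
  have md[measurable]: "divergence \<psi> \<in> borel_measurable borel"
    by (intro borel_measurable_continuous_onI continuous_on_divergence \<psi>)
  have mg[measurable]: "(\<lambda>x. grad u x \<bullet> \<psi> x) \<in> borel_measurable borel"
    by (intro borel_measurable_continuous_onI continuous_intros c\<psi> C1_continuous_grad u)
  have m\<Omega>[measurable]: "?\<Omega> \<in> sets borel" by measurable
  have "bounded ((\<lambda>x. max 0 (u x) * divergence \<psi> x) ` closure ?\<Omega>)"
    by (intro compact_imp_bounded compact_continuous_image cpt continuous_intros C1_continuous u
        continuous_on_divergence \<psi>)
  then obtain B1 where B1: "\<And>x. x \<in> ?\<Omega> \<Longrightarrow> \<bar>max 0 (u x) * divergence \<psi> x\<bar> \<le> B1"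
    unfolding bounded_iff using closure_subset by (metis (no_types, lifting) image_eqI real_norm_def subsetD)
  have "bounded ((\<lambda>x. grad u x \<bullet> \<psi> x) ` closure ?\<Omega>)"
    by (intro compact_imp_bounded compact_continuous_image cpt continuous_intros c\<psi> C1_continuous_grad u)
  then obtain B2 where B2: "\<And>x. x \<in> ?\<Omega> \<Longrightarrow> \<bar>grad u x \<bullet> \<psi> x\<bar> \<le> B2"
    unfolding bounded_iff using closure_subset by (metis (no_types, lifting) image_eqI real_norm_def subsetD)
  have ib: "integrable lborel (\<lambda>x. B * indicator ?\<Omega> x)" for B :: real
    using bd m\<Omega> by (auto intro!: integrable_mult_right emeasure_bounded_finite)
  note Cn = C1_compose[OF u smooth_pos_has_derivative continuous_on_smooth_pos_deriv]
  have part: "(\<Sum>i\<in>UNIV. partial i (\<lambda>x. smooth_pos (h n) (u x) * \<psi> x $ i) x)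
      = smooth_pos (h n) (u x) * divergence \<psi> x + smooth_pos_deriv (h n) (u x) * (grad u x \<bullet> \<psi> x)" for n x
    unfolding partial_eq_grad C1_mult(2)[OF Cn(1) \<psi>] Cn(2)
    by (simp add: divergence_def partial_eq_grad sum.distrib inner_vec_def sum_distrib_left algebra_simps)
  have zero: "bounded {x. smooth_pos (h n) (u x) * \<psi> x $ i \<noteq> 0}" for n i
    by (rule bounded_subset[OF bd]) (auto intro: ccontr simp: smooth_pos_nonpos[OF h] simp flip: not_le)
  have i1: "norm (smooth_pos (h n) (u x) * divergence \<psi> x) \<le> B1 * indicator ?\<Omega> x" for n x
  proof (cases "x \<in> ?\<Omega>")
    case True
    have "\<bar>smooth_pos (h n) (u x) * divergence \<psi> x\<bar> \<le> \<bar>max 0 (u x) * divergence \<psi> x\<bar>"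
      unfolding abs_mult using smooth_pos_bounds[OF h, of n "u x"] by (intro mult_right_mono) auto
    then show ?thesis using B1[OF True] True by simp
  qed (use h in \<open>simp add: smooth_pos_nonpos\<close>)
  have i2: "norm (smooth_pos_deriv (h n) (u x) * (grad u x \<bullet> \<psi> x)) \<le> B2 * indicator ?\<Omega> x" for n x
  proof (cases "x \<in> ?\<Omega>")
    case True
    have "\<bar>smooth_pos_deriv (h n) (u x) * (grad u x \<bullet> \<psi> x)\<bar> \<le> 1 * \<bar>grad u x \<bullet> \<psi> x\<bar>"
      unfolding abs_mult using smooth_pos_deriv_bounds[OF h, of n "u x"] by (intro mult_right_mono) auto
    then show ?thesis using B2[OF True] True by simp
  qed (use h in \<open>simp add: smooth_pos_nonpos\<close>)
  have m1: "(\<lambda>x. smooth_pos (h n) (u x) * divergence \<psi> x) \<in> borel_measurable borel" for n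
    using borel_measurable_continuous_onI[OF C1_continuous[OF Cn(1)]] by measurable
  have m2: "(\<lambda>x. smooth_pos_deriv (h n) (u x) * (grad u x \<bullet> \<psi> x)) \<in> borel_measurable borel" for n
    using measurable_compose[OF \<open>u \<in> borel_measurable borel\<close>
        borel_measurable_continuous_onI[OF continuous_on_smooth_pos_deriv]] by measurable
  have I1: "integrable lborel (\<lambda>x. smooth_pos (h n) (u x) * divergence \<psi> x)" for n
    by (rule integrable_bounded_support[OF m1 bd m\<Omega> i1])
  have I2: "integrable lborel (\<lambda>x. smooth_pos_deriv (h n) (u x) * (grad u x \<bullet> \<psi> x))" for n
    by (rule integrable_bounded_support[OF m2 bd m\<Omega> i2])
  have eq: "(LINT x|lborel. smooth_pos (h n) (u x) * divergence \<psi> x)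
      = - (LINT x|lborel. smooth_pos_deriv (h n) (u x) * (grad u x \<bullet> \<psi> x))" for n
  proof -
    have "0 = (\<Sum>i\<in>UNIV. LINT x|lborel. partial i (\<lambda>x. smooth_pos (h n) (u x) * \<psi> x $ i) x)"
      by (simp add: integral_partial_eq_0(2)[OF C1_mult(1)[OF Cn(1) \<psi>] zero])
    also have "\<dots> = (LINT x|lborel. (\<Sum>i\<in>UNIV. partial i (\<lambda>x. smooth_pos (h n) (u x) * \<psi> x $ i) x))"
      by (rule Bochner_Integration.integral_sum[symmetric])
        (rule integral_partial_eq_0(1)[OF C1_mult(1)[OF Cn(1) \<psi>] zero])
    also have "\<dots> = (LINT x|lborel. smooth_pos (h n) (u x) * divergence \<psi> x)
        + (LINT x|lborel. smooth_pos_deriv (h n) (u x) * (grad u x \<bullet> \<psi> x))"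
      unfolding part by (rule Bochner_Integration.integral_add[OF I1 I2])
    finally show ?thesis by linarith
  qed
  have M1: "(\<lambda>x. max 0 (u x) * divergence \<psi> x) \<in> borel_measurable lborel"
    and M2: "(\<lambda>x. indicator ?\<Omega> x * (grad u x \<bullet> \<psi> x)) \<in> borel_measurable lborel"
    by measurable
  have l1: "(\<lambda>n. smooth_pos (h n) (u x) * divergence \<psi> x) \<longlonglongrightarrow> max 0 (u x) * divergence \<psi> x" for x
    unfolding h_def by (intro tendsto_intros smooth_pos_LIMSEQ)
  have l2: "(\<lambda>n. smooth_pos_deriv (h n) (u x) * (grad u x \<bullet> \<psi> x))
      \<longlonglongrightarrow> indicator ?\<Omega> x * (grad u x \<bullet> \<psi> x)" for x
    using tendsto_mult_right[OF smooth_pos_deriv_LIMSEQ[of "u x"]] by (simp add: indicator_def h_def)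
  show "integrable lborel (\<lambda>x. max 0 (u x) * divergence \<psi> x)"
    by (rule integrable_dominated_convergence[OF M1 _ ib[of B1] AE_I2[OF l1] AE_I2[OF i1]])
      (use m1 in auto)
  show "integrable lborel (\<lambda>x. indicator ?\<Omega> x * (grad u x \<bullet> \<psi> x))"
    by (rule integrable_dominated_convergence[OF M2 _ ib[of B2] AE_I2[OF l2] AE_I2[OF i2]])
      (use m2 in auto)
  have L1: "(\<lambda>n. LINT x|lborel. smooth_pos (h n) (u x) * divergence \<psi> x)
      \<longlonglongrightarrow> (LINT x|lborel. max 0 (u x) * divergence \<psi> x)"
    by (rule integral_dominated_convergence[OF M1 _ ib[of B1] AE_I2[OF l1] AE_I2[OF i1]])
      (use m1 in auto)
  have L2: "(\<lambda>n. LINT x|lborel. smooth_pos_deriv (h n) (u x) * (grad u x \<bullet> \<psi> x))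
      \<longlonglongrightarrow> (LINT x|lborel. indicator ?\<Omega> x * (grad u x \<bullet> \<psi> x))"
    by (rule integral_dominated_convergence[OF M2 _ ib[of B2] AE_I2[OF l2] AE_I2[OF i2]])
      (use m2 in auto)
  show "(LINT x|lborel. max 0 (u x) * divergence \<psi> x)
      = - (LINT x|lborel. indicator ?\<Omega> x * (grad u x \<bullet> \<psi> x))"
    using L1[unfolded eq] tendsto_minus[OF L2] by (rule LIMSEQ_unique)
qed

text \<open>The flux of \<open>\<psi>\<close> out of \<open>{u > 0}\<close> as a limit over thin inner layers.\<close>

lemma divergence_layer_limit:
  fixes u :: "real ^ 'n::finite \<Rightarrow> real"
  assumes u: "C1 u" and bd: "bounded {x. 0 < u x}" and \<psi>: "\<And>i. C1 (\<lambda>x. \<psi> x $ i)"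
  shows "((\<lambda>m. (LINT x|lborel. indicator {x. 0 < u x \<and> u x \<le> m} x * (- (grad u x \<bullet> \<psi> x))) / m)
    \<longlongrightarrow> (LINT x:{x. 0 < u x}|lborel. divergence \<psi> x)) (at_right 0)"
proof -
  let ?\<Omega> = "{x. 0 < u x}"
  have cpt: "compact (closure ?\<Omega>)" using bd by simp
  have [measurable]: "u \<in> borel_measurable borel"
    by (intro borel_measurable_continuous_onI C1_continuous u)
  have md[measurable]: "divergence \<psi> \<in> borel_measurable borel"
    by (intro borel_measurable_continuous_onI continuous_on_divergence \<psi>)
  have m\<Omega>[measurable]: "?\<Omega> \<in> sets borel" by measurable
  have "bounded (divergence \<psi> ` closure ?\<Omega>)"
    by (intro compact_imp_bounded compact_continuous_image cpt continuous_on_divergence \<psi>)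
  then obtain B where B: "\<And>x. x \<in> ?\<Omega> \<Longrightarrow> \<bar>divergence \<psi> x\<bar> \<le> B"
    unfolding bounded_iff using closure_subset by (metis (no_types, lifting) image_eqI real_norm_def subsetD)
  \<comment> \<open>Both \<open>min (max 0 u) m\<close> and the indicator of the layer are differences of the corresponding
    functions for \<open>u\<close> and for \<open>u - m\<close>.\<close>
  have eq: "(LINT x|lborel. (min (max 0 (u x)) m / m) * divergence \<psi> x)
    = (LINT x|lborel. indicator {x. 0 < u x \<and> u x \<le> m} x * (- (grad u x \<bullet> \<psi> x))) / m" if m: "0 < m" for m
  proof -
    have bd2: "bounded {x. 0 < u x - m}"
      by (rule bounded_subset[OF bd]) (use m in auto)
    note I = integral_pos_part_divergence[OF u bd \<psi>]
    note J = integral_pos_part_divergence[OF C1_minus_const(1)[OF u, of m] bd2 \<psi>, unfolded C1_minus_const(2)[OF u]]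
    have "(LINT x|lborel. (min (max 0 (u x)) m / m) * divergence \<psi> x)
      = (LINT x|lborel. (max 0 (u x) * divergence \<psi> x - max 0 (u x - m) * divergence \<psi> x) / m)"
      using m by (intro Bochner_Integration.integral_cong) (auto simp: max_def min_def field_simps)
    also have "\<dots> = ((LINT x|lborel. max 0 (u x) * divergence \<psi> x)
        - (LINT x|lborel. max 0 (u x - m) * divergence \<psi> x)) / m"
      using Bochner_Integration.integral_diff[OF I(1) J(1)] by simp
    also have "(LINT x|lborel. max 0 (u x) * divergence \<psi> x)
        - (LINT x|lborel. max 0 (u x - m) * divergence \<psi> x)
        = (LINT x|lborel. indicator {x. 0 < u x - m} x * (grad u x \<bullet> \<psi> x)
            - indicator {x. 0 < u x} x * (grad u x \<bullet> \<psi> x))"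
      unfolding Bochner_Integration.integral_diff[OF J(2) I(2)] I(3) J(3) by simp
    also have "\<dots> = (LINT x|lborel. indicator {x. 0 < u x \<and> u x \<le> m} x * (- (grad u x \<bullet> \<psi> x)))"
      using m by (intro Bochner_Integration.integral_cong) (auto simp: indicator_def)
    finally show ?thesis .
  qed
  have "((\<lambda>m. LINT x|lborel. (min (max 0 (u x)) m / m) * divergence \<psi> x)
      \<longlongrightarrow> (LINT x|lborel. indicator ?\<Omega> x * divergence \<psi> x)) (at_right 0)"
    unfolding tendsto_at_iff_sequentially comp_def
  proof (intro allI impI)
    fix X :: "nat \<Rightarrow> real"
    assume X: "\<forall>i. X i \<in> {0<..} - {0}" "X \<longlonglongrightarrow> 0"
    show "(\<lambda>n. LINT x|lborel. (min (max 0 (u x)) (X n) / X n) * divergence \<psi> x)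
      \<longlonglongrightarrow> (LINT x|lborel. indicator ?\<Omega> x * divergence \<psi> x)"
    proof (rule integral_dominated_convergence[where w = "\<lambda>x. B * indicator ?\<Omega> x"])
      show "integrable lborel (\<lambda>x. B * indicator ?\<Omega> x)"
        using bd m\<Omega> by (auto intro!: integrable_mult_right emeasure_bounded_finite)
      show "AE x in lborel. (\<lambda>n. (min (max 0 (u x)) (X n) / X n) * divergence \<psi> x)
          \<longlonglongrightarrow> indicator ?\<Omega> x * divergence \<psi> x"
      proof (intro AE_I2 tendsto_mult_right)
        fix x
        show "(\<lambda>n. min (max 0 (u x)) (X n) / X n) \<longlonglongrightarrow> indicator ?\<Omega> x"
        proof (cases "0 < u x")
          case True
          then have "\<forall>\<^sub>F n in sequentially. X n < u x"
            using X(2) by (simp add: order_tendstoD)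
          then have "\<forall>\<^sub>F n in sequentially. min (max 0 (u x)) (X n) / X n = 1"
            by eventually_elim (use X(1) True in \<open>simp add: min_def less_imp_neq[symmetric]\<close>)
          then show ?thesis using True by (simp add: tendsto_eventually)
        next
          case False
          then show ?thesis using X(1) by (auto simp: max_def min_def less_le)
        qed
      qed
      show "AE x in lborel. norm ((min (max 0 (u x)) (X n) / X n) * divergence \<psi> x) \<le> B * indicator ?\<Omega> x" for n
      proof (intro AE_I2)
        fix x
        have Xn: "X n > 0" using X(1) by simp
        show "norm ((min (max 0 (u x)) (X n) / X n) * divergence \<psi> x) \<le> B * indicator ?\<Omega> x"
        proof (cases "0 < u x")
          case True
          have "\<bar>min (max 0 (u x)) (X n) / X n\<bar> * \<bar>divergence \<psi> x\<bar> \<le> 1 * \<bar>divergence \<psi> x\<bar>"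
            using Xn by (intro mult_right_mono) (auto simp: min_def max_def)
          then show ?thesis using B[of x] True by (simp add: abs_mult)
        qed (use Xn in \<open>auto simp: max_def min_def\<close>)
      qed
    qed measurable
  qed
  moreover have "\<forall>\<^sub>F m in at_right 0. (LINT x|lborel. (min (max 0 (u x)) m / m) * divergence \<psi> x)
    = (LINT x|lborel. indicator {x. 0 < u x \<and> u x \<le> m} x * (- (grad u x \<bullet> \<psi> x))) / m"
    using eq by (auto simp: eventually_at_right_less intro: eventually_mono[OF eventually_at_right_less])
  ultimately have "((\<lambda>m. (LINT x|lborel. indicator {x. 0 < u x \<and> u x \<le> m} x * (- (grad u x \<bullet> \<psi> x))) / m)
    \<longlongrightarrow> (LINT x|lborel. indicator ?\<Omega> x * divergence \<psi> x)) (at_right 0)"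
    by (rule Lim_transform_eventually)
  then show ?thesis by (simp add: set_lebesgue_integral_def)
qed

section \<open>Smooth test fields\<close>

text \<open>The function \<open>exp (- 1 / t) / t ^ k\<close>, extended by zero to \<open>t \<le> 0\<close>. The derivatives of such
  functions are combinations of functions of the same kind.\<close>

definition exp_cutoff :: "nat \<Rightarrow> real \<Rightarrow> real" where
  "exp_cutoff k t = (if t \<le> 0 then 0 else exp (- (1 / t)) / t ^ k)"

lemma exp_cutoff_has_derivative:
  "(exp_cutoff k has_real_derivative exp_cutoff (k + 2) t - k * exp_cutoff (k + 1) t) (at t)"
proof -
  consider "t < 0" | "t = 0" | "t > 0" by linarith
  then show ?thesis
  proof cases
    case 1
    have "\<forall>\<^sub>F x in nhds t. 0 = exp_cutoff k x"
      using eventually_nhds_in_open[of "{..<0}" t] 1 by (auto elim!: eventually_mono simp: exp_cutoff_def)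
    then show ?thesis
      using 1 DERIV_cong_ev[of t t "\<lambda>_. 0" "exp_cutoff k" 0 0] by (simp add: exp_cutoff_def)
  next
    case 2
    have "((\<lambda>h. exp_cutoff k h / h) \<longlongrightarrow> 0) (at_right 0)"
    proof (rule Lim_transform_eventually)
      have "((\<lambda>h::real. (inverse h) ^ (k + 1) / exp (inverse h)) \<longlongrightarrow> 0) (at_right 0)"
        by (rule filterlim_compose[OF tendsto_power_div_exp_0 filterlim_inverse_at_top_right])
      then show "((\<lambda>h::real. (inverse h) ^ (k + 1) / exp (inverse h)) \<longlongrightarrow> 0) (at_right 0)" .
      show "\<forall>\<^sub>F h::real in at_right 0. (inverse h) ^ (k + 1) / exp (inverse h) = exp_cutoff k h / h"
        using eventually_at_right_less[of 0]
        by eventually_elim (simp add: exp_cutoff_def exp_minus field_simps)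
    qed
    moreover have "((\<lambda>h. exp_cutoff k h / h) \<longlongrightarrow> 0) (at_left 0)"
    proof (rule tendsto_eventually)
      show "\<forall>\<^sub>F h in at_left 0. exp_cutoff k h / h = 0"
        by (rule eventually_at_leftI[of "-1"]) (auto simp: exp_cutoff_def)
    qed
    ultimately have "((\<lambda>h. exp_cutoff k h / h) \<longlongrightarrow> 0) (at 0)"
      by (simp add: filterlim_split_at)
    then show ?thesis using 2 by (simp add: DERIV_def exp_cutoff_def)
  next
    case 3
    have "((\<lambda>t. exp (- (1 / t)) / t ^ k) has_real_derivative
        (exp (- (1 / t)) * (1 / t\<^sup>2) * t ^ k - exp (- (1 / t)) * (k * t ^ (k - 1))) / (t ^ k * t ^ k)) (at t)"
      using 3 by (auto intro!: derivative_eq_intros simp: power2_eq_square)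
    also have "(exp (- (1 / t)) * (1 / t\<^sup>2) * t ^ k - exp (- (1 / t)) * (k * t ^ (k - 1))) / (t ^ k * t ^ k)
        = exp_cutoff (k + 2) t - k * exp_cutoff (k + 1) t"
      using 3 by (cases k) (auto simp: exp_cutoff_def field_simps power2_eq_square)
    finally have "((\<lambda>t. exp (- (1 / t)) / t ^ k) has_real_derivative
        exp_cutoff (k + 2) t - k * exp_cutoff (k + 1) t) (at t)" .
    moreover have "\<forall>\<^sub>F x in nhds t. exp (- (1 / x)) / x ^ k = exp_cutoff k x"
      using eventually_nhds_in_open[of "{0<..}" t] 3 by (auto elim!: eventually_mono simp: exp_cutoff_def)
    ultimately show ?thesis
      using DERIV_cong_ev[of t t "\<lambda>x. exp (- (1 / x)) / x ^ k" "exp_cutoff k"] by blast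
  qed
qed

lemma continuous_on_exp_cutoff: "continuous_on S (exp_cutoff k)"
  by (intro continuous_at_imp_continuous_on ballI DERIV_isCont[OF exp_cutoff_has_derivative])

lemma real_polynomial_function_C1:
  fixes p :: "real ^ 'n::finite \<Rightarrow> real"
  assumes "real_polynomial_function p"
  shows "C1 p \<and> (\<forall>i. real_polynomial_function (partial i p))"
  using assms
proof induction
  case (linear f)
  have *: "partial i f = (\<lambda>x. f (axis i 1))" for i
    using frechet_derivative_at[OF bounded_linear_imp_has_derivative[OF linear]]
    by (auto simp: partial_def fun_eq_iff)
  show ?case
    using bounded_linear_imp_differentiable[OF linear]
    by (auto intro!: C1I_partial simp: * continuous_on_const)
next
  case (const c)
  have *: "partial i (\<lambda>x. c) = (\<lambda>x. 0)" for i :: 'n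
    by (auto simp: partial_def fun_eq_iff)
  show ?case
    by (auto intro!: C1I_partial simp: * continuous_on_const)
next
  case (add f g)
  then have "partial i (\<lambda>x. f x + g x) = (\<lambda>x. partial i f x + partial i g x)" for i
    by (simp add: C1_add partial_eq_grad fun_eq_iff)
  with add show ?case by (auto simp: C1_add)
next
  case (mult f g)
  then have "partial i (\<lambda>x. f x * g x) = (\<lambda>x. f x * partial i g x + g x * partial i f x)" for i
    by (simp add: C1_mult partial_eq_grad fun_eq_iff)
  with mult show ?case by (auto simp: C1_mult intro!: real_polynomial_function.intros(3,4))
qed

text \<open>Sums of products of a polynomial with \<open>t ^ (- k) * exp (- 1 / t)\<close> at \<open>t = T - norm x ^ 2\<close>.
  This set of compactly supported functions is stable under partial derivatives.\<close>

inductive_set cutoff_polynomials :: "real \<Rightarrow> (real ^ 'n::finite \<Rightarrow> real) set" for T where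
  base: "real_polynomial_function p \<Longrightarrow> (\<lambda>x. p x * exp_cutoff k (T - x \<bullet> x)) \<in> cutoff_polynomials T"
| add: "f \<in> cutoff_polynomials T \<Longrightarrow> g \<in> cutoff_polynomials T \<Longrightarrow> (\<lambda>x. f x + g x) \<in> cutoff_polynomials T"

lemma cutoff_polynomials_C1:
  fixes f :: "real ^ 'n::finite \<Rightarrow> real"
  assumes "f \<in> cutoff_polynomials T"
  shows "C1 f \<and> (\<forall>i. partial i f \<in> cutoff_polynomials T)"
  using assms
proof induction
  case (base p k)
  let ?q = "\<lambda>x :: real ^ 'n. T - x \<bullet> x"
  have p: "C1 p" "\<And>i. real_polynomial_function (partial i p)"
    using real_polynomial_function_C1[OF base] by auto
  have "(?q has_derivative (\<lambda>h. (- 2 *\<^sub>R x) \<bullet> h)) (at x)" for x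
    by (auto intro!: derivative_eq_intros simp: inner_commute)
  moreover have "continuous_on UNIV (\<lambda>x :: real ^ 'n. - 2 *\<^sub>R x)"
    by (intro continuous_intros)
  ultimately have q: "C1 ?q" "grad ?q = (\<lambda>x. - 2 *\<^sub>R x)"
    by (rule C1I)+
  have cont: "continuous_on UNIV (\<lambda>t. exp_cutoff (k + 2) t - k * exp_cutoff (k + 1) t)"
    by (intro continuous_intros continuous_on_exp_cutoff)
  note G = C1_compose[OF q(1) exp_cutoff_has_derivative cont]
  have "partial i (\<lambda>x. p x * exp_cutoff k (?q x)) =
      (\<lambda>x. ((- 2 * (p x * x $ i)) * exp_cutoff (k + 2) (?q x)
        + (2 * k * (p x * x $ i)) * exp_cutoff (k + 1) (?q x)) + partial i p x * exp_cutoff k (?q x))" for i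
    by (simp add: C1_mult[OF p(1) G(1)] G(2) q(2) partial_eq_grad fun_eq_iff algebra_simps)
  moreover have "real_polynomial_function (\<lambda>x. c * (p x * x $ i))" for i and c :: real
    using base by (intro real_polynomial_function.intros(4)) (auto intro: real_polynomial_function.intros(1) bounded_linear_vec_nth)
  then have "(\<lambda>x. ((- 2 * (p x * x $ i)) * exp_cutoff (k + 2) (?q x)
        + (2 * k * (p x * x $ i)) * exp_cutoff (k + 1) (?q x)) + partial i p x * exp_cutoff k (?q x))
      \<in> cutoff_polynomials T" for i
    using p(2) by (intro cutoff_polynomials.intros) auto
  ultimately show ?case
    using C1_mult(1)[OF p(1) G(1)] by auto
next
  case (add f g)
  then have "partial i (\<lambda>x. f x + g x) = (\<lambda>x. partial i f x + partial i g x)" for i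
    by (simp add: C1_add partial_eq_grad fun_eq_iff)
  with add show ?case by (auto simp: C1_add intro: cutoff_polynomials.add)
qed

lemma cutoff_polynomials_Cc_infinity:
  fixes f :: "real ^ 'n::finite \<Rightarrow> real"
  assumes f: "f \<in> cutoff_polynomials T"
  shows "f \<in> Cc_infinity"
proof -
  have "f \<in> cutoff_polynomials T \<Longrightarrow> Ck k f" for k and f :: "real ^ 'n \<Rightarrow> real"
  proof (induction k arbitrary: f)
    case 0
    then show ?case using C1_continuous[OF conjunct1[OF cutoff_polynomials_C1[OF 0]], of UNIV] by simp
  next
    case (Suc k)
    then show ?case using cutoff_polynomials_C1[OF Suc.prems] by (auto simp: C1_def)
  qed
  moreover have "f x = 0" if "T \<le> x \<bullet> x" for x
    using f by induction (use that in \<open>auto simp: exp_cutoff_def\<close>)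
  then have "{x. f x \<noteq> 0} \<subseteq> cball 0 (sqrt T)"
    by (force simp: norm_eq_sqrt_inner simp flip: not_le intro: ccontr)
  then have "bounded {x. f x \<noteq> 0}"
    using bounded_cball bounded_subset by blast
  ultimately show ?thesis
    using f by (auto simp: Cc_infinity_def)
qed

text \<open>The vector fields over which the supremum in the definition of the perimeter is taken, with the
  constraint on the length written as a norm.\<close>

definition test_field :: "(real ^ 'n::finite \<Rightarrow> real ^ 'n) \<Rightarrow> bool" where
  "test_field \<psi> \<longleftrightarrow> (\<forall>i. (\<lambda>x. \<psi> x $ i) \<in> Cc_infinity) \<and> (\<forall>x. norm (\<psi> x) \<le> 1)"

lemma test_field_C1: "test_field \<psi> \<Longrightarrow> C1 (\<lambda>x. \<psi> x $ i)"
  by (auto simp: test_field_def Cc_infinity_C1)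

lemma test_field_zero: "test_field (\<lambda>x :: real ^ 'n::finite. 0 :: real ^ 'n)"
  using cutoff_polynomials_Cc_infinity[OF cutoff_polynomials.base[OF real_polynomial_function.intros(2), of 0 0 0]]
  by (simp add: test_field_def)

lemma perimeter_eq:
  fixes \<Omega> :: "(real ^ 'n::finite) set"
  shows "perimeter \<Omega> = (SUP \<psi> \<in> Collect test_field. ereal (LINT x:\<Omega>|lborel. divergence \<psi> x))"
proof -
  have sq: "(\<Sum>i\<in>UNIV. (v $ i)\<^sup>2) \<le> 1 \<longleftrightarrow> norm v \<le> 1" for v :: "real ^ 'n"
    by (simp add: norm_vec_def L2_set_def)
  then have "{\<phi> :: real ^ 'n \<Rightarrow> real ^ 'n. (\<forall>i. (\<lambda>x. \<phi> x $ i) \<in> Cc_infinity) \<and> (\<forall>x. (\<Sum>i\<in>UNIV. (\<phi> x $ i)\<^sup>2) \<le> 1)}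
      = Collect test_field"
    unfolding test_field_def sq by blast
  then show ?thesis
    unfolding perimeter_def divergence_def by simp
qed

lemma perimeter_empty: "perimeter ({} :: (real ^ 'n::finite) set) = 0"
proof -
  have "Collect test_field \<noteq> ({} :: (real ^ 'n \<Rightarrow> real ^ 'n) set)"
    using test_field_zero by blast
  then show ?thesis
    by (simp add: perimeter_eq set_lebesgue_integral_def)
qed

text \<open>A continuous vector field of length at most one is approximated by a polynomial field on a
  ball around the origin, and the polynomial field is cut off near the boundary of the ball.\<close>

lemma test_field_approx:
  fixes V :: "real ^ 'n::finite \<Rightarrow> real ^ 'n"
  assumes V: "continuous_on UNIV V" "\<And>x. norm (V x) \<le> 1" and K: "bounded K" and e: "0 < e"
  obtains \<psi> where "test_field \<psi>" "\<And>x. x \<in> K \<Longrightarrow> norm (\<psi> x - V x) \<le> e"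
proof -
  obtain R where R: "\<And>x. x \<in> K \<Longrightarrow> norm x \<le> R"
    using K by (auto simp: bounded_iff)
  \<comment> \<open>The error splits into three parts: the approximation of \<open>V\<close> by a polynomial, the cut-off, and
    the rescaling that brings the length back to at most one.\<close>
  define e' where "e' = e / 3"
  have e': "0 < e'" using e by (simp add: e'_def)
  \<comment> \<open>On \<open>K\<close> the argument of the cut-off is at least \<open>1 / e'\<close>, so the cut-off is at least
    \<open>exp (- e') \<ge> 1 - e'\<close> there.\<close>
  define T where "T = R\<^sup>2 + 1 / e'"
  obtain p where p: "polynomial_function p" "\<And>x. x \<in> cball 0 (sqrt T) \<Longrightarrow> norm (V x - p x) < e'"
    using Stone_Weierstrass_polynomial_function[of "cball 0 (sqrt T)" V e'] V(1) e'
    by (meson compact_cball continuous_on_subset subset_UNIV)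
  define \<eta> where "\<eta> x = exp_cutoff 0 (T - x \<bullet> x)" for x :: "real ^ 'n"
  have \<eta>: "0 \<le> \<eta> x" "\<eta> x \<le> 1" for x
    by (auto simp: \<eta>_def exp_cutoff_def)
  have \<eta>K: "1 - e' \<le> \<eta> x" if "x \<in> K" for x
  proof -
    have "x \<bullet> x \<le> R\<^sup>2"
      using R[OF that] power_mono[of "norm x" R 2] by (simp add: power2_norm_eq_inner)
    then have T: "1 / e' \<le> T - x \<bullet> x" by (simp add: T_def)
    moreover have pos: "0 < 1 / e'" using e' by simp
    ultimately have "1 / (T - x \<bullet> x) \<le> e'"
      using le_imp_inverse_le[of "1 / e'"] by (simp add: inverse_eq_divide)
    moreover have "1 - 1 / (T - x \<bullet> x) \<le> exp (- (1 / (T - x \<bullet> x)))"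
      using exp_ge_add_one_self[of "- (1 / (T - x \<bullet> x))"] by simp
    moreover have "\<not> T \<le> x \<bullet> x" using T pos by linarith
    ultimately show ?thesis by (simp add: \<eta>_def exp_cutoff_def)
  qed
  define \<psi> where "\<psi> x = (\<eta> x / (1 + e')) *\<^sub>R p x" for x
  have pn: "norm (p x) \<le> 1 + e'" if "x \<in> cball 0 (sqrt T)" for x
    using p(2)[OF that] V(2)[of x] norm_triangle_ineq2[of "p x" "V x"] by (simp add: norm_minus_commute)
  have \<eta>out: "x \<in> cball 0 (sqrt T)" if "\<eta> x \<noteq> 0" for x
    using that by (auto simp: \<eta>_def exp_cutoff_def norm_eq_sqrt_inner split: if_splits)
  show ?thesis
  proof
    have "(\<lambda>x. \<psi> x $ i) \<in> cutoff_polynomials T" for i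
    proof -
      have "real_polynomial_function ((\<lambda>v. v $ i) \<circ> p)"
        using p(1) bounded_linear_vec_nth unfolding polynomial_function_def by blast
      then have "real_polynomial_function (\<lambda>x. 1 / (1 + e') * p x $ i)"
        by (auto simp: o_def)
      from cutoff_polynomials.base[OF this, of 0 T] show ?thesis
        by (simp add: \<psi>_def \<eta>_def mult.commute)
    qed
    moreover have "norm (\<psi> x) \<le> 1" for x
    proof (cases "\<eta> x = 0")
      case False
      have "\<eta> x * norm (p x) \<le> 1 * (1 + e')"
        using \<eta>[of x] pn[OF \<eta>out[OF False]] e' by (intro mult_mono) auto
      then show ?thesis using e' \<eta>[of x] by (simp add: \<psi>_def field_simps)
    qed (simp add: \<psi>_def)
    ultimately show "test_field \<psi>"
      by (auto simp: test_field_def intro: cutoff_polynomials_Cc_infinity)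
    fix x assume x: "x \<in> K"
    show "norm (\<psi> x - V x) \<le> e"
    proof (cases "x \<in> cball 0 (sqrt T)")
      case True
      have "\<psi> x - p x = - ((1 - \<eta> x / (1 + e')) *\<^sub>R p x)"
        by (simp add: \<psi>_def algebra_simps)
      moreover have le: "\<eta> x / (1 + e') \<le> 1"
        using \<eta>[of x] e' by (simp add: field_simps)
      ultimately have "norm (\<psi> x - p x) = (1 - \<eta> x / (1 + e')) * norm (p x)"
        by simp
      also have "\<dots> \<le> (1 - \<eta> x / (1 + e')) * (1 + e')"
        using le pn[OF True] by (intro mult_left_mono) auto
      also have "\<dots> = 1 + e' - \<eta> x" using e' by (simp add: field_simps)
      also have "\<dots> \<le> e' + e'" using \<eta>K[OF x] by simp
      finally have "norm (\<psi> x - p x) \<le> e' + e'" .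
      then show ?thesis
        using p(2)[OF True] norm_triangle_ineq[of "\<psi> x - p x" "p x - V x"]
        by (simp add: norm_minus_commute e'_def)
    next
      case False
      have "norm x \<le> R" using R[OF x] .
      moreover have "R \<le> sqrt T" using e' by (intro real_le_rsqrt) (simp add: T_def)
      ultimately show ?thesis using False by simp
    qed
  qed
qed

section \<open>The perimeter as the rate of growth of thin layers\<close>

lemma open_superlevel: "C1 u \<Longrightarrow> open {x. 0 < u x}"
  using open_Collect_less[OF continuous_on_const C1_continuous] by blast

lemma frontier_superlevel:
  assumes u: "C1 u" and x: "x \<in> closure {x. 0 < u x}"
  shows "0 \<le> u x" "x \<in> frontier {x. 0 < u x} \<longleftrightarrow> u x = 0"
proof -
  have "closed {x. 0 \<le> u x}"
    using closed_Collect_le[OF continuous_on_const C1_continuous[OF u]] .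
  then have "closure {x. 0 < u x} \<subseteq> {x. 0 \<le> u x}"
    by (intro closure_minimal) auto
  then show "0 \<le> u x" using x by auto
  then show "x \<in> frontier {x. 0 < u x} \<longleftrightarrow> u x = 0"
    using x by (auto simp: frontier_def interior_open[OF open_superlevel[OF u]])
qed

lemma frontier_eq_empty_bounded:
  fixes S :: "(real ^ 'n::finite) set"
  assumes "frontier S = {}" "bounded S"
  shows "S = {}"
proof -
  have "S = {} \<or> S = UNIV"
    using assms(1) frontier_eq_empty by blast
  moreover have "S \<noteq> UNIV"
    using assms(2) not_bounded_UNIV by auto
  ultimately show ?thesis by blast
qed

text \<open>Dividing \<open>\<phi>\<close> by a positive smooth function close to \<open>norm (grad \<phi>)\<close> yields a function with
  the same superlevel set whose gradient has length close to one near the boundary.\<close>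

lemma normalized_defining_function:
  fixes \<phi> :: "real ^ 'n::finite \<Rightarrow> real"
  assumes \<phi>: "C1 \<phi>" and bd: "bounded {x. 0 < \<phi> x}"
    and c: "0 < c" "\<And>x. x \<in> frontier {x. 0 < \<phi> x} \<Longrightarrow> c \<le> norm (grad \<phi> x)"
    and \<delta>: "0 < \<delta>" "\<delta> < 1"
  obtains u r where "C1 u" "\<And>x. 0 < u x \<longleftrightarrow> 0 < \<phi> x" "0 < r"
    "\<And>x. 0 < u x \<Longrightarrow> u x \<le> r \<Longrightarrow> 1 - \<delta> \<le> norm (grad u x) \<and> norm (grad u x) \<le> 1 + \<delta>"
    "\<And>x. x \<in> frontier {x. 0 < u x} \<Longrightarrow> grad u x \<noteq> 0"
proof -
  let ?\<Omega> = "{x. 0 < \<phi> x}"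
  have cpt: "compact (closure ?\<Omega>)" using bd by simp
  \<comment> \<open>Then \<open>exp e\<close> and \<open>exp (- e)\<close> lie strictly between \<open>1 - \<delta>\<close> and \<open>1 + \<delta>\<close>.\<close>
  define e where "e = ln (1 + \<delta> / 2)"
  have e: "0 < e" using \<delta> by (simp add: e_def)
  \<comment> \<open>The maximum with \<open>c\<close> keeps the logarithm continuous at critical points and changes nothing on
    the frontier.\<close>
  have "max c (norm (grad \<phi> x)) \<noteq> 0" for x
    using c(1) by linarith
  then have cln: "continuous_on (closure ?\<Omega>) (\<lambda>x. ln (max c (norm (grad \<phi> x))))"
    by (intro continuous_on_ln continuous_on_max continuous_on_const continuous_on_norm
        C1_continuous_grad \<phi> ballI)
  from Stone_Weierstrass_polynomial_function[OF cpt cln e]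
  obtain p where "polynomial_function p"
    and pe: "\<And>x. x \<in> closure ?\<Omega> \<Longrightarrow> norm (ln (max c (norm (grad \<phi> x))) - p x) < e"
    by metis
  then have p: "C1 p"
    using real_polynomial_function_C1 unfolding real_polynomial_function_eq by blast
  have dexp: "((\<lambda>s. exp (- s)) has_real_derivative - exp (- s)) (at s)" for s :: real
    by (auto intro!: derivative_eq_intros)
  have cexp: "continuous_on UNIV (\<lambda>s::real. - exp (- s))"
    by (intro continuous_intros)
  note E = C1_compose[OF p dexp cexp]
  define u where "u x = \<phi> x * exp (- p x)" for x
  have u: "C1 u"
    unfolding u_def[abs_def] by (rule C1_mult(1)[OF \<phi> E(1)])
  have gu: "grad u x = \<phi> x *\<^sub>R - (exp (- p x) *\<^sub>R grad p x) + exp (- p x) *\<^sub>R grad \<phi> x" for x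
    unfolding u_def[abs_def] C1_mult(2)[OF \<phi> E(1)] E(2) by simp
  have iff: "0 < u x \<longleftrightarrow> 0 < \<phi> x" for x
    by (simp add: u_def zero_less_mult_iff)
  have u0: "1 - \<delta> < norm (grad u x) \<and> norm (grad u x) < 1 + \<delta>" if x: "x \<in> closure ?\<Omega>" "u x = 0" for x
  proof -
    have \<phi>0: "\<phi> x = 0" using x(2) by (simp add: u_def)
    then have "x \<in> frontier ?\<Omega>" using frontier_superlevel(2)[OF \<phi> x(1)] by simp
    then have n: "c \<le> norm (grad \<phi> x)" "0 < norm (grad \<phi> x)"
      using c(2)[of x] c(1) by linarith+
    then have "norm (ln (norm (grad \<phi> x)) - p x) < e"
      using pe[OF x(1)] by (simp only: max_absorb2)
    moreover have "norm (grad u x) = exp (ln (norm (grad \<phi> x)) - p x)"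
      using n(2) by (simp add: gu \<phi>0 exp_diff exp_minus divide_inverse mult.commute)
    ultimately have "exp (- e) < norm (grad u x)" "norm (grad u x) < exp e"
      by (simp_all add: abs_less_iff)
    moreover have "exp e = 1 + \<delta> / 2" using \<delta> by (simp add: e_def)
    moreover have "1 - \<delta> < exp (- e)"
      unfolding exp_minus \<open>exp e = 1 + \<delta> / 2\<close> using \<delta> by (simp add: field_simps add_pos_pos)
    ultimately show ?thesis using \<delta> by auto
  qed
  \<comment> \<open>On this compact set of points with a bad gradient \<open>u\<close> is positive, hence bounded below.\<close>
  define Z where "Z = closure ?\<Omega> \<inter> {x. norm (grad u x) \<le> 1 - \<delta> \<or> 1 + \<delta> \<le> norm (grad u x)}"
  have "closed {x. norm (grad u x) \<le> 1 - \<delta> \<or> 1 + \<delta> \<le> norm (grad u x)}"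
    unfolding Collect_disj_eq
    by (intro closed_Un closed_Collect_le continuous_intros C1_continuous_grad u)
  then have "compact Z"
    unfolding Z_def using cpt by (rule compact_Int_closed[rotated])
  have "\<exists>r>0. \<forall>x\<in>Z. r < u x"
  proof (cases "Z = {}")
    case False
    then obtain z where z: "z \<in> Z" "\<And>x. x \<in> Z \<Longrightarrow> u z \<le> u x"
      using continuous_attains_inf[OF \<open>compact Z\<close> _ C1_continuous[OF u]] by blast
    have "z \<in> closure {x. 0 < u x}" using z(1) by (simp add: Z_def iff)
    then have "0 \<le> u z" by (rule frontier_superlevel[OF u])
    moreover have "u z \<noteq> 0" using u0[of z] z(1) by (auto simp: Z_def)
    ultimately have pos: "0 < u z" by linarith
    show ?thesis
    proof (intro exI[of _ "u z / 2"] conjI ballI)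
      fix x assume "x \<in> Z"
      then show "u z / 2 < u x" using z(2)[of x] pos by linarith
    qed (use pos in simp)
  next
    case True
    then show ?thesis by (intro exI[of _ 1]) simp
  qed
  then obtain r where r: "0 < r" "\<And>x. x \<in> Z \<Longrightarrow> r < u x" by blast
  show ?thesis
  proof (rule that[of u r, OF u iff r(1)])
    fix x assume x: "0 < u x" "u x \<le> r"
    then have "x \<notin> Z" using r(2)[of x] by auto
    moreover have "x \<in> closure ?\<Omega>" using x(1) iff[of x] closure_subset[of ?\<Omega>] by auto
    ultimately show "1 - \<delta> \<le> norm (grad u x) \<and> norm (grad u x) \<le> 1 + \<delta>"
      by (auto simp: Z_def)
  next
    fix x assume x: "x \<in> frontier {x. 0 < u x}"
    then have cl: "x \<in> closure {x. 0 < u x}" by (simp add: frontier_def)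
    then have "u x = 0" "x \<in> closure ?\<Omega>"
      using frontier_superlevel(2)[OF u cl] x cl unfolding iff by simp_all
    then show "grad u x \<noteq> 0" using u0[of x] \<delta> by auto
  qed
qed

text \<open>The volume of the part of the superlevel set \<open>{u > 0}\<close> where \<open>u\<close> is at most \<open>m\<close>.\<close>

definition layer_volume :: "(real ^ 'n::finite \<Rightarrow> real) \<Rightarrow> real \<Rightarrow> real" where
  "layer_volume u m = measure lborel {x. 0 < u x \<and> u x \<le> m}"

lemma layer_sets[measurable]: "C1 u \<Longrightarrow> {x. 0 < u x \<and> u x \<le> m} \<in> sets borel"
proof -
  assume u: "C1 u"
  have [measurable]: "u \<in> borel_measurable borel"
    by (intro borel_measurable_continuous_onI C1_continuous u)
  show ?thesis by measurable
qed

lemma layer_integrable: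
  assumes "C1 u" "bounded {x. 0 < u x}"
  shows "integrable lborel (indicator {x. 0 < u x \<and> u x \<le> m} :: _ \<Rightarrow> real)"
    "emeasure lborel {x. 0 < u x \<and> u x \<le> m} < \<infinity>"
proof -
  show "emeasure lborel {x. 0 < u x \<and> u x \<le> m} < \<infinity>"
    by (intro emeasure_bounded_finite bounded_subset[OF assms(2)]) auto
  then show "integrable lborel (indicator {x. 0 < u x \<and> u x \<le> m} :: _ \<Rightarrow> real)"
    using layer_sets[OF assms(1)] by simp
qed

lemma divergence_le_layer_volume:
  fixes u :: "real ^ 'n::finite \<Rightarrow> real"
  assumes u: "C1 u" and bd: "bounded {x. 0 < u x}" and r: "0 < r"
    and g: "\<And>x. 0 < u x \<Longrightarrow> u x \<le> r \<Longrightarrow> norm (grad u x) \<le> b"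
    and \<psi>: "test_field \<psi>" and \<eta>: "0 < \<eta>"
  shows "\<forall>\<^sub>F m in at_right 0. (LINT x:{x. 0 < u x}|lborel. divergence \<psi> x) - \<eta> \<le> b * layer_volume u m / m"
proof -
  let ?I = "\<lambda>m. LINT x|lborel. indicator {x. 0 < u x \<and> u x \<le> m} x * (- (grad u x \<bullet> \<psi> x))"
  have "\<forall>\<^sub>F m in at_right 0. (LINT x:{x. 0 < u x}|lborel. divergence \<psi> x) - \<eta> < ?I m / m"
    using \<eta> by (intro order_tendstoD[OF divergence_layer_limit[OF u bd test_field_C1[OF \<psi>]]]) simp
  moreover have "\<forall>\<^sub>F m in at_right 0. 0 < m \<and> m < r"
    using eventually_at_right_real[OF r] by simp
  ultimately show ?thesis
  proof eventually_elim
    case (elim m)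
    have "?I m \<le> (LINT x|lborel. b * indicator {x. 0 < u x \<and> u x \<le> m} x)"
    proof (rule integral_mono')
      show "integrable lborel (\<lambda>x. b * indicator {x. 0 < u x \<and> u x \<le> m} x)"
        using layer_integrable(1)[OF u bd] by simp
      fix x
      have "- (grad u x \<bullet> \<psi> x) \<le> norm (grad u x) * norm (\<psi> x)"
        using Cauchy_Schwarz_ineq2[of "grad u x" "\<psi> x"] by linarith
      also have "\<dots> \<le> norm (grad u x) * 1"
        using \<psi> by (intro mult_left_mono) (auto simp: test_field_def)
      finally have "- (grad u x \<bullet> \<psi> x) \<le> norm (grad u x)" by simp
      then show "indicator {x. 0 < u x \<and> u x \<le> m} x * (- (grad u x \<bullet> \<psi> x))
          \<le> b * indicator {x. 0 < u x \<and> u x \<le> m} x"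
        using g[of x] elim by (auto simp: indicator_def)
      show "0 \<le> b * indicator {x. 0 < u x \<and> u x \<le> m} x"
        using order_trans[OF norm_ge_zero g[of x]] elim by (simp add: indicator_def)
    qed
    also have "\<dots> = b * layer_volume u m"
      by (simp add: layer_volume_def)
    finally have "?I m / m \<le> b * layer_volume u m / m"
      using elim by (intro divide_right_mono) auto
    then show ?case using elim by simp
  qed
qed

lemma layer_volume_le_divergence:
  fixes u :: "real ^ 'n::finite \<Rightarrow> real"
  assumes u: "C1 u" and bd: "bounded {x. 0 < u x}" and r: "0 < r" and \<delta>: "0 < \<delta>" "\<delta> < 1"
    and g: "\<And>x. 0 < u x \<Longrightarrow> u x \<le> r \<Longrightarrow> 1 - \<delta> \<le> norm (grad u x)"
  obtains \<psi> where "test_field \<psi>"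
    "\<And>\<eta>. 0 < \<eta> \<Longrightarrow> \<forall>\<^sub>F m in at_right 0.
      (1 - \<delta>)\<^sup>2 * layer_volume u m / m \<le> (LINT x:{x. 0 < u x}|lborel. divergence \<psi> x) + \<eta>"
proof -
  \<comment> \<open>The outer unit normal near the boundary; the maximum extends it continuously to the whole
    space with length at most one.\<close>
  define V where "V x = - (1 / max (1 - \<delta>) (norm (grad u x))) *\<^sub>R grad u x" for x
  have V1: "continuous_on UNIV V"
    unfolding V_def using \<delta> by (intro continuous_intros C1_continuous_grad u) auto
  have V2: "norm (V x) \<le> 1" for x
    using \<delta> by (auto simp: V_def max_def divide_simps)
  obtain \<psi> where \<psi>: "test_field \<psi>" "\<And>x. 0 < u x \<Longrightarrow> norm (\<psi> x - V x) \<le> \<delta>"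
    using test_field_approx[OF V1 V2 bd \<delta>(1)] by auto
  let ?I = "\<lambda>m. LINT x|lborel. indicator {x. 0 < u x \<and> u x \<le> m} x * (- (grad u x \<bullet> \<psi> x))"
  show thesis
  proof (rule that[OF \<psi>(1)])
    fix \<eta> :: real assume \<eta>: "0 < \<eta>"
    have "\<forall>\<^sub>F m in at_right 0. ?I m / m < (LINT x:{x. 0 < u x}|lborel. divergence \<psi> x) + \<eta>"
      using \<eta> by (intro order_tendstoD[OF divergence_layer_limit[OF u bd test_field_C1[OF \<psi>(1)]]]) simp
    moreover have "\<forall>\<^sub>F m in at_right 0. 0 < m \<and> m < r"
      using eventually_at_right_real[OF r] by simp
    ultimately show "\<forall>\<^sub>F m in at_right 0.
      (1 - \<delta>)\<^sup>2 * layer_volume u m / m \<le> (LINT x:{x. 0 < u x}|lborel. divergence \<psi> x) + \<eta>"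
    proof eventually_elim
      case (elim m)
      have "(1 - \<delta>)\<^sup>2 * layer_volume u m = (LINT x|lborel. (1 - \<delta>)\<^sup>2 * indicator {x. 0 < u x \<and> u x \<le> m} x)"
        by (simp add: layer_volume_def)
      also have "\<dots> \<le> ?I m"
      proof (rule integral_mono)
        show "integrable lborel (\<lambda>x. (1 - \<delta>)\<^sup>2 * indicator {x. 0 < u x \<and> u x \<le> m} x)"
          using layer_integrable(1)[OF u bd] by simp
        have cI: "continuous_on S (\<lambda>x. - (grad u x \<bullet> \<psi> x))" for S
        proof -
          have "continuous_on S (\<lambda>x. \<chi> i. \<psi> x $ i)"
            by (intro continuous_intros C1_continuous test_field_C1 \<psi>)
          then show ?thesis by (intro continuous_intros C1_continuous_grad u) simp
        qed
        have "bounded ((\<lambda>x. - (grad u x \<bullet> \<psi> x)) ` closure {x. 0 < u x})"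
          using bd by (intro compact_imp_bounded compact_continuous_image cI) auto
        then obtain B where B: "\<And>x. x \<in> {x. 0 < u x} \<Longrightarrow> \<bar>- (grad u x \<bullet> \<psi> x)\<bar> \<le> B"
          unfolding bounded_iff using closure_subset by (metis (no_types, lifting) image_eqI real_norm_def subsetD)
        show "integrable lborel (\<lambda>x. indicator {x. 0 < u x \<and> u x \<le> m} x * (- (grad u x \<bullet> \<psi> x)))"
        proof (rule integrable_bounded_support[where B = B and S = "{x. 0 < u x \<and> u x \<le> m}"])
          show "(\<lambda>x. indicator {x. 0 < u x \<and> u x \<le> m} x * (- (grad u x \<bullet> \<psi> x))) \<in> borel_measurable borel"
            using layer_sets[OF u] borel_measurable_continuous_onI[OF cI] by simp
          show "bounded {x. 0 < u x \<and> u x \<le> m}" by (rule bounded_subset[OF bd]) auto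
        qed (use layer_sets[OF u] B in \<open>auto simp: indicator_def\<close>)
        fix x
        have "(1 - \<delta>)\<^sup>2 \<le> - (grad u x \<bullet> \<psi> x)" if x: "0 < u x" "u x \<le> m"
        proof -
          let ?g = "norm (grad u x)"
          have ge: "1 - \<delta> \<le> ?g" using g[of x] x elim by simp
          then have "max (1 - \<delta>) ?g = ?g" "0 < ?g" using \<delta> by auto
          then have "- (grad u x \<bullet> V x) = ?g"
            by (simp add: V_def power2_norm_eq_inner[symmetric] power2_eq_square)
          moreover have "grad u x \<bullet> (\<psi> x - V x) \<le> ?g * norm (\<psi> x - V x)"
            by (rule norm_cauchy_schwarz)
          moreover have "?g * norm (\<psi> x - V x) \<le> ?g * \<delta>"
            using \<psi>(2)[OF x(1)] by (intro mult_left_mono) auto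
          ultimately have "?g * (1 - \<delta>) \<le> - (grad u x \<bullet> \<psi> x)"
            by (simp add: algebra_simps)
          moreover have "(1 - \<delta>) * (1 - \<delta>) \<le> ?g * (1 - \<delta>)"
            using ge \<delta> by (intro mult_right_mono) auto
          ultimately show ?thesis by (simp add: power2_eq_square)
        qed
        then show "(1 - \<delta>)\<^sup>2 * indicator {x. 0 < u x \<and> u x \<le> m} x
            \<le> indicator {x. 0 < u x \<and> u x \<le> m} x * (- (grad u x \<bullet> \<psi> x))"
          by (auto simp: indicator_def)
      qed
      finally have "(1 - \<delta>)\<^sup>2 * layer_volume u m / m \<le> ?I m / m"
        using elim by (intro divide_right_mono) auto
      then show ?case using elim by simp
    qed
  qed
qed

text \<open>The perimeter is finite because the flux of every test field is bounded in terms
  of the flux of the nearly optimal one.\<close>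

lemma perimeter_layer_volume:
  fixes u :: "real ^ 'n::finite \<Rightarrow> real"
  assumes u: "C1 u" and bd: "bounded {x. 0 < u x}" and r: "0 < r" and \<delta>: "0 < \<delta>" "\<delta> < 1"
    and g: "\<And>x. 0 < u x \<Longrightarrow> u x \<le> r \<Longrightarrow> 1 - \<delta> \<le> norm (grad u x) \<and> norm (grad u x) \<le> 1 + \<delta>"
  obtains p where "0 \<le> p" "perimeter {x. 0 < u x} = ereal p"
    "\<And>\<eta>. 0 < \<eta> \<Longrightarrow> \<forall>\<^sub>F m in at_right 0. p - \<eta> \<le> (1 + \<delta>) * layer_volume u m / m
      \<and> (1 - \<delta>)\<^sup>2 * layer_volume u m / m \<le> p + \<eta>"
proof -
  let ?\<Omega> = "{x. 0 < u x}" and ?D = "\<lambda>\<psi>. LINT x:{x. 0 < u x}|lborel. divergence \<psi> x"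
  obtain \<psi>0 where \<psi>0: "test_field \<psi>0"
    "\<And>\<eta>. 0 < \<eta> \<Longrightarrow> \<forall>\<^sub>F m in at_right 0. (1 - \<delta>)\<^sup>2 * layer_volume u m / m \<le> ?D \<psi>0 + \<eta>"
    using layer_volume_le_divergence[OF u bd r \<delta>] g by blast
  have bound: "?D \<psi> \<le> (1 + \<delta>) / (1 - \<delta>)\<^sup>2 * (?D \<psi>0 + 1) + 1" if \<psi>: "test_field \<psi>" for \<psi>
  proof -
    have "\<forall>\<^sub>F m in at_right 0. ?D \<psi> - 1 \<le> (1 + \<delta>) * layer_volume u m / m \<and>
        (1 - \<delta>)\<^sup>2 * layer_volume u m / m \<le> ?D \<psi>0 + 1"
      using g by (intro eventually_conj divergence_le_layer_volume[OF u bd r _ \<psi>] \<psi>0(2)) auto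
    then obtain m where m: "?D \<psi> - 1 \<le> (1 + \<delta>) * layer_volume u m / m"
        "(1 - \<delta>)\<^sup>2 * layer_volume u m / m \<le> ?D \<psi>0 + 1"
      using eventually_happens'[OF trivial_limit_at_right_real] by blast
    have "(1 + \<delta>) / (1 - \<delta>)\<^sup>2 * ((1 - \<delta>)\<^sup>2 * layer_volume u m / m) \<le> (1 + \<delta>) / (1 - \<delta>)\<^sup>2 * (?D \<psi>0 + 1)"
      using m(2) \<delta> by (intro mult_left_mono) auto
    moreover have "(1 + \<delta>) / (1 - \<delta>)\<^sup>2 * ((1 - \<delta>)\<^sup>2 * layer_volume u m / m) = (1 + \<delta>) * layer_volume u m / m"
      using \<delta> by simp
    ultimately show ?thesis using m(1) by linarith
  qed
  have "test_field (\<lambda>x. 0 :: real ^ 'n)"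
    by (rule test_field_zero)
  moreover have "?D (\<lambda>x. 0) = 0"
    by (simp add: divergence_def partial_def set_lebesgue_integral_def)
  ultimately have ge0: "0 \<le> perimeter ?\<Omega>"
    unfolding perimeter_eq by (intro SUP_upper2[of "\<lambda>x. 0"]) auto
  have "perimeter ?\<Omega> \<le> ereal ((1 + \<delta>) / (1 - \<delta>)\<^sup>2 * (?D \<psi>0 + 1) + 1)"
    unfolding perimeter_eq using bound by (intro SUP_least) auto
  with ge0 obtain p where p: "perimeter ?\<Omega> = ereal p" "0 \<le> p"
    by (cases "perimeter ?\<Omega>") auto
  have le_p: "?D \<psi> \<le> p" if "test_field \<psi>" for \<psi>
  proof -
    have "ereal (?D \<psi>) \<le> perimeter ?\<Omega>"
      unfolding perimeter_eq using that by (intro SUP_upper) auto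
    then show ?thesis by (simp add: p)
  qed
  show thesis
  proof (rule that[OF p(2,1)])
    fix \<eta> :: real assume \<eta>: "0 < \<eta>"
    have "ereal (p - \<eta> / 2) < perimeter ?\<Omega>" using \<eta> by (simp add: p)
    then obtain \<psi> where \<psi>: "test_field \<psi>" "p - \<eta> / 2 < ?D \<psi>"
      unfolding perimeter_eq less_SUP_iff by auto
    have "\<forall>\<^sub>F m in at_right 0. ?D \<psi> - \<eta> / 2 \<le> (1 + \<delta>) * layer_volume u m / m"
      using g \<eta> by (intro divergence_le_layer_volume[OF u bd r _ \<psi>(1)]) auto
    then show "\<forall>\<^sub>F m in at_right 0. p - \<eta> \<le> (1 + \<delta>) * layer_volume u m / m
      \<and> (1 - \<delta>)\<^sup>2 * layer_volume u m / m \<le> p + \<eta>"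
      using \<psi>0(2)[OF \<eta>]
    proof eventually_elim
      case (elim m)
      then show ?case using \<psi>(2) le_p[OF \<psi>0(1)] by linarith
    qed
  qed
qed

section \<open>Exit of a translated set from a superlevel set\<close>

text \<open>The translate of \<open>R\<close> by \<open>x\<close> stays in the superlevel set \<open>{u > 0}\<close> with a positive margin: \<open>u\<close> is
  bounded away from 0 on it. If \<open>{u > 0}\<close> is bounded, this says that the closure of the translate lies in
  \<open>{u > 0}\<close>.\<close>

definition stays :: "(real ^ 'n::finite \<Rightarrow> real) \<Rightarrow> (real ^ 'n) set \<Rightarrow> real ^ 'n \<Rightarrow> bool" where
  "stays u R x \<longleftrightarrow> (\<exists>n. \<forall>y\<in>R. 1 / real (Suc n) \<le> u (x + y))"

text \<open>The extent of \<open>R\<close> in the direction \<open>e\<close>. As a supremum of reals it is meaningful only for bounded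
  nonempty \<open>R\<close>; the same holds for \<open>sup_norm\<close>.\<close>

definition sup_dir :: "(real ^ 'n::finite) set \<Rightarrow> real ^ 'n \<Rightarrow> real" where
  "sup_dir R e = (SUP y\<in>R. e \<bullet> y)"

text \<open>The largest distance of a point of \<open>R\<close> from the origin.\<close>

definition sup_norm :: "(real ^ 'n::finite) set \<Rightarrow> real" where
  "sup_norm R = (SUP y\<in>R. norm y)"

lemma sup_dir_upper: "bounded R \<Longrightarrow> y \<in> R \<Longrightarrow> e \<bullet> y \<le> sup_dir R e"
proof -
  assume R: "bounded R" "y \<in> R"
  then obtain B where B: "\<And>y. y \<in> R \<Longrightarrow> norm y \<le> B" by (auto simp: bounded_iff)
  have "e \<bullet> y \<le> norm e * B" if "y \<in> R" for y
    using norm_cauchy_schwarz[of e y] mult_left_mono[OF B[OF that], of "norm e"] by simp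
  then have "bdd_above ((\<lambda>y. e \<bullet> y) ` R)" by (auto simp: bdd_above_def)
  then show ?thesis unfolding sup_dir_def by (rule cSUP_upper[OF R(2)])
qed

lemma sup_norm_upper: "bounded R \<Longrightarrow> y \<in> R \<Longrightarrow> norm y \<le> sup_norm R"
  unfolding sup_norm_def by (rule cSUP_upper) (auto simp: bdd_above_def bounded_iff)

lemma sup_dir_nonneg: "bounded R \<Longrightarrow> 0 \<in> R \<Longrightarrow> 0 \<le> sup_dir R e"
  using sup_dir_upper[of R 0 e] by simp

lemma sup_norm_nonneg: "bounded R \<Longrightarrow> 0 \<in> R \<Longrightarrow> 0 \<le> sup_norm R"
  using sup_norm_upper[of R 0] by simp

lemma sup_norm_le: "R \<noteq> {} \<Longrightarrow> (\<And>y. y \<in> R \<Longrightarrow> norm y \<le> c) \<Longrightarrow> sup_norm R \<le> c"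
  unfolding sup_norm_def by (rule cSUP_least)

lemma sup_dir_le: "R \<noteq> {} \<Longrightarrow> (\<And>y. y \<in> R \<Longrightarrow> e \<bullet> y \<le> c) \<Longrightarrow> sup_dir R e \<le> c"
  unfolding sup_dir_def by (rule cSUP_least)

lemma C1_uniform_linearization:
  fixes u :: "real ^ 'n::finite \<Rightarrow> real"
  assumes u: "C1 u" and S: "bounded S" and \<delta>: "0 < \<delta>"
  obtains \<epsilon> where "0 < \<epsilon>"
    "\<And>x y. x \<in> S \<Longrightarrow> norm y \<le> \<epsilon> \<Longrightarrow> \<bar>u (x + y) - u x - grad u x \<bullet> y\<bar> \<le> \<delta> * norm y"
proof -
  obtain R where R: "\<And>x. x \<in> S \<Longrightarrow> norm x \<le> R" using S by (auto simp: bounded_iff)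
  have "uniformly_continuous_on (cball 0 (R + 1)) (grad u)"
    by (intro compact_uniformly_continuous C1_continuous_grad u) auto
  then obtain d where d: "0 < d" "\<And>x y. x \<in> cball 0 (R + 1) \<Longrightarrow> y \<in> cball 0 (R + 1) \<Longrightarrow> dist y x < d \<Longrightarrow>
      dist (grad u y) (grad u x) < \<delta>"
    using \<delta> unfolding uniformly_continuous_on_def by metis
  show thesis
  proof (rule that[of "min 1 (d / 2)"])
    fix x y :: "real ^ 'n" assume x: "x \<in> S" and y: "norm y \<le> min 1 (d / 2)"
    have "\<exists>z>0. z < 1 \<and> u (x + 1 *\<^sub>R y) - u (x + 0 *\<^sub>R y) = (1 - 0) * (grad u (x + z *\<^sub>R y) \<bullet> y)"
      by (rule MVT2) (auto intro: C1_line_derivative[OF u])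
    then obtain z where z: "0 < z" "z < 1" "u (x + y) - u x = grad u (x + z *\<^sub>R y) \<bullet> y"
      by auto
    have zy: "norm (z *\<^sub>R y) \<le> norm y" using z mult_right_mono[of z 1 "norm y"] by simp
    have "x + z *\<^sub>R y \<in> cball 0 (R + 1)"
      using norm_triangle_ineq[of x "z *\<^sub>R y"] zy R[OF x] y by simp
    moreover have "x \<in> cball 0 (R + 1)" using R[OF x] by simp
    moreover have "dist (x + z *\<^sub>R y) x < d" using d(1) zy y by (simp add: dist_norm)
    ultimately have "dist (grad u (x + z *\<^sub>R y)) (grad u x) < \<delta>"
      using d(2) by blast
    then have n: "norm (grad u (x + z *\<^sub>R y) - grad u x) \<le> \<delta>" by (simp add: dist_norm)
    have "\<bar>u (x + y) - u x - grad u x \<bullet> y\<bar> = \<bar>(grad u (x + z *\<^sub>R y) - grad u x) \<bullet> y\<bar>"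
      using z(3) by (simp add: inner_diff_left)
    also have "\<dots> \<le> norm (grad u (x + z *\<^sub>R y) - grad u x) * norm y"
      by (rule Cauchy_Schwarz_ineq2)
    also have "\<dots> \<le> \<delta> * norm y" using n by (intro mult_right_mono) auto
    finally show "\<bar>u (x + y) - u x - grad u x \<bullet> y\<bar> \<le> \<delta> * norm y" .
  qed (use d in auto)
qed

text \<open>The largest displacement is dominated by the suprema along the \<open>2 * CARD('n)\<close> coordinate
  half-axes.\<close>

lemma sup_norm_le_sum:
  fixes R :: "(real ^ 'n::finite) set"
  assumes "bounded R" "0 \<in> R"
  shows "sup_norm R \<le> (\<Sum>(i, \<sigma>)\<in>UNIV \<times> {1, -1}. sup_dir R (\<sigma> *\<^sub>R axis i (1::real) :: real ^ 'n))"
proof (rule sup_norm_le)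
  fix y assume y: "y \<in> R"
  have "norm y \<le> (\<Sum>i\<in>UNIV. \<bar>y $ i\<bar>)" by (rule norm_le_l1_cart)
  also have "\<dots> \<le> (\<Sum>i\<in>UNIV. \<Sum>\<sigma>\<in>{1, -1}. sup_dir R (\<sigma> *\<^sub>R axis i (1::real) :: real ^ 'n))"
  proof (rule sum_mono)
    fix i :: 'n
    have "y $ i \<le> sup_dir R (axis i 1)" "- (y $ i) \<le> sup_dir R (- axis i 1)"
      using sup_dir_upper[OF assms(1) y, of "axis i 1"] sup_dir_upper[OF assms(1) y, of "- axis i 1"]
      by (simp_all add: inner_axis')
    moreover have "0 \<le> sup_dir R (axis i 1)" "0 \<le> sup_dir R (- axis i 1)"
      by (rule sup_dir_nonneg[OF assms])+
    ultimately show "\<bar>y $ i\<bar> \<le> (\<Sum>\<sigma>\<in>{1, -1}. sup_dir R (\<sigma> *\<^sub>R axis i (1::real) :: real ^ 'n))"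
      by simp
  qed
  also have "\<dots> = (\<Sum>(i, \<sigma>)\<in>UNIV \<times> {1, -1}. sup_dir R (\<sigma> *\<^sub>R axis i (1::real) :: real ^ 'n))"
    by (rule sum.cartesian_product)
  finally show "norm y \<le> (\<Sum>(i, \<sigma>)\<in>UNIV \<times> {1, -1}. sup_dir R (\<sigma> *\<^sub>R axis i (1::real) :: real ^ 'n))" .
qed (use assms in auto)

text \<open>The unit vector opposite to the gradient of \<open>u\<close>, which points out of \<open>{u > 0}\<close>; the zero vector at
  critical points.\<close>

definition descent_dir :: "(real ^ 'n::finite \<Rightarrow> real) \<Rightarrow> real ^ 'n \<Rightarrow> real ^ 'n" where
  "descent_dir u x = - (1 / norm (grad u x)) *\<^sub>R grad u x"

lemma norm_descent_dir: "grad u x \<noteq> 0 \<Longrightarrow> norm (descent_dir u x) = 1"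
  by (simp add: descent_dir_def)

lemma norm_descent_dir_le: "norm (descent_dir u x) \<le> 1"
  by (simp add: descent_dir_def)

lemma grad_eq_descent_dir: "grad u x = - norm (grad u x) *\<^sub>R descent_dir u x"
  by (simp add: descent_dir_def)

text \<open>For small displacements, exit is governed by the supremum in the outer direction alone, up
  to an error that is small relative to the largest displacement.\<close>

lemma exit_criterion:
  fixes u :: "real ^ 'n::finite \<Rightarrow> real"
  assumes u: "C1 u" and bd: "bounded {x. 0 < u x}" and r: "0 < r" and \<delta>: "0 < \<delta>" "\<delta> < 1"
    and g: "\<And>x. 0 < u x \<Longrightarrow> u x \<le> r \<Longrightarrow> 1 - \<delta> \<le> norm (grad u x) \<and> norm (grad u x) \<le> 1 + \<delta>"
  obtains \<epsilon>0 where "0 < \<epsilon>0"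
    "\<And>R x. R \<subseteq> cball 0 \<epsilon>0 \<Longrightarrow> 0 \<in> R \<Longrightarrow> 0 < u x \<Longrightarrow> \<not> stays u R x \<Longrightarrow>
      u x \<le> r \<and> u x \<le> (1 + \<delta>) * sup_dir R (descent_dir u x) + \<delta> * sup_norm R"
    "\<And>R x. R \<subseteq> cball 0 \<epsilon>0 \<Longrightarrow> 0 \<in> R \<Longrightarrow> 0 < u x \<Longrightarrow> u x \<le> r \<Longrightarrow>
      u x \<le> (1 - \<delta>) * sup_dir R (descent_dir u x) - \<delta> * sup_norm R \<Longrightarrow> \<not> stays u R x"
proof -
  obtain \<epsilon>1 where \<epsilon>1: "0 < \<epsilon>1"
    "\<And>x y. 0 < u x \<Longrightarrow> norm y \<le> \<epsilon>1 \<Longrightarrow> \<bar>u (x + y) - u x - grad u x \<bullet> y\<bar> \<le> \<delta> * norm y"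
    using C1_uniform_linearization[OF u bd \<delta>(1)] by auto
  have "bounded (grad u ` closure {x. 0 < u x})"
    using bd by (intro compact_imp_bounded compact_continuous_image C1_continuous_grad u) auto
  then obtain B0 where B0: "\<And>x. x \<in> {x. 0 < u x} \<Longrightarrow> norm (grad u x) \<le> B0"
    unfolding bounded_iff using closure_subset by (metis (no_types, lifting) image_eqI subsetD)
  define B where "B = max 1 B0"
  have B: "0 < B" "\<And>x. 0 < u x \<Longrightarrow> norm (grad u x) \<le> B"
    using B0 by (auto simp: B_def intro: max.coboundedI2)
  \<comment> \<open>With this radius a path that exits can only have started where \<open>u \<le> r\<close>, so that the bounds on
    the gradient apply.\<close>
  define \<epsilon>0 where "\<epsilon>0 = min \<epsilon>1 (r / (B + \<delta>))"
  have \<epsilon>0: "0 < \<epsilon>0" "\<epsilon>0 \<le> \<epsilon>1" "(B + \<delta>) * \<epsilon>0 \<le> r"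
  proof -
    show "0 < \<epsilon>0" "\<epsilon>0 \<le> \<epsilon>1" using \<epsilon>1 r B \<delta> by (auto simp: \<epsilon>0_def)
    have "(B + \<delta>) * \<epsilon>0 \<le> (B + \<delta>) * (r / (B + \<delta>))"
      using B \<delta> by (intro mult_left_mono) (auto simp: \<epsilon>0_def)
    also have "\<dots> = r" using B(1) \<delta>(1) by simp
    finally show "(B + \<delta>) * \<epsilon>0 \<le> r" .
  qed
  show thesis
  proof (rule that[OF \<epsilon>0(1)])
    fix R x assume R: "R \<subseteq> cball 0 \<epsilon>0" "0 \<in> R" and x: "0 < u x" and ns: "\<not> stays u R x"
    let ?M = "sup_dir R (descent_dir u x)" and ?K = "sup_norm R" and ?g = "norm (grad u x)"
    have bR: "bounded R" using R(1) bounded_cball bounded_subset by blast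
    have lower: "u x - ?g * ?M - \<delta> * ?K \<le> u (x + y)" if y: "y \<in> R" for y
    proof -
      have "\<bar>u (x + y) - u x - grad u x \<bullet> y\<bar> \<le> \<delta> * norm y"
        using R(1) y \<epsilon>0(2) by (intro \<epsilon>1(2)[OF x]) auto
      moreover have "\<delta> * norm y \<le> \<delta> * ?K"
        using sup_norm_upper[OF bR y] \<delta> by simp
      moreover have "grad u x \<bullet> y = - (?g * (descent_dir u x \<bullet> y))"
        by (subst grad_eq_descent_dir) simp
      moreover have "?g * (descent_dir u x \<bullet> y) \<le> ?g * ?M"
        by (intro mult_left_mono sup_dir_upper[OF bR y]) simp
      ultimately show ?thesis by linarith
    qed
    have up: "u x \<le> ?g * ?M + \<delta> * ?K"
    proof (rule ccontr)
      assume "\<not> ?thesis"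
      then have "0 < u x - ?g * ?M - \<delta> * ?K" by simp
      then obtain n where "1 / real (Suc n) < u x - ?g * ?M - \<delta> * ?K"
        by (metis nat_approx_posE)
      then have "stays u R x" unfolding stays_def using lower by (meson less_imp_le order_trans)
      with ns show False ..
    qed
    have M: "0 \<le> ?M" "?M \<le> \<epsilon>0"
    proof -
      show "0 \<le> ?M" by (rule sup_dir_nonneg[OF bR R(2)])
      show "?M \<le> \<epsilon>0"
      proof (rule sup_dir_le)
        fix y assume "y \<in> R"
        then have "norm y \<le> \<epsilon>0" using R(1) by auto
        then have "norm (descent_dir u x) * norm y \<le> 1 * \<epsilon>0"
          using norm_descent_dir_le[of u x] by (intro mult_mono) auto
        then show "descent_dir u x \<bullet> y \<le> \<epsilon>0"
          using norm_cauchy_schwarz[of "descent_dir u x" y] by simp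
      qed (use R in auto)
    qed
    have K: "?K \<le> \<epsilon>0" using R by (intro sup_norm_le) auto
    have "?g * ?M \<le> B * \<epsilon>0" using B(2)[OF x] M B(1) by (intro mult_mono) auto
    moreover have "\<delta> * ?K \<le> \<delta> * \<epsilon>0" using K \<delta> by simp
    ultimately have ur: "u x \<le> r" using up \<epsilon>0(3) by (simp add: distrib_right)
    have "?g * ?M \<le> (1 + \<delta>) * ?M"
      using g[OF x ur] M(1) by (intro mult_right_mono) auto
    with ur up show "u x \<le> r \<and> u x \<le> (1 + \<delta>) * ?M + \<delta> * ?K" by simp
  next
    fix R x assume R: "R \<subseteq> cball 0 \<epsilon>0" "0 \<in> R" and x: "0 < u x" "u x \<le> r"
      and le: "u x \<le> (1 - \<delta>) * sup_dir R (descent_dir u x) - \<delta> * sup_norm R"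
    let ?M = "sup_dir R (descent_dir u x)" and ?K = "sup_norm R" and ?g = "norm (grad u x)"
    have bR: "bounded R" using R(1) bounded_cball bounded_subset by blast
    have gpos: "0 < ?g" using g[OF x] \<delta> by linarith
    have "(1 - \<delta>) * ?M \<le> ?g * ?M"
      using g[OF x] sup_dir_nonneg[OF bR R(2)] by (intro mult_right_mono) auto
    with le have le2: "u x \<le> ?g * ?M - \<delta> * ?K" by simp
    show "\<not> stays u R x"
    proof
      assume "stays u R x"
      then obtain n where n: "\<And>y. y \<in> R \<Longrightarrow> 1 / real (Suc n) \<le> u (x + y)"
        unfolding stays_def by blast
      have "?M \<le> (u x + \<delta> * ?K - 1 / real (Suc n)) / ?g"
      proof (rule sup_dir_le)
        fix y assume y: "y \<in> R"
        have "\<bar>u (x + y) - u x - grad u x \<bullet> y\<bar> \<le> \<delta> * norm y"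
          using R(1) y \<epsilon>0(2) by (intro \<epsilon>1(2)[OF x(1)]) auto
        moreover have "\<delta> * norm y \<le> \<delta> * ?K"
          using sup_norm_upper[OF bR y] \<delta> by simp
        moreover have "grad u x \<bullet> y = - (?g * (descent_dir u x \<bullet> y))"
          by (subst grad_eq_descent_dir) simp
        ultimately have "?g * (descent_dir u x \<bullet> y) \<le> u x + \<delta> * ?K - 1 / real (Suc n)"
          using n[OF y] by linarith
        then show "descent_dir u x \<bullet> y \<le> (u x + \<delta> * ?K - 1 / real (Suc n)) / ?g"
          using gpos by (simp only: pos_le_divide_eq mult.commute)
      qed (use R in auto)
      then have "?g * ?M \<le> u x + \<delta> * ?K - 1 / real (Suc n)"
        using gpos by (simp only: pos_le_divide_eq mult.commute)
      moreover have "0 < 1 / real (Suc n)" by simp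
      ultimately show False using le2 by linarith
    qed
  qed
qed

lemma emeasure_lborel_translate:
  fixes A :: "'a::euclidean_space set"
  assumes "A \<in> sets borel"
  shows "emeasure lborel {x. x - c \<in> A} = emeasure lborel A"
proof -
  have "emeasure lborel A = emeasure (distr lborel borel ((+) (- c))) A"
    by (simp add: lborel_distr_plus)
  also have "\<dots> = emeasure lborel {x. x - c \<in> A}"
    using assms by (subst emeasure_distr) (auto simp: vimage_def)
  finally show ?thesis by simp
qed

text \<open>A bounded set with infinitely many disjoint translates into a bounded region is null.\<close>

lemma null_set_disjoint_translates:
  fixes A :: "'a::euclidean_space set" and c :: "nat \<Rightarrow> 'a"
  assumes A: "A \<in> sets borel" "bounded A" and c: "bounded (range c)"
    and disj: "disjoint_family (\<lambda>j. {x. x - c j \<in> A})"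
  shows "A \<in> null_sets lborel"
proof -
  let ?T = "\<lambda>j. {x. x - c j \<in> A}"
  obtain a b where ab: "\<And>x. x \<in> A \<Longrightarrow> norm x \<le> a" "\<And>j. norm (c j) \<le> b"
    using A(2) c by (auto simp: bounded_iff)
  have sub: "?T j \<subseteq> cball 0 (a + b)" for j
  proof
    fix x assume "x \<in> ?T j"
    then have "norm (x - c j) \<le> a" using ab(1) by auto
    then show "x \<in> cball 0 (a + b)"
      using ab(2)[of j] norm_triangle_ineq[of "x - c j" "c j"] by simp
  qed
  have sets: "?T j \<in> sets lborel" for j
    using A(1) by (simp add: measurable_sets_borel[of "\<lambda>x. x - c j", simplified vimage_def])
  have fin: "emeasure lborel (cball 0 (a + b) :: 'a set) < \<infinity>" "emeasure lborel A < \<infinity>"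
    by (rule emeasure_bounded_finite bounded_cball A(2))+
  obtain V m where V: "emeasure lborel (cball 0 (a + b) :: 'a set) = ennreal V" "0 \<le> V"
    and m: "emeasure lborel A = ennreal m" "0 \<le> m"
    using fin by (metis ennreal_cases infinity_ennreal_def less_irrefl)
  have "real N * m \<le> V" for N
  proof -
    have "ennreal (real N * m) = (\<Sum>j<N. emeasure lborel (?T j))"
      using m by (simp add: emeasure_lborel_translate[OF A(1)] ennreal_mult ennreal_of_nat_eq_real_of_nat)
    also have "\<dots> = emeasure lborel (\<Union>j<N. ?T j)"
      using sets disj by (intro sum_emeasure) (auto simp: disjoint_family_on_def)
    also have "\<dots> \<le> ennreal V"
      unfolding V(1)[symmetric] using sub by (intro emeasure_mono) auto
    finally show ?thesis using V(2) by simp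
  qed
  then have "m = 0"
    using m(2) reals_Archimedean3[of m] by (metis less_eq_real_def not_le)
  then show ?thesis using A(1) m by (intro null_setsI) auto
qed

lemma pred_countable_ball:
  assumes "countable I" "\<And>i. i \<in> I \<Longrightarrow> Measurable.pred M (P i)"
  shows "Measurable.pred M (\<lambda>x. \<forall>i\<in>I. P i x)"
proof (cases "I = {}")
  case False
  have "(\<lambda>x. \<forall>i\<in>I. P i x) = (\<lambda>x. \<forall>n. P (from_nat_into I n) x)"
    using False assms(1) by (metis from_nat_into from_nat_into_surj)
  then show ?thesis
    using False assms(2) by (auto intro!: pred_intros_countable from_nat_into)
qed simp

text \<open>A translate of \<open>R\<close> that lies in the superlevel set but touches its boundary in the limit leaves
  it under all small shifts in some fixed coordinate direction. Hence such positions form a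
  null set.\<close>

lemma null_set_touching:
  fixes u :: "real ^ 'n::finite \<Rightarrow> real"
  assumes u: "C1 u" and bd: "bounded {x. 0 < u x}"
    and g: "\<And>x. x \<in> frontier {x. 0 < u x} \<Longrightarrow> grad u x \<noteq> 0"
    and R: "countable R" "bounded R" "R \<noteq> {}"
  shows "{x. (\<forall>y\<in>R. 0 < u (x + y)) \<and> \<not> stays u R x} \<in> null_sets lborel"
proof -
  define C where "C = {x. \<forall>y\<in>R. 0 < u (x + y)}"
  define N where "N = {x \<in> C. \<not> stays u R x}"
  have [measurable]: "u \<in> borel_measurable borel"
    by (intro borel_measurable_continuous_onI C1_continuous u)
  have [measurable]: "C \<in> sets borel"
  proof -
    have "Measurable.pred borel (\<lambda>x. \<forall>y\<in>R. 0 < u (x + y))"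
      by (rule pred_countable_ball[OF R(1)]) measurable
    then show ?thesis by (simp add: C_def pred_def)
  qed
  have [measurable]: "N \<in> sets borel"
  proof -
    have "Measurable.pred borel (\<lambda>x. \<exists>n. \<forall>y\<in>R. 1 / real (Suc n) \<le> u (x + y))"
      by (intro pred_intros_countable pred_countable_ball[OF R(1)]) measurable
    then have "{x. stays u R x} \<in> sets borel" by (simp add: stays_def pred_def)
    moreover have "N = C - {x. stays u R x}" by (auto simp: N_def)
    ultimately show ?thesis by simp
  qed
  have bC: "bounded C"
  proof -
    obtain y where y: "y \<in> R" using R(3) by blast
    have "C \<subseteq> (\<lambda>z. z - y) ` {x. 0 < u x}"
      using y by (auto simp: C_def intro!: image_eqI[of _ _ "_ + y"])
    then show ?thesis using bounded_translation_minus[OF bd] bounded_subset by blast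
  qed
  \<comment> \<open>The positions that leave \<open>C\<close> under all rational shifts of size below \<open>1 / Suc n\<close> along one
    coordinate half-axis. Rational shifts suffice for disjointness and keep the set measurable.\<close>
  define D where "D i \<sigma> n = {x \<in> N. \<forall>q\<in>\<rat>. 0 < q \<and> q < 1 / real (Suc n) \<longrightarrow> x + (q * \<sigma>) *\<^sub>R axis i 1 \<notin> C}"
    for i :: 'n and \<sigma> :: real and n
  have Dnull: "D i \<sigma> n \<in> null_sets lborel" if \<sigma>: "\<sigma> \<in> {1, -1}" for i \<sigma> n
  proof (rule null_set_disjoint_translates)
    have "Measurable.pred borel (\<lambda>x. x \<in> N \<and> (\<forall>q\<in>\<rat>. 0 < q \<and> q < 1 / real (Suc n) \<longrightarrow> x + (q * \<sigma>) *\<^sub>R axis i 1 \<notin> C))"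
      by (intro pred_intros_logic pred_countable_ball countable_rat) measurable
    then show "D i \<sigma> n \<in> sets borel" by (simp add: D_def pred_def)
    show "bounded (D i \<sigma> n)" by (rule bounded_subset[OF bC]) (auto simp: D_def N_def)
    define h where "h j = 1 / (real (Suc n) * real (j + 2))" for j :: nat
    have h: "0 < h j" "h j < 1 / real (Suc n)" "h j \<in> \<rat>" for j
    proof -
      show "0 < h j" "h j \<in> \<rat>" by (simp_all add: h_def)
      have "1 * real (Suc n) < real (j + 2) * real (Suc n)"
        by (rule mult_strict_right_mono) auto
      then show "h j < 1 / real (Suc n)"
        unfolding h_def by (intro divide_strict_left_mono) (auto simp: mult.commute simp del: of_nat_Suc of_nat_add)
    qed
    have anti: "h k < h j" if "j < k" for j k
      unfolding h_def using that
      by (intro divide_strict_left_mono mult_strict_left_mono) (auto simp: add_pos_pos)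
    let ?c = "\<lambda>j. (h j * \<sigma>) *\<^sub>R axis i (1::real) :: real ^ 'n"
    show "bounded (range ?c)"
      unfolding bounded_iff
    proof (intro exI ballI)
      fix v assume "v \<in> range ?c"
      then obtain j where "v = ?c j" by blast
      then show "norm v \<le> 1 / real (Suc n)"
        using h(1,2)[of j] \<sigma> by (auto simp: abs_mult simp del: of_nat_Suc)
    qed
    have dis: "{x. x - ?c j \<in> D i \<sigma> n} \<inter> {x. x - ?c k \<in> D i \<sigma> n} = {}" if "j < k" for j k
    proof (rule ccontr)
      assume "\<not> ?thesis"
      then obtain x where x: "x - ?c j \<in> D i \<sigma> n" "x - ?c k \<in> D i \<sigma> n" by auto
      have "h j - h k \<in> \<rat>" "0 < h j - h k" "h j - h k < 1 / real (Suc n)"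
        using h[of j] h[of k] anti[OF that] by (auto simp del: of_nat_Suc)
      then have "(x - ?c j) + ((h j - h k) * \<sigma>) *\<^sub>R axis i 1 \<notin> C"
        using x(1) unfolding D_def by blast
      moreover have "(x - ?c j) + ((h j - h k) * \<sigma>) *\<^sub>R axis i 1 = x - ?c k"
        by (simp add: algebra_simps)
      moreover have "x - ?c k \<in> C" using x(2) by (simp add: D_def N_def)
      ultimately show False by simp
    qed
    show "disjoint_family (\<lambda>j. {x. x - ?c j \<in> D i \<sigma> n})"
      unfolding disjoint_family_on_def using dis by (metis Int_commute linorder_neqE_nat)
  qed
  have sub: "N \<subseteq> (\<Union>i. \<Union>n. D i 1 n \<union> D i (-1) n)"
  proof
    fix x assume x: "x \<in> N"
    have "\<exists>y\<in>R. u (x + y) < 1 / real (Suc n)" for n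
      using x by (auto simp: N_def stays_def not_le)
    then obtain y where y: "\<And>n. y n \<in> R" "\<And>n. u (x + y n) < 1 / real (Suc n)" by metis
    have "bounded (range y)" using y(1) by (intro bounded_subset[OF R(2)]) auto
    then obtain z s where s: "strict_mono (s :: nat \<Rightarrow> nat)" "(y \<circ> s) \<longlonglongrightarrow> z"
      using bounded_imp_convergent_subsequence by blast
    have u_lim: "(\<lambda>n. u (x + y (s n) + v)) \<longlonglongrightarrow> u (x + z + v)" for v
    proof -
      have "(\<lambda>n. x + y (s n) + v) \<longlonglongrightarrow> x + z + v"
        using s(2) by (intro tendsto_intros) (simp add: o_def)
      moreover have "isCont u (x + z + v)"
        using has_derivative_continuous[OF C1_has_derivative[OF u]] .
      ultimately show ?thesis by (rule isCont_tendsto_compose[rotated])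
    qed
    have pos: "0 < u (x + y n)" for n using x y(1) by (auto simp: N_def C_def)
    have "x + z \<in> closure {x. 0 < u x}"
      unfolding closure_sequential
    proof (intro exI conjI allI)
      show "x + y (s n) \<in> {x. 0 < u x}" for n using pos by simp
      show "(\<lambda>n. x + y (s n)) \<longlonglongrightarrow> x + z"
        using s(2) by (intro tendsto_intros) (simp add: o_def)
    qed
    moreover have "u (x + z) = 0"
    proof (rule LIMSEQ_unique)
      show "(\<lambda>n. u (x + y (s n))) \<longlonglongrightarrow> u (x + z)" using u_lim[of 0] by simp
      show "(\<lambda>n. u (x + y (s n))) \<longlonglongrightarrow> 0"
      proof (rule tendsto_sandwich[OF _ _ tendsto_const])
        show "(\<lambda>n. inverse (real (Suc n))) \<longlonglongrightarrow> 0" by (rule LIMSEQ_inverse_real_of_nat)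
        show "\<forall>\<^sub>F n in sequentially. u (x + y (s n)) \<le> inverse (real (Suc n))"
        proof (intro always_eventually allI)
          fix n
          have "inverse (real (Suc (s n))) \<le> inverse (real (Suc n))"
            using seq_suble[OF s(1), of n] by (intro le_imp_inverse_le) auto
          then show "u (x + y (s n)) \<le> inverse (real (Suc n))"
            using y(2)[of "s n"] by (simp add: inverse_eq_divide)
        qed
      qed (intro always_eventually allI less_imp_le pos)
    qed
    ultimately have gz: "grad u (x + z) \<noteq> 0" and uz: "u (x + z) = 0"
      using frontier_superlevel(2)[OF u] g by blast+
    then obtain i where i: "grad u (x + z) $ i \<noteq> 0" by (auto simp: vec_eq_iff)
    define \<sigma> where "\<sigma> = - sgn (grad u (x + z) $ i)"
    have \<sigma>: "\<sigma> \<in> {1, -1}" using i by (auto simp: \<sigma>_def sgn_if)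
    have "((\<lambda>s. u (x + z + s *\<^sub>R (\<sigma> *\<^sub>R axis i 1))) has_real_derivative
        grad u (x + z + 0 *\<^sub>R (\<sigma> *\<^sub>R axis i 1)) \<bullet> (\<sigma> *\<^sub>R axis i 1)) (at 0)"
      by (rule C1_line_derivative[OF u])
    moreover have "grad u (x + z + 0 *\<^sub>R (\<sigma> *\<^sub>R axis i 1)) \<bullet> (\<sigma> *\<^sub>R axis i 1) < 0"
      using i by (auto simp: inner_axis \<sigma>_def sgn_if)
    ultimately obtain d where d: "0 < d" "\<And>h. 0 < h \<Longrightarrow> h < d \<Longrightarrow> u (x + z + h *\<^sub>R (\<sigma> *\<^sub>R axis i 1)) < 0"
      using DERIV_neg_dec_right[of "\<lambda>s. u (x + z + s *\<^sub>R (\<sigma> *\<^sub>R axis i 1))" _ 0] uz by auto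
    obtain n where n: "1 / real (Suc n) < d" using d(1) by (metis nat_approx_posE)
    have "x + (q * \<sigma>) *\<^sub>R axis i 1 \<notin> C" if q: "0 < q" "q < 1 / real (Suc n)" for q
    proof
      assume c: "x + (q * \<sigma>) *\<^sub>R axis i 1 \<in> C"
      let ?v = "(q * \<sigma>) *\<^sub>R axis i 1 :: real ^ 'n"
      have "u (x + z + ?v) < 0" using d(2)[of q] q n by simp
      with u_lim[of ?v] have "\<forall>\<^sub>F k in sequentially. u (x + y (s k) + ?v) < 0"
        by (rule order_tendstoD)
      then obtain k where "u (x + y (s k) + ?v) < 0"
        using eventually_happens'[OF sequentially_bot] by blast
      moreover have "0 < u (x + ?v + y (s k))" using c y(1) by (simp add: C_def)
      moreover have "x + ?v + y (s k) = x + y (s k) + ?v" by simp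
      ultimately show False by (metis less_asym)
    qed
    then have "x \<in> D i \<sigma> n" using x by (simp add: D_def)
    then show "x \<in> (\<Union>i. \<Union>n. D i 1 n \<union> D i (-1) n)" using \<sigma> by auto
  qed
  have "(\<Union>i. \<Union>n. D i 1 n \<union> D i (-1) n) \<in> null_sets lborel"
    by (intro null_sets_UN' null_sets.Un Dnull) (auto intro: countable_finite)
  then have "N \<in> null_sets lborel"
    by (rule null_sets_subset[OF _ _ sub]) simp
  then show ?thesis by (simp add: N_def C_def conj_commute)
qed

section \<open>Right-continuous paths along countably many times\<close>

text \<open>A countable set of times that determines the closure of the range of a right-continuous path on
  \<open>{0..t}\<close>. The end point \<open>t\<close> has to be included, because right-continuity says nothing about it from
  inside the interval.\<close>

definition dense_times :: "real \<Rightarrow> real set" where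
  "dense_times t = insert 0 (insert t (\<rat> \<inter> {0..t}))"

text \<open>The values of a path at these times.\<close>

definition path_values :: "(real \<Rightarrow> 'w \<Rightarrow> 'a) \<Rightarrow> real \<Rightarrow> 'w \<Rightarrow> 'a set" where
  "path_values X t \<omega> = (\<lambda>s. X s \<omega>) ` dense_times t"

lemma countable_dense_times: "countable (dense_times t)"
  by (auto simp: dense_times_def intro: countable_rat countable_Int1)

lemma dense_times_subset: "0 \<le> t \<Longrightarrow> dense_times t \<subseteq> {0..t}"
  by (auto simp: dense_times_def)

lemma cadlag_right_tendsto: "cadlag f \<Longrightarrow> 0 \<le> t \<Longrightarrow> (f \<longlongrightarrow> f t) (at_right t)"
  by (auto simp: cadlag_def continuous_within)

lemma cadlag_bounded:
  fixes f :: "real \<Rightarrow> 'a::real_normed_vector"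
  assumes f: "cadlag f" and t: "0 \<le> t"
  shows "bounded (f ` {0..t})"
proof -
  have "bounded (f ` ({0..t} \<inter> {0..t}))"
  proof (rule Bolzano[OF t, where P = "\<lambda>a b. bounded (f ` ({a..b} \<inter> {0..t}))"])
    fix a b c :: real
    assume "bounded (f ` ({a..b} \<inter> {0..t}))" "bounded (f ` ({b..c} \<inter> {0..t}))"
    then have "bounded (f ` ({a..b} \<inter> {0..t}) \<union> f ` ({b..c} \<inter> {0..t}))" by simp
    then show "bounded (f ` ({a..c} \<inter> {0..t}))"
      unfolding image_Un[symmetric] by (rule bounded_subset) (intro image_mono, auto)
  next
    fix x assume x: "0 \<le> x" "x \<le> t"
    have "\<forall>\<^sub>F y in at_right x. dist (f y) (f x) < 1"
      using cadlag_right_tendsto[OF f x(1)] by (rule tendstoD) simp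
    then obtain b1 where b1: "x < b1" "\<And>y. x < y \<Longrightarrow> y < b1 \<Longrightarrow> dist (f y) (f x) < 1"
      unfolding eventually_at_right_field by blast
    define d1 where "d1 = b1 - x"
    have d1: "0 < d1" "\<And>y. x < y \<Longrightarrow> y < x + d1 \<Longrightarrow> dist (f y) (f x) < 1"
      using b1 by (simp_all add: d1_def)
    have "\<exists>d2 l. 0 < d2 \<and> (\<forall>y. 0 \<le> y \<longrightarrow> x - d2 < y \<longrightarrow> y < x \<longrightarrow> dist (f y) l < 1)"
    proof (cases "x = 0")
      case True
      have "0 < (1::real) \<and> (\<forall>y. 0 \<le> y \<longrightarrow> x - 1 < y \<longrightarrow> y < x \<longrightarrow> dist (f y) 0 < 1)"
        using True by simp
      then show ?thesis by blast
    next
      case False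
      then have "0 < x" using x by simp
      then obtain l where "(f \<longlongrightarrow> l) (at_left x)" using f by (auto simp: cadlag_def)
      then have "\<forall>\<^sub>F y in at_left x. dist (f y) l < 1" by (rule tendstoD) simp
      then obtain b where b: "b < x" "\<And>y. b < y \<Longrightarrow> y < x \<Longrightarrow> dist (f y) l < 1"
        unfolding eventually_at_left_field by blast
      then show ?thesis by (intro exI[of _ "x - b"] exI[of _ l]) auto
    qed
    then obtain d2 l where "0 < d2 \<and> (\<forall>y. 0 \<le> y \<longrightarrow> x - d2 < y \<longrightarrow> y < x \<longrightarrow> dist (f y) l < 1)"
      by (elim exE)
    then have d2: "0 < d2" "\<And>y. 0 \<le> y \<Longrightarrow> x - d2 < y \<Longrightarrow> y < x \<Longrightarrow> dist (f y) l < 1"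
      by simp_all
    show "\<exists>d>0. \<forall>a b. a \<le> x \<and> x \<le> b \<and> b - a < d \<longrightarrow> bounded (f ` ({a..b} \<inter> {0..t}))"
    proof (intro exI[of _ "min d1 d2"] conjI allI impI)
      fix a b assume ab: "a \<le> x \<and> x \<le> b \<and> b - a < min d1 d2"
      have "f ` ({a..b} \<inter> {0..t}) \<subseteq> cball (f x) 1 \<union> cball l 1"
      proof
        fix z assume "z \<in> f ` ({a..b} \<inter> {0..t})"
        then obtain y where y: "z = f y" "a \<le> y" "y \<le> b" "0 \<le> y" by auto
        consider "y < x" | "y = x" | "x < y" by linarith
        then show "z \<in> cball (f x) 1 \<union> cball l 1"
        proof cases
          case 1
          then have "dist (f y) l < 1" using y ab by (intro d2(2)) auto
          then show ?thesis by (simp add: y(1) dist_commute)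
        next
          case 3
          then have "dist (f y) (f x) < 1" using y ab by (intro d1(2)) auto
          then show ?thesis by (simp add: y(1) dist_commute)
        qed (simp add: y(1))
      qed
      then show "bounded (f ` ({a..b} \<inter> {0..t}))"
        by (rule bounded_subset[rotated]) simp
    qed (use d1 d2 in simp)
  qed
  then show ?thesis by simp
qed

text \<open>Up to closure, the values at the countably many times exhaust the path.\<close>

lemma cadlag_dense:
  fixes f :: "real \<Rightarrow> 'a::metric_space"
  assumes f: "cadlag f" and s: "s \<in> {0..t}"
  shows "f s \<in> closure (f ` dense_times t)"
proof (cases "s = t")
  case True
  then have "f s \<in> f ` dense_times t" by (simp add: dense_times_def)
  then show ?thesis by (rule subsetD[OF closure_subset])
next
  case False
  show ?thesis unfolding closure_approachable
  proof (intro allI impI)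
    fix e :: real assume "0 < e"
    then have "\<forall>\<^sub>F y in at_right s. dist (f y) (f s) < e"
      using cadlag_right_tendsto[OF f] s by (intro tendstoD) auto
    then obtain b where b: "s < b" "\<And>y. s < y \<Longrightarrow> y < b \<Longrightarrow> dist (f y) (f s) < e"
      unfolding eventually_at_right_field by blast
    obtain q where q: "q \<in> \<rat>" "s < q" "q < min b t"
      using Rats_dense_in_real[of s "min b t"] b(1) False s by auto
    then have "q \<in> dense_times t" "dist (f q) (f s) < e"
      using b(2)[of q] s by (simp_all add: dense_times_def)
    then show "\<exists>y\<in>f ` dense_times t. dist y (f s) < e" by blast
  qed
qed

lemma bounded_path_values:
  fixes X :: "real \<Rightarrow> 'w \<Rightarrow> 'a::real_normed_vector"
  assumes "cadlag (\<lambda>t. X t \<omega>)" "0 \<le> t"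
  shows "bounded (path_values X t \<omega>)"
  unfolding path_values_def
  by (rule bounded_subset[OF cadlag_bounded[OF assms]]) (use dense_times_subset[OF assms(2)] in auto)

lemma running_sup_eq:
  fixes X :: "real \<Rightarrow> 'w \<Rightarrow> real ^ 'n::finite"
  assumes c: "cadlag (\<lambda>t. X t \<omega>)" and t: "0 \<le> t"
  shows "running_sup X k t \<omega> = sup_dir (path_values X t \<omega>) (axis k 1)"
proof -
  let ?R = "path_values X t \<omega>"
  have bR: "bounded ?R" by (rule bounded_path_values[of X \<omega>, OF c t])
  have eq: "running_sup X k t \<omega> = sup_dir ((\<lambda>s. X s \<omega>) ` {0..t}) (axis k 1)"
    by (simp add: running_sup_def sup_dir_def image_image inner_axis inner_commute)
  have sub: "?R \<subseteq> (\<lambda>s. X s \<omega>) ` {0..t}"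
    using dense_times_subset[OF t] by (auto simp: path_values_def)
  have ne: "?R \<noteq> {}" by (auto simp: path_values_def dense_times_def)
  show ?thesis unfolding eq
  proof (rule antisym)
    show "sup_dir ((\<lambda>s. X s \<omega>) ` {0..t}) (axis k 1) \<le> sup_dir ?R (axis k 1)"
    proof (rule sup_dir_le)
      fix y assume "y \<in> (\<lambda>s. X s \<omega>) ` {0..t}"
      then have "y \<in> closure ?R" using cadlag_dense[OF c] by (auto simp: path_values_def)
      moreover have "closure ?R \<subseteq> {y. axis k 1 \<bullet> y \<le> sup_dir ?R (axis k 1)}"
        by (intro closure_minimal closed_halfspace_le) (auto intro: sup_dir_upper[OF bR])
      ultimately show "axis k 1 \<bullet> y \<le> sup_dir ?R (axis k 1)" by auto
    qed (use ne sub in blast)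
    show "sup_dir ?R (axis k 1) \<le> sup_dir ((\<lambda>s. X s \<omega>) ` {0..t}) (axis k 1)"
      by (intro sup_dir_le ne sup_dir_upper cadlag_bounded[OF c t]) (use sub in blast)
  qed
qed

lemma stays_imp_exit_time:
  fixes X :: "real \<Rightarrow> 'w \<Rightarrow> real ^ 'n::finite"
  assumes u: "C1 u" and c: "cadlag (\<lambda>t. X t \<omega>)" and t: "0 \<le> t"
    and st: "stays u (path_values X t \<omega>) 0"
  shows "ereal t < exit_time X {x. 0 < u x} \<omega>"
proof -
  obtain n where n: "\<And>y. y \<in> path_values X t \<omega> \<Longrightarrow> 1 / real (Suc n) \<le> u y"
    using st by (auto simp: stays_def)
  have "closure (path_values X t \<omega>) \<subseteq> {y. 1 / real (Suc n) \<le> u y}"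
    by (intro closure_minimal closed_Collect_le continuous_on_const C1_continuous u) (use n in auto)
  then have "1 / real (Suc n) \<le> u (X s \<omega>)" if "s \<in> {0..t}" for s
    using cadlag_dense[OF c that] by (auto simp: path_values_def)
  moreover have "0 < 1 / real (Suc n)" by simp
  ultimately have pos: "0 < u (X s \<omega>)" if "s \<in> {0..t}" for s
    using that by (meson less_le_trans)
  have "((\<lambda>s. u (X s \<omega>)) \<longlongrightarrow> u (X t \<omega>)) (at_right t)"
    using has_derivative_continuous[OF C1_has_derivative[OF u]] cadlag_right_tendsto[OF c t]
    by (rule isCont_tendsto_compose)
  moreover have "0 < u (X t \<omega>)" using t by (intro pos) simp
  ultimately have "\<forall>\<^sub>F s in at_right t. 0 < u (X s \<omega>)" by (rule order_tendstoD)
  then obtain b where b: "t < b" "\<And>s. t < s \<Longrightarrow> s < b \<Longrightarrow> 0 < u (X s \<omega>)"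
    unfolding eventually_at_right_field by blast
  have "ereal b \<le> exit_time X {x. 0 < u x} \<omega>"
    unfolding exit_time_def
  proof (rule Inf_greatest)
    fix v assume "v \<in> ereal ` {t. 0 \<le> t \<and> X t \<omega> \<notin> {x. 0 < u x}}"
    then obtain s where s: "v = ereal s" "0 \<le> s" "\<not> 0 < u (X s \<omega>)" by auto
    then have "\<not> s \<le> t" using pos[of s] by auto
    then have "\<not> s < b" using s(3) b(2)[of s] by auto
    then show "ereal b \<le> v" by (simp add: s(1))
  qed
  then show ?thesis using b(1) by (meson ereal_less_eq less_ereal.simps(1) less_le_trans)
qed

lemma exit_time_imp_inside:
  assumes "ereal t < exit_time X \<Omega> \<omega>" "s \<in> {0..t}"
  shows "X s \<omega> \<in> \<Omega>"
proof (rule ccontr)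
  assume "X s \<omega> \<notin> \<Omega>"
  then have "exit_time X \<Omega> \<omega> \<le> ereal s"
    unfolding exit_time_def using assms(2) by (intro Inf_lower) auto
  also have "\<dots> \<le> ereal t" using assms(2) by simp
  finally show False using assms(1) by simp
qed

section \<open>Consequences of invariance for path functionals\<close>

lemma path_law_prob_eq:
  fixes Y :: "real \<Rightarrow> 'w \<Rightarrow> real ^ 'n::finite" and Y' :: "real \<Rightarrow> 'w \<Rightarrow> real ^ 'n"
  assumes eq: "path_law M Y = path_law M' Y'"
    and Y: "\<And>s. 0 \<le> s \<Longrightarrow> Y s \<in> borel_measurable M"
    and Y': "\<And>s. 0 \<le> s \<Longrightarrow> Y' s \<in> borel_measurable M'"
    and Q: "Measurable.pred (\<Pi>\<^sub>M s\<in>{0..}. borel) Q"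
  shows "measure M {\<omega> \<in> space M. Q (\<lambda>s\<in>{0..}. Y s \<omega>)} = measure M' {\<omega> \<in> space M'. Q (\<lambda>s\<in>{0..}. Y' s \<omega>)}"
proof -
  have *: "measure N {\<omega> \<in> space N. Q (\<lambda>s\<in>{0..}. Z s \<omega>)}
      = measure (path_law N Z) {f \<in> space (\<Pi>\<^sub>M s\<in>{0..}. borel). Q f}"
    if "\<And>s. 0 \<le> s \<Longrightarrow> Z s \<in> borel_measurable N" for N and Z :: "real \<Rightarrow> 'w \<Rightarrow> real ^ 'n"
  proof -
    have m: "(\<lambda>\<omega>. \<lambda>s\<in>{0..}. Z s \<omega>) \<in> N \<rightarrow>\<^sub>M (\<Pi>\<^sub>M s\<in>{0..}. borel)"
      using that by (intro measurable_restrict) auto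
    show ?thesis
      unfolding path_law_def using Q
      by (subst measure_distr[OF m])
        (auto simp: pred_def space_PiM intro!: arg_cong[where f = "measure N"])
  qed
  show ?thesis using *[OF Y] *[OF Y'] eq by simp
qed

lemma min_sum_le:
  assumes "finite I" "\<And>i. i \<in> I \<Longrightarrow> 0 \<le> a i"
  shows "min (\<Sum>i\<in>I. a i) 1 \<le> (\<Sum>i\<in>I. min (a i) (1::real))"
  using assms
proof (induction rule: finite_induct)
  case (insert i I)
  have "0 \<le> (\<Sum>i\<in>I. a i)" "0 \<le> a i" using insert by (auto intro: sum_nonneg)
  then have "min (a i + (\<Sum>i\<in>I. a i)) 1 \<le> min (a i) 1 + min (\<Sum>i\<in>I. a i) 1" by simp
  moreover have "min (\<Sum>i\<in>I. a i) 1 \<le> (\<Sum>i\<in>I. min (a i) 1)" using insert by simp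
  ultimately show ?case using insert(1,2) by simp
qed simp

lemma SUP_real_of_ereal:
  fixes g :: "'a \<Rightarrow> real"
  assumes "bdd_above (g ` D)" "D \<noteq> {}"
  shows "real_of_ereal (SUP q\<in>D. ereal (g q)) = (SUP q\<in>D. g q)"
proof -
  obtain B where B: "\<And>q. q \<in> D \<Longrightarrow> g q \<le> B" using assms(1) by (auto simp: bdd_above_def)
  obtain q where q: "q \<in> D" using assms(2) by blast
  have "(SUP q\<in>D. ereal (g q)) \<le> ereal B" using B by (intro SUP_least) simp
  moreover have "ereal (g q) \<le> (SUP q\<in>D. ereal (g q))" using q by (rule SUP_upper)
  ultimately have "\<bar>SUP q\<in>D. ereal (g q)\<bar> \<noteq> \<infinity>" by auto
  then have "ereal (SUP q\<in>D. g q) = (SUP q\<in>D. ereal (g q))" by (rule ereal_SUP)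
  then show ?thesis by (metis real_of_ereal.simps(1))
qed

text \<open>The suprema as measurable functionals on the space of all paths; the detour over the extended
  reals gives them a value at unbounded paths.\<close>

definition path_sup_dir :: "real \<Rightarrow> real ^ 'n::finite \<Rightarrow> (real \<Rightarrow> real ^ 'n) \<Rightarrow> real" where
  "path_sup_dir t e f = real_of_ereal (SUP q\<in>dense_times t. ereal (e \<bullet> f q))"

text \<open>The same for the largest displacement.\<close>

definition path_sup_norm :: "real \<Rightarrow> (real \<Rightarrow> real ^ 'n::finite) \<Rightarrow> real" where
  "path_sup_norm t f = real_of_ereal (SUP q\<in>dense_times t. ereal (norm (f q)))"

lemma path_component_measurable:
  "0 \<le> t \<Longrightarrow> q \<in> dense_times t \<Longrightarrow> (\<lambda>f. f q) \<in> borel_measurable (\<Pi>\<^sub>M s\<in>{0::real..}. borel)"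
  using dense_times_subset[of t] by (intro measurable_component_singleton) auto

lemma path_sup_measurable:
  assumes t: "0 \<le> t"
  shows "path_sup_dir t e \<in> borel_measurable (\<Pi>\<^sub>M s\<in>{0..}. borel)"
    "path_sup_norm t \<in> borel_measurable (\<Pi>\<^sub>M s\<in>{0..}. borel)"
proof -
  note [measurable] = path_component_measurable[OF t]
  show "path_sup_dir t e \<in> borel_measurable (\<Pi>\<^sub>M s\<in>{0..}. borel)"
    unfolding path_sup_dir_def[abs_def]
    by (intro borel_measurable_real_of_ereal borel_measurable_SUP countable_dense_times) measurable
  show "path_sup_norm t \<in> borel_measurable (\<Pi>\<^sub>M s\<in>{0..}. borel)"
    unfolding path_sup_norm_def[abs_def]
    by (intro borel_measurable_real_of_ereal borel_measurable_SUP countable_dense_times) measurable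
qed

lemma path_sup_eq:
  fixes Y :: "real \<Rightarrow> 'w \<Rightarrow> real ^ 'n::finite"
  assumes t: "0 \<le> t" and bd: "bounded (path_values Y t \<omega>)"
  shows "path_sup_dir t e (\<lambda>s\<in>{0..}. Y s \<omega>) = sup_dir (path_values Y t \<omega>) e"
    "path_sup_norm t (\<lambda>s\<in>{0..}. Y s \<omega>) = sup_norm (path_values Y t \<omega>)"
proof -
  obtain B where B: "\<And>q. q \<in> dense_times t \<Longrightarrow> norm (Y q \<omega>) \<le> B"
    using bd by (auto simp: bounded_iff path_values_def)
  have r: "(\<lambda>s\<in>{0..}. Y s \<omega>) q = Y q \<omega>" if "q \<in> dense_times t" for q
    using that dense_times_subset[OF t] by auto
  have ne: "dense_times t \<noteq> {}" by (simp add: dense_times_def)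
  have "e \<bullet> Y q \<omega> \<le> norm e * B" if "q \<in> dense_times t" for q
    using norm_cauchy_schwarz[of e "Y q \<omega>"] mult_left_mono[OF B[OF that], of "norm e"] by simp
  then have "bdd_above ((\<lambda>q. e \<bullet> Y q \<omega>) ` dense_times t)" by (auto simp: bdd_above_def)
  then show "path_sup_dir t e (\<lambda>s\<in>{0..}. Y s \<omega>) = sup_dir (path_values Y t \<omega>) e"
    unfolding path_sup_dir_def sup_dir_def path_values_def image_image
    using r ne by (simp add: SUP_real_of_ereal cong: SUP_cong)
  have "bdd_above ((\<lambda>q. norm (Y q \<omega>)) ` dense_times t)" using B by (auto simp: bdd_above_def)
  then show "path_sup_norm t (\<lambda>s\<in>{0..}. Y s \<omega>) = sup_norm (path_values Y t \<omega>)"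
    unfolding path_sup_norm_def sup_norm_def path_values_def image_image
    using r ne by (simp add: SUP_real_of_ereal cong: SUP_cong)
qed

text \<open>A set squeezed between two measurable sets of equal measure has that measure in the completion.\<close>

lemma measure_completion_squeeze:
  assumes "finite_measure M" and S: "S \<in> sets M" and W: "W \<in> sets M" and sub: "S \<subseteq> E" "E \<subseteq> W"
    and eq: "measure M S = measure M W"
  shows "measure (completion M) E = measure M S"
proof -
  interpret finite_measure M by fact
  have "measure M (W - S) = 0"
    using finite_measure_Diff[OF W S] sub eq by auto
  then have "W - S \<in> null_sets (completion M)"
    using S W by (intro null_sets_completionI null_setsI) (auto simp: emeasure_eq_measure)
  then have n: "E - S \<in> null_sets (completion M)"
    by (rule null_sets_completion_subset[rotated]) (use sub in auto)
  have "emeasure (completion M) (S \<union> (E - S)) = emeasure (completion M) S"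
    using S by (intro emeasure_Un_null_set n) auto
  moreover have "S \<union> (E - S) = E" using sub by auto
  ultimately show ?thesis using S by (simp add: measure_def)
qed

section \<open>Isotropic processes\<close>

text \<open>A translation invariant isotropic process whose paths are right-continuous with left limits, as a
  family of probability measures indexed by the starting points.\<close>

locale isotropic_process =
  fixes P :: "real ^ 'n::finite \<Rightarrow> 'w measure" and X :: "real \<Rightarrow> 'w \<Rightarrow> real ^ 'n"
  assumes process: "cadlag_process P X"
    and translation: "translation_invariant P X"
    and isotropy: "isotropic P X"
begin

lemma prob_space_P: "prob_space (P x)"
  using process by (simp add: cadlag_process_def)

sublocale P0: prob_space "P 0"
  by (rule prob_space_P)

lemma X_measurable: "0 \<le> s \<Longrightarrow> X s \<in> borel_measurable (P x)"
  using process by (simp add: cadlag_process_def)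

lemma sets_P: "sets (P x) = sets (P 0)" and space_P: "space (P x) = space (P 0)"
proof -
  show "sets (P x) = sets (P 0)" using process unfolding cadlag_process_def by blast
  then show "space (P x) = space (P 0)" by (rule sets_eq_imp_space_eq)
qed

lemma cadlag_path: "\<omega> \<in> space (P 0) \<Longrightarrow> cadlag (\<lambda>t. X t \<omega>)"
  using process by (simp add: cadlag_process_def)

lemma bounded_path: "\<omega> \<in> space (P 0) \<Longrightarrow> 0 \<le> t \<Longrightarrow> bounded (path_values X t \<omega>)"
  using bounded_path_values[of X \<omega> t] cadlag_path by simp

lemma AE_start: "AE \<omega> in P 0. 0 \<in> path_values X t \<omega>"
proof -
  have "AE \<omega> in P 0. X 0 \<omega> = 0"
    using process by (simp add: cadlag_process_def)
  then show ?thesis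
    by eventually_elim (force simp: path_values_def dense_times_def)
qed

text \<open>The supremum of the path up to time \<open>t\<close> in the direction \<open>e\<close>, and the largest displacement up to
  time \<open>t\<close>.\<close>

abbreviation sup_e :: "real ^ 'n \<Rightarrow> real \<Rightarrow> 'w \<Rightarrow> real" where
  "sup_e e t \<omega> \<equiv> sup_dir (path_values X t \<omega>) e"

abbreviation sup_n :: "real \<Rightarrow> 'w \<Rightarrow> real" where
  "sup_n t \<omega> \<equiv> sup_norm (path_values X t \<omega>)"

lemma restrict_path_measurable: "(\<lambda>\<omega>. \<lambda>s\<in>{0..}. X s \<omega>) \<in> P 0 \<rightarrow>\<^sub>M (\<Pi>\<^sub>M s\<in>{0..}. borel)"
  by (intro measurable_restrict) (auto intro: X_measurable)

lemma sup_measurable: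
  assumes t: "0 \<le> t"
  shows "sup_e e t \<in> borel_measurable (P 0)" "sup_n t \<in> borel_measurable (P 0)"
proof -
  have "(\<lambda>\<omega>. path_sup_dir t e (\<lambda>s\<in>{0..}. X s \<omega>)) \<in> borel_measurable (P 0)"
    by (rule measurable_compose[OF restrict_path_measurable path_sup_measurable(1)[OF t]])
  then show "sup_e e t \<in> borel_measurable (P 0)"
    by (rule measurable_cong[THEN iffD1, rotated]) (simp add: path_sup_eq(1)[OF t bounded_path[OF _ t]])
  have "(\<lambda>\<omega>. path_sup_norm t (\<lambda>s\<in>{0..}. X s \<omega>)) \<in> borel_measurable (P 0)"
    by (rule measurable_compose[OF restrict_path_measurable path_sup_measurable(2)[OF t]])
  then show "sup_n t \<in> borel_measurable (P 0)"
    by (rule measurable_cong[THEN iffD1, rotated]) (simp add: path_sup_eq(2)[OF t bounded_path[OF _ t]])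
qed

text \<open>By isotropy the joint law of the supremum in a unit direction and of the largest
  displacement does not depend on the direction.\<close>

lemma sup_law:
  assumes t: "0 \<le> t" and e: "norm e = 1" "norm e' = 1"
  shows "distr (P 0) (borel \<Otimes>\<^sub>M borel) (\<lambda>\<omega>. (sup_e e t \<omega>, sup_n t \<omega>))
    = distr (P 0) (borel \<Otimes>\<^sub>M borel) (\<lambda>\<omega>. (sup_e e' t \<omega>, sup_n t \<omega>))"
proof (rule measure_eqI)
  note [measurable] = sup_measurable[OF t]
  fix B :: "(real \<times> real) set"
  assume "B \<in> sets (distr (P 0) (borel \<Otimes>\<^sub>M borel) (\<lambda>\<omega>. (sup_e e t \<omega>, sup_n t \<omega>)))"
  then have B[measurable]: "B \<in> sets (borel \<Otimes>\<^sub>M borel)" by simp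
  \<comment> \<open>If \<open>f\<close> maps \<open>e'\<close> to \<open>e\<close>, the image path under \<open>f\<close> has in the direction \<open>e\<close> the supremum that the
    original path has in the direction \<open>e'\<close>.\<close>
  obtain f where f: "orthogonal_transformation f" "f e' = e"
    using orthogonal_transformation_exists_1[OF e(2,1)] by blast
  define U where "U = matrix f"
  have Uf: "U *v y = f y" for y
    unfolding U_def using orthogonal_transformation_linear[OF f(1)] by simp
  have U: "orthogonal_matrix U"
    using f(1) by (simp add: U_def orthogonal_transformation_matrix)
  have inner: "e \<bullet> f y = e' \<bullet> y" for y
    using f by (metis orthogonal_transformation_def)
  define Y where "Y t \<omega> = U *v X t \<omega>" for t \<omega>
  have pvY: "path_values Y t \<omega> = f ` path_values X t \<omega>" for \<omega>
    by (auto simp: path_values_def Y_def Uf)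
  have sY: "sup_dir (path_values Y t \<omega>) e = sup_e e' t \<omega>" "sup_norm (path_values Y t \<omega>) = sup_n t \<omega>" for \<omega>
    using orthogonal_transformation_norm[OF f(1)]
    by (simp_all add: sup_dir_def sup_norm_def pvY image_image inner)
  have bY: "bounded (path_values Y t \<omega>)" if "\<omega> \<in> space (P 0)" for \<omega>
    unfolding pvY using bounded_path[OF that t] orthogonal_transformation_norm[OF f(1)]
    by (simp add: bounded_iff)
  define Q where "Q g \<longleftrightarrow> (path_sup_dir t e g, path_sup_norm t g) \<in> B" for g
  have Q: "Measurable.pred (\<Pi>\<^sub>M s\<in>{0..}. borel) Q"
    unfolding Q_def using path_sup_measurable(1)[OF t, of e] path_sup_measurable(2)[OF t] by measurable
  have "measure (P 0) {\<omega> \<in> space (P 0). Q (\<lambda>s\<in>{0..}. X s \<omega>)}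
      = measure (P 0) {\<omega> \<in> space (P 0). Q (\<lambda>s\<in>{0..}. Y s \<omega>)}"
  proof (rule path_law_prob_eq[OF _ X_measurable _ Q])
    show "path_law (P 0) X = path_law (P 0) Y"
      using isotropy U unfolding isotropic_def Y_def by blast
    have "(*v) U \<in> borel_measurable borel"
      by (intro borel_measurable_continuous_onI matrix_vector_mult_linear_continuous_on)
    from measurable_compose[OF X_measurable this]
    show "Y s \<in> borel_measurable (P 0)" if "0 \<le> s" for s
      using that by (simp add: Y_def[abs_def])
  qed
  also have "{\<omega> \<in> space (P 0). Q (\<lambda>s\<in>{0..}. X s \<omega>)} = {\<omega> \<in> space (P 0). (sup_e e t \<omega>, sup_n t \<omega>) \<in> B}"
    using path_sup_eq[OF t bounded_path[OF _ t]] by (auto simp: Q_def)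
  also have "{\<omega> \<in> space (P 0). Q (\<lambda>s\<in>{0..}. Y s \<omega>)} = {\<omega> \<in> space (P 0). (sup_e e' t \<omega>, sup_n t \<omega>) \<in> B}"
    using path_sup_eq[OF t bY] by (auto simp: Q_def sY)
  finally have "emeasure (P 0) {\<omega> \<in> space (P 0). (sup_e e t \<omega>, sup_n t \<omega>) \<in> B}
      = emeasure (P 0) {\<omega> \<in> space (P 0). (sup_e e' t \<omega>, sup_n t \<omega>) \<in> B}"
    by (simp add: P0.emeasure_eq_measure)
  then show "emeasure (distr (P 0) (borel \<Otimes>\<^sub>M borel) (\<lambda>\<omega>. (sup_e e t \<omega>, sup_n t \<omega>))) B
      = emeasure (distr (P 0) (borel \<Otimes>\<^sub>M borel) (\<lambda>\<omega>. (sup_e e' t \<omega>, sup_n t \<omega>))) B"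
    by (subst (1 2) emeasure_distr) (auto simp: vimage_def Int_def conj_commute)
qed simp

lemma sup_prob_eq:
  assumes t: "0 \<le> t" and e: "norm e = 1" "norm e' = 1"
    and B: "Measurable.pred (borel \<Otimes>\<^sub>M borel) (\<lambda>z. B (fst z) (snd z))"
  shows "emeasure (P 0) {\<omega> \<in> space (P 0). B (sup_e e t \<omega>) (sup_n t \<omega>)}
    = emeasure (P 0) {\<omega> \<in> space (P 0). B (sup_e e' t \<omega>) (sup_n t \<omega>)}"
proof -
  note [measurable] = sup_measurable[OF t]
  have "emeasure (P 0) {\<omega> \<in> space (P 0). B (sup_e e t \<omega>) (sup_n t \<omega>)}
    = emeasure (distr (P 0) (borel \<Otimes>\<^sub>M borel) (\<lambda>\<omega>. (sup_e e t \<omega>, sup_n t \<omega>))) {z. B (fst z) (snd z)}" for e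
    using B by (subst emeasure_distr) (auto simp: pred_def space_pair_measure vimage_def Int_def conj_commute)
  then show ?thesis using sup_law[OF t e] by simp
qed

lemma expectation_sup_eq:
  assumes t: "0 \<le> t" and e: "norm e = 1" "norm e' = 1"
  shows "(LINT \<omega>|P 0. min (sup_e e t \<omega>) 1) = (LINT \<omega>|P 0. min (sup_e e' t \<omega>) 1)"
proof -
  note [measurable] = sup_measurable[OF t]
  have "(LINT \<omega>|P 0. min (sup_e e t \<omega>) 1)
    = (LINT z|distr (P 0) (borel \<Otimes>\<^sub>M borel) (\<lambda>\<omega>. (sup_e e t \<omega>, sup_n t \<omega>)). min (fst z) 1)" for e
    by (subst integral_distr) auto
  then show ?thesis using sup_law[OF t e] by simp
qed

lemma mean_truncated_sup_eq:
  assumes t: "0 \<le> t" and e: "norm e = 1"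
  shows "mean_truncated_sup P X k t = (LINT \<omega>|P 0. min (sup_e e t \<omega>) 1)"
proof -
  have "mean_truncated_sup P X k t = (LINT \<omega>|P 0. min (sup_e (axis k 1) t \<omega>) 1)"
    unfolding mean_truncated_sup_def
    by (intro Bochner_Integration.integral_cong) (auto simp: running_sup_eq[where X = X, OF cadlag_path t])
  also have "\<dots> = (LINT \<omega>|P 0. min (sup_e e t \<omega>) 1)"
    using e by (intro expectation_sup_eq[OF t]) simp_all
  finally show ?thesis .
qed

lemma AE_sup_nonneg:
  assumes "0 \<le> t"
  shows "AE \<omega> in P 0. (\<forall>e. 0 \<le> sup_e e t \<omega>) \<and> 0 \<le> sup_n t \<omega>"
  using AE_start[of t] AE_space
proof eventually_elim
  case (elim \<omega>)
  then show ?case using bounded_path[OF elim(2) assms] by (simp add: sup_dir_nonneg sup_norm_nonneg)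
qed

lemma integrable_min_sup:
  assumes t: "0 \<le> t"
  shows "integrable (P 0) (\<lambda>\<omega>. min (sup_e e t \<omega>) 1)" "integrable (P 0) (\<lambda>\<omega>. min (sup_n t \<omega>) 1)"
proof -
  note [measurable] = sup_measurable[OF t]
  show "integrable (P 0) (\<lambda>\<omega>. min (sup_e e t \<omega>) 1)"
  proof (rule P0.integrable_const_bound[where B = 1])
    show "AE \<omega> in P 0. norm (min (sup_e e t \<omega>) 1) \<le> 1"
      using AE_sup_nonneg[OF t] by eventually_elim (auto simp: abs_le_iff min_le_iff_disj intro: order_trans[of _ 0])
  qed measurable
  show "integrable (P 0) (\<lambda>\<omega>. min (sup_n t \<omega>) 1)"
  proof (rule P0.integrable_const_bound[where B = 1])
    show "AE \<omega> in P 0. norm (min (sup_n t \<omega>) 1) \<le> 1"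
      using AE_sup_nonneg[OF t] by eventually_elim (auto simp: abs_le_iff min_le_iff_disj intro: order_trans[of _ 0])
  qed measurable
qed

lemma mean_truncated_sup_nonneg: "0 \<le> t \<Longrightarrow> 0 \<le> mean_truncated_sup P X k t"
  unfolding mean_truncated_sup_eq[of t "axis k 1", OF _ norm_axis_1]
  by (rule integral_nonneg_AE) (use AE_sup_nonneg[of t] in \<open>auto elim!: eventually_mono\<close>)

lemma expectation_min_sup_norm:
  assumes t: "0 \<le> t"
  shows "(LINT \<omega>|P 0. min (sup_n t \<omega>) 1) \<le> 2 * CARD('n) * mean_truncated_sup P X k t"
proof -
  let ?J = "(UNIV :: 'n set) \<times> {1, -1 :: real}" and ?e = "\<lambda>j. snd j *\<^sub>R axis (fst j) (1::real) :: real ^ 'n"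
  have "(LINT \<omega>|P 0. min (sup_n t \<omega>) 1) \<le> (LINT \<omega>|P 0. (\<Sum>j\<in>?J. min (sup_e (?e j) t \<omega>) 1))"
  proof (rule integral_mono_AE)
    show "integrable (P 0) (\<lambda>\<omega>. \<Sum>j\<in>?J. min (sup_e (?e j) t \<omega>) 1)"
      by (intro Bochner_Integration.integrable_sum integrable_min_sup t)
    show "AE \<omega> in P 0. min (sup_n t \<omega>) 1 \<le> (\<Sum>j\<in>?J. min (sup_e (?e j) t \<omega>) 1)"
      using AE_start[of t] AE_space
    proof eventually_elim
      case (elim \<omega>)
      note R = bounded_path[OF elim(2) t] elim(1)
      have "min (sup_n t \<omega>) 1 \<le> min (\<Sum>j\<in>?J. sup_e (?e j) t \<omega>) 1"
        using sup_norm_le_sum[OF R] by (auto simp: case_prod_beta)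
      also have "\<dots> \<le> (\<Sum>j\<in>?J. min (sup_e (?e j) t \<omega>) 1)"
        by (intro min_sum_le sup_dir_nonneg R) simp
      finally show ?case .
    qed
  qed (rule integrable_min_sup[OF t])
  also have "\<dots> = (\<Sum>j\<in>?J. LINT \<omega>|P 0. min (sup_e (?e j) t \<omega>) 1)"
    by (intro Bochner_Integration.integral_sum integrable_min_sup t)
  also have "\<dots> = (\<Sum>j\<in>?J. mean_truncated_sup P X k t)"
    by (intro sum.cong refl mean_truncated_sup_eq[OF t, symmetric]) auto
  also have "\<dots> = 2 * CARD('n) * mean_truncated_sup P X k t"
    by (simp add: card_cartesian_product)
  finally show ?thesis .
qed

lemma prob_sup_norm_gt:
  assumes t: "0 \<le> t" and \<epsilon>: "0 < \<epsilon>"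
  shows "measure (P 0) {\<omega> \<in> space (P 0). \<epsilon> < sup_n t \<omega>}
    \<le> 2 * CARD('n) * measure (P 0) {\<omega> \<in> space (P 0). running_sup X k t \<omega> > \<epsilon> / (2 * CARD('n))}"
proof -
  note [measurable] = sup_measurable[OF t]
  let ?J = "(UNIV :: 'n set) \<times> {1, -1 :: real}" and ?e = "\<lambda>j. snd j *\<^sub>R axis (fst j) (1::real) :: real ^ 'n"
  let ?c = "\<epsilon> / (2 * CARD('n))"
  let ?S = "\<lambda>e. {\<omega> \<in> space (P 0). ?c < sup_e e t \<omega>}"
  have "measure (P 0) {\<omega> \<in> space (P 0). \<epsilon> < sup_n t \<omega>} \<le> measure (P 0) (\<Union>j\<in>?J. ?S (?e j))"
  proof (rule P0.finite_measure_mono_AE)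
    show "AE \<omega> in P 0. \<omega> \<in> {\<omega> \<in> space (P 0). \<epsilon> < sup_n t \<omega>} \<longrightarrow> \<omega> \<in> (\<Union>j\<in>?J. ?S (?e j))"
      using AE_start[of t] AE_space
    proof eventually_elim
      case (elim \<omega>)
      note R = bounded_path[OF elim(2) t] elim(1)
      show ?case
      proof (intro impI, rule ccontr)
        assume gt: "\<omega> \<in> {\<omega> \<in> space (P 0). \<epsilon> < sup_n t \<omega>}" and "\<omega> \<notin> (\<Union>j\<in>?J. ?S (?e j))"
        then have "sup_e (?e j) t \<omega> \<le> ?c" if "j \<in> ?J" for j
          using that elim(2) not_le by blast
        then have "(\<Sum>j\<in>?J. sup_e (?e j) t \<omega>) \<le> real (card ?J) * ?c"
          by (rule sum_bounded_above)
        also have "\<dots> = \<epsilon>" by (simp add: card_cartesian_product)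
        finally show False using sup_norm_le_sum[OF R] gt by (simp add: case_prod_beta)
      qed
    qed
    show "(\<Union>j\<in>?J. ?S (?e j)) \<in> sets (P 0)" by (intro sets.finite_UN) auto
  qed
  also have "\<dots> \<le> (\<Sum>j\<in>?J. measure (P 0) (?S (?e j)))"
    by (intro P0.finite_measure_subadditive_finite) auto
  also have "\<dots> = (\<Sum>j\<in>?J. measure (P 0) (?S (axis k 1)))"
  proof (rule sum.cong[OF refl])
    fix j assume "j \<in> ?J"
    then have "norm (?e j) = 1" by auto
    then have "emeasure (P 0) (?S (?e j)) = emeasure (P 0) (?S (axis k 1))"
      by (intro sup_prob_eq[OF t, where B = "\<lambda>a b. ?c < a"]) auto
    then show "measure (P 0) (?S (?e j)) = measure (P 0) (?S (axis k 1))"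
      by (simp add: measure_def)
  qed
  also have "\<dots> = 2 * CARD('n) * measure (P 0) (?S (axis k 1))"
    by (simp add: card_cartesian_product)
  also have "?S (axis k 1) = {\<omega> \<in> space (P 0). running_sup X k t \<omega> > ?c}"
    using running_sup_eq[where X = X, OF cadlag_path t] by auto
  finally show ?thesis .
qed

section \<open>Heat loss as an average over paths\<close>

lemma path_values_iffs:
  "stays u (path_values X t \<omega>) x \<longleftrightarrow> (\<exists>n. \<forall>q\<in>dense_times t. 1 / real (Suc n) \<le> u (x + X q \<omega>))"
  "(\<forall>y\<in>path_values X t \<omega>. 0 < u (x + y)) \<longleftrightarrow> (\<forall>q\<in>dense_times t. 0 < u (x + X q \<omega>))"
  by (simp_all add: stays_def path_values_def)

lemma pred_inside_measurable:
  assumes u: "C1 u" and t: "0 \<le> t"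
  shows "Measurable.pred (borel \<Otimes>\<^sub>M P 0) (\<lambda>z. stays u (path_values X t (snd z)) (fst z))"
    "Measurable.pred (borel \<Otimes>\<^sub>M P 0) (\<lambda>z. \<forall>y\<in>path_values X t (snd z). 0 < u (fst z + y))"
proof -
  have [measurable]: "u \<in> borel_measurable borel"
    by (intro borel_measurable_continuous_onI C1_continuous u)
  have [measurable]: "X q \<in> borel_measurable (P 0)" if "q \<in> dense_times t" for q
    using dense_times_subset[OF t] that by (intro X_measurable) auto
  show "Measurable.pred (borel \<Otimes>\<^sub>M P 0) (\<lambda>z. stays u (path_values X t (snd z)) (fst z))"
    unfolding path_values_iffs
    by (intro pred_intros_countable pred_countable_ball countable_dense_times) measurable
  show "Measurable.pred (borel \<Otimes>\<^sub>M P 0) (\<lambda>z. \<forall>y\<in>path_values X t (snd z). 0 < u (fst z + y))"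
    unfolding path_values_iffs
    by (intro pred_countable_ball countable_dense_times) measurable
qed

lemma stays_sets:
  assumes u: "C1 u" and t: "0 \<le> t"
  shows "{\<omega> \<in> space (P 0). stays u (path_values X t \<omega>) x} \<in> sets (P 0)"
    "{\<omega> \<in> space (P 0). \<forall>y\<in>path_values X t \<omega>. 0 < u (x + y)} \<in> sets (P 0)"
proof -
  have m: "(\<lambda>\<omega>. (x, \<omega>)) \<in> P 0 \<rightarrow>\<^sub>M borel \<Otimes>\<^sub>M P 0" by simp
  show "{\<omega> \<in> space (P 0). stays u (path_values X t \<omega>) x} \<in> sets (P 0)"
    using measurable_compose[OF m pred_inside_measurable(1)[OF u t]] by (simp add: pred_def)
  show "{\<omega> \<in> space (P 0). \<forall>y\<in>path_values X t \<omega>. 0 < u (x + y)} \<in> sets (P 0)"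
    using measurable_compose[OF m pred_inside_measurable(2)[OF u t]] by (simp add: pred_def)
qed

lemma translated_prob_eq:
  assumes t: "0 \<le> t" and Q: "Measurable.pred (\<Pi>\<^sub>M s\<in>{0..}. borel) Q"
  shows "measure (P x) {\<omega> \<in> space (P x). Q (\<lambda>s\<in>{0..}. X s \<omega>)}
    = measure (P 0) {\<omega> \<in> space (P 0). Q (\<lambda>s\<in>{0..}. X s \<omega> + x)}"
proof (rule path_law_prob_eq[OF _ X_measurable _ Q])
  show "path_law (P x) X = path_law (P 0) (\<lambda>t \<omega>. X t \<omega> + x)"
    using translation by (simp only: translation_invariant_def)
  show "(\<lambda>\<omega>. X s \<omega> + x) \<in> borel_measurable (P 0)" if "0 \<le> s" for s
    using X_measurable[OF that, of 0] by measurable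
qed

text \<open>For almost every starting point the survival probability is the probability of an event on
  countably many times, which translation invariance moves to the measure \<open>P 0\<close>.\<close>

lemma survival_prob_AE:
  assumes u: "C1 u" and bd: "bounded {x. 0 < u x}"
    and g: "\<And>x. x \<in> frontier {x. 0 < u x} \<Longrightarrow> grad u x \<noteq> 0" and t: "0 \<le> t"
  shows "AE x in lborel. measure (completion (P x)) {\<omega> \<in> space (P x). exit_time X {x. 0 < u x} \<omega> > ereal t}
    = measure (P 0) {\<omega> \<in> space (P 0). stays u (path_values X t \<omega>) x}"
proof -
  let ?D = "dense_times t" and ?R = "path_values X t"
  interpret pair_sigma_finite lborel "P 0" ..
  note [measurable] = pred_inside_measurable[OF u t]
  have pred: "Measurable.pred (lborel \<Otimes>\<^sub>M P 0) (\<lambda>z. (\<forall>y\<in>?R (snd z). 0 < u (fst z + y)) \<longrightarrow> stays u (?R (snd z)) (fst z))"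
    using pred_inside_measurable[OF u t] by simp
  have "AE \<omega> in P 0. AE x in lborel. (\<forall>y\<in>?R \<omega>. 0 < u (x + y)) \<longrightarrow> stays u (?R \<omega>) x"
  proof (rule AE_I2)
    fix \<omega> assume \<omega>: "\<omega> \<in> space (P 0)"
    have "{x. (\<forall>y\<in>?R \<omega>. 0 < u (x + y)) \<and> \<not> stays u (?R \<omega>) x} \<in> null_sets lborel"
      by (rule null_set_touching[OF u bd g _ bounded_path[OF \<omega> t]])
        (auto simp: path_values_def dense_times_def intro: countable_rat countable_Int1)
    then show "AE x in lborel. (\<forall>y\<in>?R \<omega>. 0 < u (x + y)) \<longrightarrow> stays u (?R \<omega>) x"
      by (rule AE_I') auto
  qed
  then have "AE x in lborel. AE \<omega> in P 0. (\<forall>y\<in>?R \<omega>. 0 < u (x + y)) \<longrightarrow> stays u (?R \<omega>) x"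
    using pred by (subst AE_commute) (auto simp: pred_def)
  then show ?thesis
  proof eventually_elim
    case (elim x)
    let ?S = "{\<omega> \<in> space (P 0). stays u (?R \<omega>) x}"
    let ?W = "{\<omega> \<in> space (P 0). \<forall>y\<in>?R \<omega>. 0 < u (x + y)}"
    let ?Sx = "{\<omega> \<in> space (P x). stays u (?R \<omega>) 0}"
    let ?Wx = "{\<omega> \<in> space (P x). \<forall>y\<in>?R \<omega>. 0 < u y}"
    let ?E = "{\<omega> \<in> space (P x). exit_time X {x. 0 < u x} \<omega> > ereal t}"
    have SW: "?S \<subseteq> ?W"
    proof
      fix \<omega> assume "\<omega> \<in> ?S"
      then obtain n where n: "\<omega> \<in> space (P 0)" "\<And>y. y \<in> ?R \<omega> \<Longrightarrow> 1 / real (Suc n) \<le> u (x + y)"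
        by (auto simp: stays_def)
      have "0 < 1 / real (Suc n)" by simp
      then show "\<omega> \<in> ?W" using n less_le_trans by blast
    qed
    have "measure (P 0) ?S = measure (P 0) ?W"
    proof (rule P0.finite_measure_eq_AE[OF _ stays_sets(1)[OF u t] stays_sets(2)[OF u t]])
      show "AE \<omega> in P 0. \<omega> \<in> ?S \<longleftrightarrow> \<omega> \<in> ?W"
        using elim by eventually_elim (use SW in blast)
    qed
    have D: "0 \<le> q" if "q \<in> ?D" for q using dense_times_subset[OF t] that by auto
    have [measurable]: "u \<in> borel_measurable borel"
      by (intro borel_measurable_continuous_onI C1_continuous u)
    note [measurable] = path_component_measurable[OF t]
    have QS: "Measurable.pred (\<Pi>\<^sub>M s\<in>{0..}. borel) (\<lambda>f. \<exists>n. \<forall>q\<in>?D. 1 / real (Suc n) \<le> u (f q))"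
      by (intro pred_intros_countable pred_countable_ball countable_dense_times) measurable
    have QW: "Measurable.pred (\<Pi>\<^sub>M s\<in>{0..}. borel) (\<lambda>f. \<forall>q\<in>?D. 0 < u (f q))"
      by (intro pred_countable_ball countable_dense_times) measurable
    have S: "measure (P x) ?Sx = measure (P 0) ?S"
      using translated_prob_eq[OF t QS, of x] D
      by (simp add: stays_def path_values_def add.commute cong: ball_cong)
    have W: "measure (P x) ?Wx = measure (P 0) ?W"
      using translated_prob_eq[OF t QW, of x] D
      by (simp add: path_values_def add.commute cong: ball_cong)
    have "measure (completion (P x)) ?E = measure (P x) ?Sx"
    proof (rule measure_completion_squeeze)
      show "finite_measure (P x)" using prob_space_P[of x] by (simp add: prob_space_def)
      show "?Sx \<in> sets (P x)" "?Wx \<in> sets (P x)"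
        using stays_sets[OF u t, of 0] by (simp_all add: space_P[of x] sets_P[of x])
      show "?Sx \<subseteq> ?E"
        using stays_imp_exit_time[where X = X, OF u cadlag_path t] by (auto simp: space_P[of x])
      show "?E \<subseteq> ?Wx"
        using exit_time_imp_inside[where X = X and \<Omega> = "{x. 0 < u x}" and t = t] dense_times_subset[OF t]
        by (fastforce simp: path_values_def)
      show "measure (P x) ?Sx = measure (P x) ?Wx"
        unfolding S W by fact
    qed
    then show ?case unfolding S .
  qed
qed

text \<open>The probability that the path, started at \<open>x\<close> by translation, does not keep a positive distance
  from the complement up to time \<open>t\<close>. For almost every \<open>x\<close> this is the exit probability.\<close>

definition loss_prob :: "(real ^ 'n \<Rightarrow> real) \<Rightarrow> real \<Rightarrow> real ^ 'n \<Rightarrow> real" where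
  "loss_prob u t x = measure (P 0) {\<omega> \<in> space (P 0). \<not> stays u (path_values X t \<omega>) x}"

lemma loss_prob_eq:
  assumes u: "C1 u" and t: "0 \<le> t"
  shows "measure (P 0) {\<omega> \<in> space (P 0). stays u (path_values X t \<omega>) x} = 1 - loss_prob u t x"
proof -
  have "{\<omega> \<in> space (P 0). \<not> stays u (path_values X t \<omega>) x}
      = space (P 0) - {\<omega> \<in> space (P 0). stays u (path_values X t \<omega>) x}" by auto
  then show ?thesis
    unfolding loss_prob_def using P0.prob_compl[OF stays_sets(1)[OF u t, of x]] by simp
qed

lemma loss_prob_measurable:
  assumes u: "C1 u" and t: "0 \<le> t"
  shows "loss_prob u t \<in> borel_measurable borel"
proof -
  let ?Q = "{z \<in> space (borel \<Otimes>\<^sub>M P 0). \<not> stays u (path_values X t (snd z)) (fst z)}"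
  have "?Q \<in> sets (borel \<Otimes>\<^sub>M P 0)"
    using pred_inside_measurable(1)[OF u t] by (simp add: pred_def[symmetric])
  from P0.measurable_emeasure_Pair[OF this]
  have "(\<lambda>x. enn2real (emeasure (P 0) (Pair x -` ?Q))) \<in> borel_measurable borel" by simp
  also have "(\<lambda>x. enn2real (emeasure (P 0) (Pair x -` ?Q))) = loss_prob u t"
    by (auto simp: loss_prob_def measure_def fun_eq_iff space_pair_measure intro!: arg_cong[where f = "\<lambda>S. enn2real (emeasure (P 0) S)"])
  finally show ?thesis .
qed

lemma heat_loss_eq:
  assumes u: "C1 u" and bd: "bounded {x. 0 < u x}"
    and g: "\<And>x. x \<in> frontier {x. 0 < u x} \<Longrightarrow> grad u x \<noteq> 0" and t: "0 \<le> t"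
  shows "integrable lborel (\<lambda>x. indicator {x. 0 < u x} x * loss_prob u t x)"
    "measure lborel {x. 0 < u x} - spectral_heat_content P X {x. 0 < u x} t
      = (LINT x|lborel. indicator {x. 0 < u x} x * loss_prob u t x)"
proof -
  let ?\<Omega> = "{x. 0 < u x}"
  let ?f = "\<lambda>x. measure (completion (P x)) {\<omega> \<in> space (P x). exit_time X ?\<Omega> \<omega> > ereal t}"
  have m\<Omega>: "?\<Omega> \<in> sets borel" by (intro borel_open open_superlevel u)
  note lm = loss_prob_measurable[OF u t]
  have I\<Omega>: "integrable lborel (indicator ?\<Omega> :: _ \<Rightarrow> real)"
    using m\<Omega> bd by (auto intro: emeasure_bounded_finite)
  show il: "integrable lborel (\<lambda>x. indicator ?\<Omega> x * loss_prob u t x)"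
  proof (rule integrable_bounded_support[where B = 1 and S = ?\<Omega>])
    show "(\<lambda>x. indicator ?\<Omega> x * loss_prob u t x) \<in> borel_measurable borel"
      using m\<Omega> lm by measurable
  qed (use m\<Omega> bd in \<open>auto simp: indicator_def loss_prob_def\<close>)
  have ae: "AE x in lebesgue. indicator ?\<Omega> x * (1 - loss_prob u t x) = indicator ?\<Omega> x * ?f x"
    using survival_prob_AE[OF u bd g t] unfolding loss_prob_eq[OF u t]
    by (intro AE_completion) (auto elim!: eventually_mono)
  have m1: "(\<lambda>x. indicator ?\<Omega> x * (1 - loss_prob u t x)) \<in> borel_measurable lborel"
    using m\<Omega> lm by measurable
  then have m2: "(\<lambda>x. indicator ?\<Omega> x * (1 - loss_prob u t x)) \<in> borel_measurable lebesgue"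
    by (rule measurable_completion)
  have "spectral_heat_content P X ?\<Omega> t = (LINT x|lebesgue. indicator ?\<Omega> x * ?f x)"
    by (simp add: spectral_heat_content_def set_lebesgue_integral_def)
  also have "\<dots> = (LINT x|lebesgue. indicator ?\<Omega> x * (1 - loss_prob u t x))"
    using ae by (intro integral_cong_AE borel_measurable_AE[OF m2 ae] m2) (auto elim!: eventually_mono)
  also have "\<dots> = (LINT x|lborel. indicator ?\<Omega> x * (1 - loss_prob u t x))"
    by (rule integral_completion[OF m1])
  also have "\<dots> = (LINT x|lborel. indicator ?\<Omega> x - indicator ?\<Omega> x * loss_prob u t x)"
    by (simp add: right_diff_distrib)
  also have "\<dots> = measure lborel ?\<Omega> - (LINT x|lborel. indicator ?\<Omega> x * loss_prob u t x)"
    using Bochner_Integration.integral_diff[OF I\<Omega> il] by simp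
  finally show "measure lborel ?\<Omega> - spectral_heat_content P X ?\<Omega> t
      = (LINT x|lborel. indicator ?\<Omega> x * loss_prob u t x)" by simp
qed

text \<open>The heat loss as a nonnegative integral, the form to which Tonelli's theorem applies.\<close>

lemma heat_loss_nn:
  assumes u: "C1 u" and bd: "bounded {x. 0 < u x}"
    and g: "\<And>x. x \<in> frontier {x. 0 < u x} \<Longrightarrow> grad u x \<noteq> 0" and t: "0 \<le> t"
  shows "ennreal (measure lborel {x. 0 < u x} - spectral_heat_content P X {x. 0 < u x} t)
      = (\<integral>\<^sup>+x. indicator {x. 0 < u x} x * emeasure (P 0) {\<omega> \<in> space (P 0). \<not> stays u (path_values X t \<omega>) x} \<partial>lborel)"
    "0 \<le> measure lborel {x. 0 < u x} - spectral_heat_content P X {x. 0 < u x} t"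
proof -
  note H = heat_loss_eq(1)[OF u bd g t] heat_loss_eq(2)[OF u bd g t]
  have "0 \<le> (LINT x|lborel. indicator {x. 0 < u x} x * loss_prob u t x)"
    by (rule Bochner_Integration.integral_nonneg) (simp add: loss_prob_def)
  then show "0 \<le> measure lborel {x. 0 < u x} - spectral_heat_content P X {x. 0 < u x} t"
    by (simp only: H(2))
  show "ennreal (measure lborel {x. 0 < u x} - spectral_heat_content P X {x. 0 < u x} t)
      = (\<integral>\<^sup>+x. indicator {x. 0 < u x} x * emeasure (P 0) {\<omega> \<in> space (P 0). \<not> stays u (path_values X t \<omega>) x} \<partial>lborel)"
  proof -
    have "(\<integral>\<^sup>+x. indicator {x. 0 < u x} x * emeasure (P 0) {\<omega> \<in> space (P 0). \<not> stays u (path_values X t \<omega>) x} \<partial>lborel)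
        = (\<integral>\<^sup>+x. ennreal (indicator {x. 0 < u x} x * loss_prob u t x) \<partial>lborel)"
      by (intro nn_integral_cong) (auto simp: loss_prob_def P0.emeasure_eq_measure indicator_def)
    also have "\<dots> = ennreal (LINT x|lborel. indicator {x. 0 < u x} x * loss_prob u t x)"
    proof (rule nn_integral_eq_integral[OF H(1)])
      show "AE x in lborel. 0 \<le> indicator {x. 0 < u x} x * loss_prob u t x"
        by (simp add: loss_prob_def)
    qed
    finally show ?thesis by (simp only: H(2))
  qed
qed

text \<open>Integrating over the starting points first gives the volume of a layer of thickness \<open>Y\<close>.\<close>

lemma layer_fubini:
  assumes u: "C1 u" and Y: "Y \<in> borel_measurable (P 0)" and A: "A \<in> sets (P 0)"
  shows "(\<lambda>x. emeasure (P 0) {\<omega> \<in> A. 0 < u x \<and> u x \<le> Y \<omega>}) \<in> borel_measurable lborel"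
    "(\<integral>\<^sup>+x. emeasure (P 0) {\<omega> \<in> A. 0 < u x \<and> u x \<le> Y \<omega>} \<partial>lborel)
    = (\<integral>\<^sup>+\<omega>. indicator A \<omega> * emeasure lborel {x. 0 < u x \<and> u x \<le> Y \<omega>} \<partial>P 0)"
proof -
  interpret pair_sigma_finite lborel "P 0" ..
  have [measurable]: "u \<in> borel_measurable borel"
    by (intro borel_measurable_continuous_onI C1_continuous u)
  note [measurable] = Y A
  let ?Q = "{z \<in> space (lborel \<Otimes>\<^sub>M P 0). snd z \<in> A \<and> 0 < u (fst z) \<and> u (fst z) \<le> Y (snd z)}"
  have Q: "?Q \<in> sets (lborel \<Otimes>\<^sub>M P 0)" by measurable
  have sub: "A \<subseteq> space (P 0)" using A by (rule sets.sets_into_space)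
  have 1: "Pair x -` ?Q = {\<omega> \<in> A. 0 < u x \<and> u x \<le> Y \<omega>}" for x
    using sub by (auto simp: space_pair_measure)
  have "(\<lambda>x. (x, \<omega>)) -` ?Q = (if \<omega> \<in> A then {x. 0 < u x \<and> u x \<le> Y \<omega>} else {})" for \<omega>
    using sub by (auto simp: space_pair_measure)
  then have 2: "emeasure lborel ((\<lambda>x. (x, \<omega>)) -` ?Q) = indicator A \<omega> * emeasure lborel {x. 0 < u x \<and> u x \<le> Y \<omega>}" for \<omega>
    by simp
  show "(\<lambda>x. emeasure (P 0) {\<omega> \<in> A. 0 < u x \<and> u x \<le> Y \<omega>}) \<in> borel_measurable lborel"
    using P0.measurable_emeasure_Pair[OF Q] unfolding 1 by simp
  show "(\<integral>\<^sup>+x. emeasure (P 0) {\<omega> \<in> A. 0 < u x \<and> u x \<le> Y \<omega>} \<partial>lborel)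
    = (\<integral>\<^sup>+\<omega>. indicator A \<omega> * emeasure lborel {x. 0 < u x \<and> u x \<le> Y \<omega>} \<partial>P 0)"
    using P0.emeasure_pair_measure_alt[OF Q] emeasure_pair_measure_alt2[OF Q] unfolding 1 2 by simp
qed

section \<open>Two-sided bounds for the heat loss\<close>

lemma path_subset_cball:
  assumes "\<omega> \<in> space (P 0)" "0 \<le> t" "sup_n t \<omega> \<le> \<epsilon>"
  shows "path_values X t \<omega> \<subseteq> cball 0 \<epsilon>"
proof
  fix y assume "y \<in> path_values X t \<omega>"
  then have "norm y \<le> sup_n t \<omega>" by (rule sup_norm_upper[OF bounded_path[OF assms(1,2)]])
  then show "y \<in> cball 0 \<epsilon>" using assms(3) by simp
qed

lemma sup_e_le_sup_n:
  assumes "\<omega> \<in> space (P 0)" "0 \<le> t" "norm e = 1"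
  shows "sup_e e t \<omega> \<le> sup_n t \<omega>"
proof (rule sup_dir_le)
  show "path_values X t \<omega> \<noteq> {}" by (simp add: path_values_def dense_times_def)
  fix y assume "y \<in> path_values X t \<omega>"
  then have "norm y \<le> sup_n t \<omega>" by (rule sup_norm_upper[OF bounded_path[OF assms(1,2)]])
  then show "e \<bullet> y \<le> sup_n t \<omega>" using norm_cauchy_schwarz[of e y] assms(3) by simp
qed

lemma layer_emeasure:
  assumes "C1 u" "bounded {x. 0 < u x}"
  shows "emeasure lborel {x. 0 < u x \<and> u x \<le> m} = ennreal (layer_volume u m)"
  unfolding layer_volume_def using layer_integrable(2)[OF assms, of m]
  by (intro emeasure_eq_ennreal_measure) (auto simp: less_top[symmetric])

text \<open>In both bounds the direction \<open>descent_dir u x\<close>, which depends on \<open>x\<close>, is replaced by a fixed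
  direction through isotropy, and Tonelli's theorem turns the integral over \<open>x\<close> into the volume of
  a layer of random thickness.\<close>

lemma heat_loss_upper:
  fixes k :: 'n and \<delta> \<epsilon> r m0 a :: real
  assumes u: "C1 u" and bd: "bounded {x. 0 < u x}"
    and gf: "\<And>x. x \<in> frontier {x. 0 < u x} \<Longrightarrow> grad u x \<noteq> 0" and t: "0 \<le> t"
    and \<delta>: "0 < \<delta>" "\<delta> < 1"
    and g: "\<And>x. 0 < u x \<Longrightarrow> u x \<le> r \<Longrightarrow> grad u x \<noteq> 0"
    and a: "0 \<le> a" "\<And>m. 0 < m \<Longrightarrow> m \<le> m0 \<Longrightarrow> layer_volume u m \<le> a * m"
    and \<epsilon>: "0 < \<epsilon>" "\<epsilon> \<le> 1" "(1 + 2 * \<delta>) * \<epsilon> \<le> m0"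
    and ex: "\<And>R x. R \<subseteq> cball 0 \<epsilon> \<Longrightarrow> 0 \<in> R \<Longrightarrow> 0 < u x \<Longrightarrow> \<not> stays u R x \<Longrightarrow>
      u x \<le> r \<and> u x \<le> (1 + \<delta>) * sup_dir R (descent_dir u x) + \<delta> * sup_norm R"
  shows "measure lborel {x. 0 < u x} - spectral_heat_content P X {x. 0 < u x} t
    \<le> measure lborel {x. 0 < u x} * measure (P 0) {\<omega> \<in> space (P 0). \<epsilon> < sup_n t \<omega>}
      + a * ((1 + \<delta>) + 2 * CARD('n) * \<delta>) * mean_truncated_sup P X k t"
proof -
  let ?\<Omega> = "{x. 0 < u x}" and ?e = "axis k 1 :: real ^ 'n" and ?\<mu> = "mean_truncated_sup P X k t"
  note [measurable] = sup_measurable[OF t]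
  define A where "A = {\<omega> \<in> space (P 0). sup_n t \<omega> \<le> \<epsilon>}"
  define Z where "Z = {\<omega> \<in> space (P 0). \<epsilon> < sup_n t \<omega>}"
  define Y where "Y \<omega> = (1 + \<delta>) * sup_e ?e t \<omega> + \<delta> * sup_n t \<omega>" for \<omega>
  define G where "G \<omega> = a * ((1 + \<delta>) * min (sup_e ?e t \<omega>) 1 + \<delta> * min (sup_n t \<omega>) 1)" for \<omega>
  have A[measurable]: "A \<in> sets (P 0)" and Z[measurable]: "Z \<in> sets (P 0)"
    unfolding A_def Z_def by measurable
  have Y[measurable]: "Y \<in> borel_measurable (P 0)" unfolding Y_def[abs_def] by measurable
  have m\<Omega>[measurable]: "?\<Omega> \<in> sets borel" by (intro borel_open open_superlevel u)
  note F = layer_fubini[OF u Y A]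
  have loss: "ennreal (measure lborel ?\<Omega> - spectral_heat_content P X ?\<Omega> t)
      = (\<integral>\<^sup>+x. indicator ?\<Omega> x * emeasure (P 0) {\<omega> \<in> space (P 0). \<not> stays u (path_values X t \<omega>) x} \<partial>lborel)"
    by (rule heat_loss_nn(1)[OF u bd _ t]) (rule gf)
  have loss0: "0 \<le> measure lborel ?\<Omega> - spectral_heat_content P X ?\<Omega> t"
    by (rule heat_loss_nn(2)[OF u bd _ t]) (rule gf)
  have pt: "emeasure (P 0) {\<omega> \<in> space (P 0). \<not> stays u (path_values X t \<omega>) x}
      \<le> emeasure (P 0) Z + emeasure (P 0) {\<omega> \<in> A. 0 < u x \<and> u x \<le> Y \<omega>}" if x: "0 < u x" for x
  proof (cases "u x \<le> r")
    case True
    let ?d = "descent_dir u x"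
    let ?B = "\<lambda>v w :: real. w \<le> \<epsilon> \<and> u x \<le> (1 + \<delta>) * v + \<delta> * w"
    let ?W = "{\<omega> \<in> space (P 0). ?B (sup_e ?d t \<omega>) (sup_n t \<omega>)}"
    have W: "?W \<in> sets (P 0)" by measurable
    have "emeasure (P 0) {\<omega> \<in> space (P 0). \<not> stays u (path_values X t \<omega>) x} \<le> emeasure (P 0) (Z \<union> ?W)"
    proof (rule emeasure_mono_AE)
      show "AE \<omega> in P 0. \<omega> \<in> {\<omega> \<in> space (P 0). \<not> stays u (path_values X t \<omega>) x} \<longrightarrow> \<omega> \<in> Z \<union> ?W"
        using AE_start[of t] AE_space
      proof eventually_elim
        case (elim \<omega>)
        show ?case
        proof (intro impI)
          assume "\<omega> \<in> {\<omega> \<in> space (P 0). \<not> stays u (path_values X t \<omega>) x}"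
          then have ns: "\<not> stays u (path_values X t \<omega>) x" by simp
          show "\<omega> \<in> Z \<union> ?W"
          proof (cases "sup_n t \<omega> \<le> \<epsilon>")
            case le: True
            have "?B (sup_e ?d t \<omega>) (sup_n t \<omega>)"
              using ex[OF path_subset_cball[OF elim(2) t le] elim(1) x ns] le by blast
            then show ?thesis using elim(2) by blast
          qed (use elim(2) in \<open>simp add: Z_def\<close>)
        qed
      qed
      show "Z \<union> ?W \<in> sets (P 0)" using W Z by (rule sets.Un[rotated])
    qed
    also have "\<dots> \<le> emeasure (P 0) Z + emeasure (P 0) ?W"
      by (rule emeasure_subadditive[OF Z W])
    also have "emeasure (P 0) ?W = emeasure (P 0) {\<omega> \<in> space (P 0). ?B (sup_e ?e t \<omega>) (sup_n t \<omega>)}"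
      by (rule sup_prob_eq[OF t norm_descent_dir[OF g[OF x True]] norm_axis_1]) measurable
    also have "{\<omega> \<in> space (P 0). ?B (sup_e ?e t \<omega>) (sup_n t \<omega>)} = {\<omega> \<in> A. 0 < u x \<and> u x \<le> Y \<omega>}"
      using x by (auto simp: A_def Y_def)
    finally show ?thesis .
  next
    case False
    have "emeasure (P 0) {\<omega> \<in> space (P 0). \<not> stays u (path_values X t \<omega>) x} \<le> emeasure (P 0) Z"
    proof (rule emeasure_mono_AE)
      show "AE \<omega> in P 0. \<omega> \<in> {\<omega> \<in> space (P 0). \<not> stays u (path_values X t \<omega>) x} \<longrightarrow> \<omega> \<in> Z"
        using AE_start[of t] AE_space
      proof eventually_elim
        case (elim \<omega>)
        show ?case
        proof (intro impI)
          assume "\<omega> \<in> {\<omega> \<in> space (P 0). \<not> stays u (path_values X t \<omega>) x}"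
          then have ns: "\<not> stays u (path_values X t \<omega>) x" by simp
          have "\<not> sup_n t \<omega> \<le> \<epsilon>"
            using ex[OF path_subset_cball[OF elim(2) t] elim(1) x ns] False by blast
          then show "\<omega> \<in> Z" using elim(2) by (simp add: Z_def)
        qed
      qed
    qed (rule Z)
    also have "\<dots> \<le> emeasure (P 0) Z + emeasure (P 0) {\<omega> \<in> A. 0 < u x \<and> u x \<le> Y \<omega>}" by simp
    finally show ?thesis .
  qed
  have GI: "integrable (P 0) G"
    unfolding G_def[abs_def] by (intro integrable_mult_right Bochner_Integration.integrable_add integrable_min_sup t)
  have Gn: "AE \<omega> in P 0. 0 \<le> G \<omega>"
    using AE_sup_nonneg[OF t] by eventually_elim (use a \<delta> in \<open>auto simp: G_def\<close>)
  have AG: "AE \<omega> in P 0. indicator A \<omega> * emeasure lborel {x. 0 < u x \<and> u x \<le> Y \<omega>} \<le> ennreal (G \<omega>)"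
    using AE_sup_nonneg[OF t] AE_space
  proof eventually_elim
    case (elim \<omega>)
    show ?case
    proof (cases "\<omega> \<in> A")
      case True
      have le: "sup_n t \<omega> \<le> \<epsilon>" "sup_e ?e t \<omega> \<le> \<epsilon>"
        using True sup_e_le_sup_n[OF elim(2) t norm_axis_1, of k] by (auto simp: A_def)
      then have GY: "G \<omega> = a * Y \<omega>" using \<epsilon>(2) by (simp add: G_def Y_def min_absorb1)
      have "(1 + \<delta>) * sup_e ?e t \<omega> \<le> (1 + \<delta>) * \<epsilon>" "\<delta> * sup_n t \<omega> \<le> \<delta> * \<epsilon>"
        using le \<delta> by (auto intro!: mult_left_mono)
      then have "Y \<omega> \<le> m0" using \<epsilon>(3) by (simp add: Y_def algebra_simps)
      moreover have "0 \<le> Y \<omega>" using elim(1) \<delta> by (simp add: Y_def)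
      ultimately have "layer_volume u (Y \<omega>) \<le> a * Y \<omega>"
      proof (cases "Y \<omega> = 0")
        case True
        have "{x. 0 < u x \<and> u x \<le> 0} = {}" by auto
        then have "layer_volume u 0 = 0" unfolding layer_volume_def by (simp only: measure_empty)
        then show ?thesis unfolding True by simp
      next
        case False
        with \<open>0 \<le> Y \<omega>\<close> \<open>Y \<omega> \<le> m0\<close> show ?thesis by (intro a(2)) simp_all
      qed
      then show ?thesis using True by (simp add: layer_emeasure[OF u bd] GY ennreal_leI)
    qed simp
  qed
  have "ennreal (measure lborel ?\<Omega> - spectral_heat_content P X ?\<Omega> t)
      \<le> (\<integral>\<^sup>+x. emeasure (P 0) Z * indicator ?\<Omega> x + emeasure (P 0) {\<omega> \<in> A. 0 < u x \<and> u x \<le> Y \<omega>} \<partial>lborel)"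
    unfolding loss
    by (intro nn_integral_mono) (use pt in \<open>auto simp: indicator_def\<close>)
  also have "\<dots> = emeasure (P 0) Z * emeasure lborel ?\<Omega>
      + (\<integral>\<^sup>+x. emeasure (P 0) {\<omega> \<in> A. 0 < u x \<and> u x \<le> Y \<omega>} \<partial>lborel)"
    by (subst nn_integral_add) (use F(1) in \<open>auto simp: nn_integral_cmult_indicator\<close>)
  also have "\<dots> \<le> emeasure (P 0) Z * emeasure lborel ?\<Omega> + (\<integral>\<^sup>+\<omega>. ennreal (G \<omega>) \<partial>P 0)"
    unfolding F(2) by (intro add_left_mono nn_integral_mono_AE AG)
  also have "(\<integral>\<^sup>+\<omega>. ennreal (G \<omega>) \<partial>P 0) = ennreal (LINT \<omega>|P 0. G \<omega>)"
    by (rule nn_integral_eq_integral[OF GI Gn])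
  also have "emeasure lborel ?\<Omega> = ennreal (measure lborel ?\<Omega>)"
    by (intro emeasure_eq_ennreal_measure less_imp_neq) (use emeasure_bounded_finite[OF bd] in simp)
  also have "emeasure (P 0) Z * ennreal (measure lborel ?\<Omega>) + ennreal (LINT \<omega>|P 0. G \<omega>)
      = ennreal (measure (P 0) Z * measure lborel ?\<Omega> + (LINT \<omega>|P 0. G \<omega>))"
    using integral_nonneg_AE[OF Gn] by (simp add: P0.emeasure_eq_measure ennreal_mult ennreal_plus)
  finally have "measure lborel ?\<Omega> - spectral_heat_content P X ?\<Omega> t
      \<le> measure (P 0) Z * measure lborel ?\<Omega> + (LINT \<omega>|P 0. G \<omega>)"
    using integral_nonneg_AE[OF Gn] by (subst (asm) ennreal_le_iff) auto
  also have "(LINT \<omega>|P 0. G \<omega>) = a * ((1 + \<delta>) * ?\<mu> + \<delta> * (LINT \<omega>|P 0. min (sup_n t \<omega>) 1))"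
    unfolding G_def mean_truncated_sup_eq[OF t norm_axis_1[of k]]
    using integrable_min_sup[OF t] by simp
  also have "\<dots> \<le> a * ((1 + \<delta>) * ?\<mu> + \<delta> * (2 * CARD('n) * ?\<mu>))"
    using a(1) \<delta> expectation_min_sup_norm[OF t, of k]
    by (intro mult_left_mono add_left_mono) auto
  also have "\<dots> = a * ((1 + \<delta>) + 2 * CARD('n) * \<delta>) * ?\<mu>" by (simp add: algebra_simps)
  finally show ?thesis by (simp add: Z_def mult.commute)
qed

lemma heat_loss_lower:
  fixes k :: 'n and \<delta> \<epsilon> r m0 b :: real
  assumes u: "C1 u" and bd: "bounded {x. 0 < u x}"
    and gf: "\<And>x. x \<in> frontier {x. 0 < u x} \<Longrightarrow> grad u x \<noteq> 0" and t: "0 \<le> t"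
    and \<delta>: "0 < \<delta>" "\<delta> < 1"
    and g: "\<And>x. 0 < u x \<Longrightarrow> u x \<le> r \<Longrightarrow> grad u x \<noteq> 0"
    and b: "0 \<le> b" "\<And>m. 0 < m \<Longrightarrow> m \<le> m0 \<Longrightarrow> b * m \<le> layer_volume u m"
    and \<epsilon>: "0 < \<epsilon>" "\<epsilon> \<le> 1" "\<epsilon> \<le> m0" "\<epsilon> \<le> r"
    and ex: "\<And>R x. R \<subseteq> cball 0 \<epsilon> \<Longrightarrow> 0 \<in> R \<Longrightarrow> 0 < u x \<Longrightarrow> u x \<le> r \<Longrightarrow>
      u x \<le> (1 - \<delta>) * sup_dir R (descent_dir u x) - \<delta> * sup_norm R \<Longrightarrow> \<not> stays u R x"
  shows "b * ((1 - \<delta>) * (mean_truncated_sup P X k t - measure (P 0) {\<omega> \<in> space (P 0). \<epsilon> < sup_n t \<omega>})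
      - 2 * CARD('n) * \<delta> * mean_truncated_sup P X k t)
    \<le> measure lborel {x. 0 < u x} - spectral_heat_content P X {x. 0 < u x} t"
proof -
  let ?\<Omega> = "{x. 0 < u x}" and ?e = "axis k 1 :: real ^ 'n" and ?\<mu> = "mean_truncated_sup P X k t"
  note [measurable] = sup_measurable[OF t]
  define A where "A = {\<omega> \<in> space (P 0). sup_n t \<omega> \<le> \<epsilon>}"
  define Z where "Z = {\<omega> \<in> space (P 0). \<epsilon> < sup_n t \<omega>}"
  define Y where "Y \<omega> = (1 - \<delta>) * sup_e ?e t \<omega> - \<delta> * sup_n t \<omega>" for \<omega>
  define G where "G \<omega> = b * ((1 - \<delta>) * (min (sup_e ?e t \<omega>) 1 - indicator Z \<omega>) - \<delta> * min (sup_n t \<omega>) 1)" for \<omega>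
  have A[measurable]: "A \<in> sets (P 0)" and Z[measurable]: "Z \<in> sets (P 0)"
    unfolding A_def Z_def by measurable
  have Y[measurable]: "Y \<in> borel_measurable (P 0)" unfolding Y_def[abs_def] by measurable
  note F = layer_fubini[OF u Y A]
  have loss: "ennreal (measure lborel ?\<Omega> - spectral_heat_content P X ?\<Omega> t)
      = (\<integral>\<^sup>+x. indicator ?\<Omega> x * emeasure (P 0) {\<omega> \<in> space (P 0). \<not> stays u (path_values X t \<omega>) x} \<partial>lborel)"
    by (rule heat_loss_nn(1)[OF u bd _ t]) (rule gf)
  have loss0: "0 \<le> measure lborel ?\<Omega> - spectral_heat_content P X ?\<Omega> t"
    by (rule heat_loss_nn(2)[OF u bd _ t]) (rule gf)
  have Yle: "AE \<omega> in P 0. \<omega> \<in> A \<longrightarrow> Y \<omega> \<le> \<epsilon>"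
    using AE_sup_nonneg[OF t] AE_space
  proof eventually_elim
    case (elim \<omega>)
    have "(1 - \<delta>) * sup_e ?e t \<omega> \<le> 1 * sup_e ?e t \<omega>" using elim \<delta> by (intro mult_right_mono) auto
    moreover have "0 \<le> \<delta> * sup_n t \<omega>" using elim \<delta> by simp
    ultimately show ?case
      using sup_e_le_sup_n[OF elim(2) t norm_axis_1, of k] by (auto simp: A_def Y_def)
  qed
  have pt: "emeasure (P 0) {\<omega> \<in> A. 0 < u x \<and> u x \<le> Y \<omega>}
      \<le> emeasure (P 0) {\<omega> \<in> space (P 0). \<not> stays u (path_values X t \<omega>) x}" if x: "0 < u x" for x
  proof (cases "u x \<le> r")
    case True
    let ?d = "descent_dir u x"
    let ?B = "\<lambda>v w :: real. w \<le> \<epsilon> \<and> u x \<le> (1 - \<delta>) * v - \<delta> * w"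
    have AB: "{\<omega> \<in> A. 0 < u x \<and> u x \<le> Y \<omega>} = {\<omega> \<in> space (P 0). ?B (sup_e ?e t \<omega>) (sup_n t \<omega>)}"
      using x by (auto simp: A_def Y_def)
    have "emeasure (P 0) {\<omega> \<in> A. 0 < u x \<and> u x \<le> Y \<omega>} = emeasure (P 0) {\<omega> \<in> space (P 0). ?B (sup_e ?d t \<omega>) (sup_n t \<omega>)}"
      unfolding AB by (rule sup_prob_eq[OF t norm_axis_1 norm_descent_dir[OF g[OF x True]]]) measurable
    also have "\<dots> \<le> emeasure (P 0) {\<omega> \<in> space (P 0). \<not> stays u (path_values X t \<omega>) x}"
    proof (rule emeasure_mono_AE)
      show "AE \<omega> in P 0. \<omega> \<in> {\<omega> \<in> space (P 0). ?B (sup_e ?d t \<omega>) (sup_n t \<omega>)}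
          \<longrightarrow> \<omega> \<in> {\<omega> \<in> space (P 0). \<not> stays u (path_values X t \<omega>) x}"
        using AE_start[of t] AE_space
      proof eventually_elim
        case (elim \<omega>)
        show ?case
        proof (intro impI)
          assume "\<omega> \<in> {\<omega> \<in> space (P 0). ?B (sup_e ?d t \<omega>) (sup_n t \<omega>)}"
          then have "sup_n t \<omega> \<le> \<epsilon>" and le: "u x \<le> (1 - \<delta>) * sup_e ?d t \<omega> - \<delta> * sup_n t \<omega>"
            by simp_all
          then have "\<not> stays u (path_values X t \<omega>) x"
            using ex[OF path_subset_cball[OF elim(2) t] elim(1) x True] by blast
          then show "\<omega> \<in> {\<omega> \<in> space (P 0). \<not> stays u (path_values X t \<omega>) x}"
            using elim(2) by simp
        qed
      qed
      have "{\<omega> \<in> space (P 0). \<not> stays u (path_values X t \<omega>) x}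
        = space (P 0) - {\<omega> \<in> space (P 0). stays u (path_values X t \<omega>) x}" by auto
      then show "{\<omega> \<in> space (P 0). \<not> stays u (path_values X t \<omega>) x} \<in> sets (P 0)"
        using stays_sets(1)[OF u t, of x] by simp
    qed
    finally show ?thesis .
  next
    case False
    have "emeasure (P 0) {\<omega> \<in> A. 0 < u x \<and> u x \<le> Y \<omega>} \<le> emeasure (P 0) {}"
    proof (rule emeasure_mono_AE)
      show "AE \<omega> in P 0. \<omega> \<in> {\<omega> \<in> A. 0 < u x \<and> u x \<le> Y \<omega>} \<longrightarrow> \<omega> \<in> {}"
        using Yle by eventually_elim (use False \<epsilon>(4) in auto)
    qed simp
    then show ?thesis by simp
  qed
  have ZI: "integrable (P 0) (indicator Z :: _ \<Rightarrow> real)"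
    using Z by (simp add: P0.emeasure_eq_measure)
  have GI: "integrable (P 0) G"
    unfolding G_def[abs_def]
    by (intro integrable_mult_right Bochner_Integration.integrable_diff integrable_min_sup t ZI)
  have AG: "AE \<omega> in P 0. ennreal (G \<omega>) \<le> indicator A \<omega> * emeasure lborel {x. 0 < u x \<and> u x \<le> Y \<omega>}"
    using AE_sup_nonneg[OF t] AE_space Yle
  proof eventually_elim
    case (elim \<omega>)
    show ?case
    proof (cases "\<omega> \<in> A")
      case True
      then have le: "sup_n t \<omega> \<le> \<epsilon>" "sup_e ?e t \<omega> \<le> \<epsilon>" "\<omega> \<notin> Z"
        using sup_e_le_sup_n[OF elim(2) t norm_axis_1, of k] by (auto simp: A_def Z_def)
      then have GY: "G \<omega> = b * Y \<omega>" using \<epsilon>(2) by (simp add: G_def Y_def min_absorb1)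
      show ?thesis
      proof (cases "0 < Y \<omega>")
        case pos: True
        have "Y \<omega> \<le> m0" using elim(3) True \<epsilon>(3) by simp
        then show ?thesis
          using b(2)[OF pos] True by (simp add: layer_emeasure[OF u bd] GY ennreal_leI)
      next
        case False
        then have "G \<omega> \<le> 0" using b(1) by (simp add: GY mult_nonneg_nonpos)
        then show ?thesis by (simp add: ennreal_neg)
      qed
    next
      case False
      then have Zo: "\<omega> \<in> Z" using elim(2) by (auto simp: A_def Z_def)
      have "(1 - \<delta>) * (min (sup_e ?e t \<omega>) 1 - 1) \<le> 0"
        using \<delta> by (intro mult_nonneg_nonpos) auto
      moreover have "0 \<le> \<delta> * min (sup_n t \<omega>) 1" using elim(1) \<delta> by simp
      ultimately have "G \<omega> \<le> 0"
        unfolding G_def using Zo b(1) by (intro mult_nonneg_nonpos) auto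
      then show ?thesis by (simp add: ennreal_neg)
    qed
  qed
  have "ennreal (LINT \<omega>|P 0. G \<omega>) \<le> ennreal (LINT \<omega>|P 0. max 0 (G \<omega>))"
    by (intro ennreal_leI integral_mono) (use GI in auto)
  also have "\<dots> = (\<integral>\<^sup>+\<omega>. ennreal (max 0 (G \<omega>)) \<partial>P 0)"
    by (rule nn_integral_eq_integral[symmetric]) (use GI in auto)
  also have "\<dots> = (\<integral>\<^sup>+\<omega>. ennreal (G \<omega>) \<partial>P 0)"
    by (intro nn_integral_cong) (auto simp: max_def ennreal_neg)
  also have "\<dots> \<le> (\<integral>\<^sup>+\<omega>. indicator A \<omega> * emeasure lborel {x. 0 < u x \<and> u x \<le> Y \<omega>} \<partial>P 0)"
    by (intro nn_integral_mono_AE AG)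
  also have "\<dots> = (\<integral>\<^sup>+x. emeasure (P 0) {\<omega> \<in> A. 0 < u x \<and> u x \<le> Y \<omega>} \<partial>lborel)"
    by (rule F(2)[symmetric])
  also have "\<dots> \<le> ennreal (measure lborel ?\<Omega> - spectral_heat_content P X ?\<Omega> t)"
    unfolding loss
    by (intro nn_integral_mono) (use pt in \<open>auto simp: indicator_def\<close>)
  finally have fin: "(LINT \<omega>|P 0. G \<omega>) \<le> measure lborel ?\<Omega> - spectral_heat_content P X ?\<Omega> t"
    using loss0 by (subst (asm) ennreal_le_iff) auto
  have "(LINT \<omega>|P 0. G \<omega>)
      = b * ((1 - \<delta>) * (?\<mu> - measure (P 0) Z) - \<delta> * (LINT \<omega>|P 0. min (sup_n t \<omega>) 1))"
    unfolding G_def mean_truncated_sup_eq[OF t norm_axis_1[of k]]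
    using integrable_min_sup[OF t] ZI Z by simp
  moreover have "b * ((1 - \<delta>) * (?\<mu> - measure (P 0) Z) - \<delta> * (2 * CARD('n) * ?\<mu>))
      \<le> b * ((1 - \<delta>) * (?\<mu> - measure (P 0) Z) - \<delta> * (LINT \<omega>|P 0. min (sup_n t \<omega>) 1))"
    using b(1) \<delta> expectation_min_sup_norm[OF t, of k]
    by (intro mult_left_mono diff_left_mono) auto
  ultimately show ?thesis using fin by (simp add: Z_def algebra_simps)
qed

section \<open>The limit of the heat loss\<close>

text \<open>For fixed \<open>\<delta>\<close> the quotient is eventually squeezed between two bounds that both tend to the
  perimeter as \<open>\<delta>\<close> tends to 0. The function \<open>u\<close> and the radius \<open>\<epsilon>\<close> depend on \<open>\<delta>\<close>; the perimeter does
  not.\<close>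

lemma heat_loss_limit:
  fixes \<phi> :: "real ^ 'n \<Rightarrow> real" and c :: real and \<mu> :: "real \<Rightarrow> real" and k :: 'n
  assumes \<mu>_def: "\<mu> = mean_truncated_sup P X k"
    and \<phi>: "C1 \<phi>" and bd: "bounded {x. 0 < \<phi> x}"
    and c: "0 < c" "\<And>x. x \<in> frontier {x. 0 < \<phi> x} \<Longrightarrow> c \<le> norm (grad \<phi> x)"
    and \<mu>: "\<forall>\<^sub>F t in at_right 0. \<mu> t \<noteq> 0"
    and small: "\<And>\<epsilon>. 0 < \<epsilon> \<Longrightarrow> ((\<lambda>t. 1 / \<mu> t * measure (P 0) {\<omega> \<in> space (P 0). running_sup X k t \<omega> > \<epsilon>})
           \<longlongrightarrow> 0) (at_right 0)"
  obtains p where "0 \<le> p" "perimeter {x. 0 < \<phi> x} = ereal p"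
    "((\<lambda>t. (measure lborel {x. 0 < \<phi> x} - spectral_heat_content P X {x. 0 < \<phi> x} t) / \<mu> t)
      \<longlongrightarrow> p) (at_right 0)"
proof -
  let ?\<Omega> = "{x. 0 < \<phi> x}"
  let ?V = "measure lborel ?\<Omega>"
  let ?q = "\<lambda>t. (?V - spectral_heat_content P X ?\<Omega> t) / \<mu> t"
  let ?d = "real (2 * CARD('n))"
  let ?T = "\<lambda>\<epsilon> t. measure (P 0) {\<omega> \<in> space (P 0). \<epsilon> < sup_n t \<omega>}"
  have \<mu>pos: "\<forall>\<^sub>F t in at_right 0. 0 < t \<and> 0 < \<mu> t"
    using \<mu> eventually_at_right_less[of "0 :: real"]
  proof eventually_elim
    case (elim t)
    then show ?case
      using mean_truncated_sup_nonneg[of t k] by (simp add: \<mu>_def less_le)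
  qed
  have tail: "\<forall>\<^sub>F t in at_right 0. ?T \<epsilon> t / \<mu> t < \<eta>" if \<epsilon>: "0 < \<epsilon>" and \<eta>: "0 < \<eta>" for \<epsilon> \<eta>
  proof -
    have d: "0 < ?d" by simp
    have "((\<lambda>t. ?d * (1 / \<mu> t * measure (P 0) {\<omega> \<in> space (P 0). running_sup X k t \<omega> > \<epsilon> / ?d}))
        \<longlongrightarrow> 0) (at_right 0)"
      by (intro tendsto_mult_right_zero small divide_pos_pos \<epsilon> d)
    then have "\<forall>\<^sub>F t in at_right 0.
        ?d * (1 / \<mu> t * measure (P 0) {\<omega> \<in> space (P 0). running_sup X k t \<omega> > \<epsilon> / ?d}) < \<eta>"
      using \<eta> by (rule order_tendstoD)
    then show ?thesis using \<mu>pos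
    proof eventually_elim
      case (elim t)
      have "?T \<epsilon> t / \<mu> t
          \<le> (?d * measure (P 0) {\<omega> \<in> space (P 0). running_sup X k t \<omega> > \<epsilon> / ?d}) / \<mu> t"
        using elim prob_sup_norm_gt[of t \<epsilon> k] \<epsilon> by (intro divide_right_mono) auto
      then show ?case using elim by simp
    qed
  qed
  have main: "\<exists>p\<ge>0. perimeter ?\<Omega> = ereal p \<and> (\<forall>\<^sub>F t in at_right 0.
      ?q t \<le> (p + \<delta>) / (1 - \<delta>)\<^sup>2 * ((1 + \<delta>) + ?d * \<delta>) + \<delta> \<and>
      max 0 ((p - \<delta>) / (1 + \<delta>)) * ((1 - \<delta>) * (1 - \<delta>) - ?d * \<delta>) \<le> ?q t)"
    if \<delta>: "0 < \<delta>" "\<delta> < 1" for \<delta>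
  proof -
    obtain u r where u: "C1 u" and iff: "\<And>x. 0 < u x \<longleftrightarrow> 0 < \<phi> x" and r: "0 < r"
      and g: "\<And>x. 0 < u x \<Longrightarrow> u x \<le> r \<Longrightarrow> 1 - \<delta> \<le> norm (grad u x) \<and> norm (grad u x) \<le> 1 + \<delta>"
      and gf: "\<And>x. x \<in> frontier {x. 0 < u x} \<Longrightarrow> grad u x \<noteq> 0"
      using normalized_defining_function[OF \<phi> bd c(1) _ \<delta>] c(2) by blast
    have \<Omega>: "{x. 0 < u x} = ?\<Omega>" using iff by simp
    have bu: "bounded {x. 0 < u x}" unfolding \<Omega> by (rule bd)
    have g0: "grad u x \<noteq> 0" if "0 < u x" "u x \<le> r" for x
      using g[OF that] \<delta> by auto
    obtain p where p: "0 \<le> p" "perimeter {x. 0 < u x} = ereal p"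
      and lay: "\<And>\<eta>. 0 < \<eta> \<Longrightarrow> \<forall>\<^sub>F m in at_right 0. p - \<eta> \<le> (1 + \<delta>) * layer_volume u m / m
        \<and> (1 - \<delta>)\<^sup>2 * layer_volume u m / m \<le> p + \<eta>"
      using perimeter_layer_volume[OF u bu r \<delta> g] by blast
    define a where "a = (p + \<delta>) / (1 - \<delta>)\<^sup>2"
    \<comment> \<open>The maximum matters only if the perimeter is smaller than \<open>\<delta>\<close>.\<close>
    define b where "b = max 0 ((p - \<delta>) / (1 + \<delta>))"
    have a: "0 \<le> a" using p(1) \<delta> by (simp add: a_def)
    have b: "0 \<le> b" by (simp add: b_def)
    obtain m1 where m1: "0 < m1" "\<And>m. 0 < m \<Longrightarrow> m < m1 \<Longrightarrow> p - \<delta> \<le> (1 + \<delta>) * layer_volume u m / m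
        \<and> (1 - \<delta>)\<^sup>2 * layer_volume u m / m \<le> p + \<delta>"
      using lay[OF \<delta>(1)] unfolding eventually_at_right_field by blast
    define m0 where "m0 = m1 / 2"
    have m0: "0 < m0" using m1(1) by (simp add: m0_def)
    have la: "layer_volume u m \<le> a * m" if "0 < m" "m \<le> m0" for m
    proof -
      have "(1 - \<delta>)\<^sup>2 * layer_volume u m / m \<le> p + \<delta>"
        using m1(2)[of m] that m1(1) by (simp add: m0_def)
      then show ?thesis
        using that \<delta> by (simp add: a_def field_simps)
    qed
    have lb: "b * m \<le> layer_volume u m" if "0 < m" "m \<le> m0" for m
    proof -
      have "p - \<delta> \<le> (1 + \<delta>) * layer_volume u m / m"
        using m1(2)[of m] that m1(1) by (simp add: m0_def)
      then have "(p - \<delta>) / (1 + \<delta>) * m \<le> layer_volume u m"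
        using that \<delta> by (simp add: field_simps)
      moreover have "0 \<le> layer_volume u m" by (simp add: layer_volume_def)
      ultimately show ?thesis by (simp add: b_def max_def)
    qed
    obtain \<epsilon>0 where \<epsilon>0: "0 < \<epsilon>0"
      and ex1: "\<And>R x. R \<subseteq> cball 0 \<epsilon>0 \<Longrightarrow> 0 \<in> R \<Longrightarrow> 0 < u x \<Longrightarrow> \<not> stays u R x \<Longrightarrow>
        u x \<le> r \<and> u x \<le> (1 + \<delta>) * sup_dir R (descent_dir u x) + \<delta> * sup_norm R"
      and ex2: "\<And>R x. R \<subseteq> cball 0 \<epsilon>0 \<Longrightarrow> 0 \<in> R \<Longrightarrow> 0 < u x \<Longrightarrow> u x \<le> r \<Longrightarrow>
        u x \<le> (1 - \<delta>) * sup_dir R (descent_dir u x) - \<delta> * sup_norm R \<Longrightarrow> \<not> stays u R x"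
      using exit_criterion[OF u bu r \<delta> g] by blast
    define \<epsilon> where "\<epsilon> = min (min \<epsilon>0 1) (min r (m0 / (1 + 2 * \<delta>)))"
    have \<epsilon>: "0 < \<epsilon>" "\<epsilon> \<le> \<epsilon>0" "\<epsilon> \<le> 1" "\<epsilon> \<le> r" "(1 + 2 * \<delta>) * \<epsilon> \<le> m0" "\<epsilon> \<le> m0"
    proof -
      show "0 < \<epsilon>" using \<epsilon>0 r m0 \<delta> by (simp add: \<epsilon>_def)
      show "\<epsilon> \<le> \<epsilon>0" "\<epsilon> \<le> 1" "\<epsilon> \<le> r" by (simp_all add: \<epsilon>_def)
      have "\<epsilon> \<le> m0 / (1 + 2 * \<delta>)" by (simp add: \<epsilon>_def)
      then show le: "(1 + 2 * \<delta>) * \<epsilon> \<le> m0" using \<delta> by (simp add: field_simps)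
      have "1 * \<epsilon> \<le> (1 + 2 * \<delta>) * \<epsilon>" using \<open>0 < \<epsilon>\<close> \<delta> by (intro mult_right_mono) auto
      then show "\<epsilon> \<le> m0" using le by simp
    qed
    have sub: "R \<subseteq> cball 0 \<epsilon>0" if "R \<subseteq> cball 0 \<epsilon>" for R :: "(real ^ 'n) set"
      using that \<epsilon>(2) by (auto simp: subset_iff)
    have V: "0 \<le> ?V" by simp
    have "\<forall>\<^sub>F t in at_right 0. ?T \<epsilon> t / \<mu> t < \<delta> / (?V + 1)"
      using \<delta> V by (intro tail \<epsilon>(1) divide_pos_pos) linarith+
    moreover have "\<forall>\<^sub>F t in at_right 0. ?T \<epsilon> t / \<mu> t < \<delta>"
      by (intro tail \<epsilon>(1) \<delta>(1))
    ultimately have "\<forall>\<^sub>F t in at_right 0. ?q t \<le> a * ((1 + \<delta>) + ?d * \<delta>) + \<delta> \<and>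
        b * ((1 - \<delta>) * (1 - \<delta>) - ?d * \<delta>) \<le> ?q t"
      using \<mu>pos
    proof eventually_elim
      case (elim t)
      then have t: "0 \<le> t" and \<mu>t: "0 < \<mu> t" by auto
      have up: "measure lborel {x. 0 < u x} - spectral_heat_content P X {x. 0 < u x} t
          \<le> measure lborel {x. 0 < u x} * ?T \<epsilon> t + a * ((1 + \<delta>) + ?d * \<delta>) * mean_truncated_sup P X k t"
        by (rule heat_loss_upper[OF u bu gf t \<delta> g0 a la \<epsilon>(1,3,5) ex1[OF sub]])
      have "?q t \<le> (?V * ?T \<epsilon> t + a * ((1 + \<delta>) + ?d * \<delta>) * \<mu> t) / \<mu> t"
        using up \<mu>t unfolding \<Omega> \<mu>_def by (intro divide_right_mono) auto
      also have "\<dots> = ?V * (?T \<epsilon> t / \<mu> t) + a * ((1 + \<delta>) + ?d * \<delta>)"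
        using \<mu>t by (simp add: add_divide_distrib)
      also have "?V * (?T \<epsilon> t / \<mu> t) \<le> ?V * (\<delta> / (?V + 1))"
        using elim(1) by (intro mult_left_mono) auto
      also have "?V * (\<delta> / (?V + 1)) \<le> \<delta>"
      proof -
        have "?V / (?V + 1) \<le> 1" by (simp add: add_nonneg_pos)
        then have "\<delta> * (?V / (?V + 1)) \<le> \<delta> * 1" using \<delta> by (intro mult_left_mono) auto
        then show ?thesis by (simp add: mult.commute)
      qed
      finally have 1: "?q t \<le> a * ((1 + \<delta>) + ?d * \<delta>) + \<delta>" by simp
      have lo: "b * ((1 - \<delta>) * (mean_truncated_sup P X k t - ?T \<epsilon> t) - ?d * \<delta> * mean_truncated_sup P X k t)
          \<le> measure lborel {x. 0 < u x} - spectral_heat_content P X {x. 0 < u x} t"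
        by (rule heat_loss_lower[OF u bu gf t \<delta> g0 b lb \<epsilon>(1,3,6,4) ex2[OF sub]])
      have "b * ((1 - \<delta>) * (1 - \<delta>) - ?d * \<delta>) \<le> b * ((1 - \<delta>) * (1 - ?T \<epsilon> t / \<mu> t) - ?d * \<delta>)"
        using b \<delta> elim(2) by (intro mult_left_mono diff_right_mono) auto
      also have "\<dots> = b * ((1 - \<delta>) * (\<mu> t - ?T \<epsilon> t) - ?d * \<delta> * \<mu> t) / \<mu> t"
        using \<mu>t by (simp add: field_simps)
      also have "\<dots> \<le> ?q t"
        using lo \<mu>t unfolding \<Omega> \<mu>_def by (intro divide_right_mono) auto
      finally show ?case using 1 by simp
    qed
    then show ?thesis using p by (auto simp: a_def b_def \<Omega>)
  qed
  obtain p where p: "0 \<le> p" "perimeter ?\<Omega> = ereal p"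
    using main[of "1 / 2"] by auto
  have bounds: "\<forall>\<^sub>F t in at_right 0.
      ?q t \<le> (p + \<delta>) / (1 - \<delta>)\<^sup>2 * ((1 + \<delta>) + ?d * \<delta>) + \<delta> \<and>
      max 0 ((p - \<delta>) / (1 + \<delta>)) * ((1 - \<delta>) * (1 - \<delta>) - ?d * \<delta>) \<le> ?q t"
    if "0 < \<delta>" "\<delta> < 1" for \<delta>
    using main[OF that] p(2) by auto
  have small\<delta>: "\<forall>\<^sub>F \<delta> in at_right 0. (0 :: real) < \<delta> \<and> \<delta> < 1"
    using eventually_at_right_real[of 0 1] by simp
  have limU: "((\<lambda>\<delta>. (p + \<delta>) / (1 - \<delta>)\<^sup>2 * ((1 + \<delta>) + ?d * \<delta>) + \<delta>) \<longlongrightarrow>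
      (p + 0) / (1 - 0)\<^sup>2 * ((1 + 0) + ?d * 0) + 0) (at_right 0)"
    by (intro tendsto_intros) auto
  have limL: "((\<lambda>\<delta>. max 0 ((p - \<delta>) / (1 + \<delta>)) * ((1 - \<delta>) * (1 - \<delta>) - ?d * \<delta>)) \<longlongrightarrow>
      max 0 ((p - 0) / (1 + 0)) * ((1 - 0) * (1 - 0) - ?d * 0)) (at_right 0)"
    by (intro tendsto_intros) auto
  have "(?q \<longlongrightarrow> p) (at_right 0)"
  proof (rule order_tendstoI)
    fix y assume y: "y < p"
    have "\<forall>\<^sub>F \<delta> in at_right 0. y < max 0 ((p - \<delta>) / (1 + \<delta>)) * ((1 - \<delta>) * (1 - \<delta>) - ?d * \<delta>)"
      using y p(1) by (intro order_tendstoD(1)[OF limL]) simp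
    then obtain \<delta> where \<delta>: "0 < \<delta>" "\<delta> < 1"
      "y < max 0 ((p - \<delta>) / (1 + \<delta>)) * ((1 - \<delta>) * (1 - \<delta>) - ?d * \<delta>)"
      using eventually_happens'[OF trivial_limit_at_right_real eventually_conj[OF small\<delta>]] by blast
    show "\<forall>\<^sub>F t in at_right 0. y < ?q t"
      using bounds[OF \<delta>(1,2)] by eventually_elim (use \<delta>(3) in linarith)
  next
    fix y assume y: "p < y"
    have "\<forall>\<^sub>F \<delta> in at_right 0. (p + \<delta>) / (1 - \<delta>)\<^sup>2 * ((1 + \<delta>) + ?d * \<delta>) + \<delta> < y"
      using y by (intro order_tendstoD(2)[OF limU]) simp
    then obtain \<delta> where \<delta>: "0 < \<delta>" "\<delta> < 1"
      "(p + \<delta>) / (1 - \<delta>)\<^sup>2 * ((1 + \<delta>) + ?d * \<delta>) + \<delta> < y"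
      using eventually_happens'[OF trivial_limit_at_right_real eventually_conj[OF small\<delta>]] by blast
    show "\<forall>\<^sub>F t in at_right 0. ?q t < y"
      using bounds[OF \<delta>(1,2)] by eventually_elim (use \<delta>(3) in linarith)
  qed
  then show thesis by (rule that[OF p])
qed

end

theorem theorem6p1:
  fixes \<kappa> :: real
    and \<phi> :: "real ^ 'n::finite \<Rightarrow> real"
    and \<Omega> :: "(real ^ 'n) set"
    and P :: "real ^ 'n \<Rightarrow> 'w measure"
    and X :: "real \<Rightarrow> 'w \<Rightarrow> real ^ 'n"
    and k :: 'n  \<comment> \<open>the coordinate called first; the index type carries no order\<close>
    and \<mu> :: "real \<Rightarrow> real"
  assumes "0 < \<kappa>" and "\<kappa> < 1" and "C1_kappa \<kappa> \<phi>"
    and "\<Omega> = \<phi> -` {0<..}" and "compact (closure \<Omega>)"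
    and "\<exists>c>0. \<exists>V. open V \<and> frontier \<Omega> \<subseteq> V \<and> (\<forall>x\<in>V. c \<le> norm (grad \<phi> x))"
    and "cadlag_process P X" and "translation_invariant P X" and "isotropic P X"
    and "\<mu> = mean_truncated_sup P X k"
    \<comment> \<open>the quotients by \<open>\<mu> t\<close> are meaningful; division by zero would otherwise return zero\<close>
    and "\<forall>\<^sub>F t in at_right 0. \<mu> t \<noteq> 0"
    and "\<forall>\<epsilon>>0. ((\<lambda>t. 1 / \<mu> t * measure (P 0) {\<omega> \<in> space (P 0). running_sup X k t \<omega> > \<epsilon>})
           \<longlongrightarrow> 0) (at_right 0)"
  shows "perimeter \<Omega> \<le>
           Liminf (at_right 0) (\<lambda>t. ereal ((measure lborel \<Omega> - spectral_heat_content P X \<Omega> t) / \<mu> t))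
       \<and> Liminf (at_right 0) (\<lambda>t. ereal ((measure lborel \<Omega> - spectral_heat_content P X \<Omega> t) / \<mu> t)) \<le>
           Limsup (at_right 0) (\<lambda>t. ereal ((measure lborel \<Omega> - spectral_heat_content P X \<Omega> t) / \<mu> t))
       \<and> Limsup (at_right 0) (\<lambda>t. ereal ((measure lborel \<Omega> - spectral_heat_content P X \<Omega> t) / \<mu> t)) \<le>
           ereal ((SUP x\<in>frontier \<Omega>. norm (grad \<phi> x)) / (INF x\<in>frontier \<Omega>. norm (grad \<phi> x))) * perimeter \<Omega>"
proof -
  interpret isotropic_process P X
    by standard (rule assms)+
  have \<phi>: "C1 \<phi>" using assms(3) by (auto simp: C1_kappa_def C1_def)
  have \<Omega>: "\<Omega> = {x. 0 < \<phi> x}" using assms(4) by auto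
  have bd: "bounded \<Omega>"
    using assms(5) closure_subset bounded_subset compact_imp_bounded by metis
  obtain c V where c: "0 < c" "frontier \<Omega> \<subseteq> V" "\<And>x. x \<in> V \<Longrightarrow> c \<le> norm (grad \<phi> x)"
    using assms(6) by blast
  have cf: "c \<le> norm (grad \<phi> x)" if "x \<in> frontier \<Omega>" for x
    using c(2,3) that by blast
  let ?q = "\<lambda>t. (measure lborel \<Omega> - spectral_heat_content P X \<Omega> t) / \<mu> t"
  obtain p where p: "0 \<le> p" "perimeter \<Omega> = ereal p" "(?q \<longlongrightarrow> p) (at_right 0)"
    by (rule heat_loss_limit[OF assms(10) \<phi>, folded \<Omega>, OF bd c(1) _ assms(11)])
      (use cf assms(12) in blast)+
  have lim: "((\<lambda>t. ereal (?q t)) \<longlongrightarrow> ereal p) (at_right 0)"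
    using p(3) by (rule tendsto_ereal)
  have L: "Liminf (at_right 0) (\<lambda>t. ereal (?q t)) = ereal p"
    "Limsup (at_right 0) (\<lambda>t. ereal (?q t)) = ereal p"
    using lim_imp_Liminf[OF _ lim] lim_imp_Limsup[OF _ lim] by simp_all
  let ?S = "SUP x\<in>frontier \<Omega>. norm (grad \<phi> x)" and ?I = "INF x\<in>frontier \<Omega>. norm (grad \<phi> x)"
  have "ereal p \<le> ereal (?S / ?I) * ereal p"
  proof (cases "frontier \<Omega> = {}")
    case True
    then have "\<Omega> = {}" using bd by (rule frontier_eq_empty_bounded)
    then have "ereal p = 0" using p(2) by (simp add: perimeter_empty)
    then have "p = 0" by simp
    then show ?thesis by simp
  next
    case False
    then obtain z where z: "z \<in> frontier \<Omega>" by blast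
    have "bounded ((\<lambda>x. norm (grad \<phi> x)) ` frontier \<Omega>)"
      by (intro compact_imp_bounded compact_continuous_image compact_frontier_bounded[OF bd]
          continuous_on_norm C1_continuous_grad \<phi>)
    then have ba: "bdd_above ((\<lambda>x. norm (grad \<phi> x)) ` frontier \<Omega>)"
      "bdd_below ((\<lambda>x. norm (grad \<phi> x)) ` frontier \<Omega>)"
      by (auto intro: bounded_imp_bdd_above bounded_imp_bdd_below)
    have "c \<le> ?I" using False cf by (intro cINF_greatest) auto
    moreover have "?I \<le> norm (grad \<phi> z)" by (rule cINF_lower[OF ba(2) z])
    moreover have "norm (grad \<phi> z) \<le> ?S" by (rule cSUP_upper[OF z ba(1)])
    ultimately have "1 \<le> ?S / ?I" using c(1) by simp
    then have "1 * p \<le> ?S / ?I * p" using p(1) by (rule mult_right_mono)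
    then show ?thesis by simp
  qed
  then show ?thesis unfolding L p(2) by simp
qed

end
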